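(* Let $1<p<\infty$, $1<s<\infty$, let $X$ be a Banach space of analytic functions in $\mathbb{D}$ with $\Lambda^s_{1/s}\subseteq X\subseteq\mathcal{B}$, and let $\mu$ be a finite positive Borel measure on $[0,1)$. Let $q$ be the real number satisfying $\frac1p+\frac1q=1$. Then the following conditions are equivalent: (i) $\mathcal{C}_\mu$ is a compact operator from $B_p$ into $X$; (ii) $\mu$ is a vanishing $\frac1q$-logarithmic $1$-Carleson measure.
   Context: $\mathbb{D}$ is the open unit disk of $\mathbb{C}$ and $H(\mathbb{D})$ is the space of functions analytic in $\mathbb{D}$. A Banach space of analytic functions in $\mathbb{D}$ is, as usual, a Banach space whose elements are functions in $H(\mathbb{D})$ (with the usual vector space operations) and on which the point evaluations at points of $\mathbb{D}$ are continuous. For a finite positive Borel measure $\mu$ on $[0,1)$ and an integer $n\ge 0$, let $\mu_n=\int_{[0,1)}t^n\,\mathrm{d}\mu(t)$. For $f(z)=\sum_{n=0}^\infty a_nz^n$ in $H(\mathbb{D})$, the Cesàro-like operator $\mathcal{C}_\mu$ is $$\mathcal{C}_\mu(f)(z)=\sum_{n=0}^\infty\Big(\mu_n\sum_{k=0}^n a_k\Big)z^n,\quad z\in\mathbb{D}.$$ For $p>1$, the Besov space $B_p$ consists of $f\in H(\mathbb{D})$ with $$\|f\|_{B_p}=|f(0)|+\Big(\int_{\mathbb{D}}|f'(z)|^p(1-|z|^2)^{p-2}\,\mathrm{d}A(z)\Big)^{1/p}<\infty,$$ where $\mathrm{d}A$ is area measure normalized so that $A(\mathbb{D})=1$. The Bloch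 space $\mathcal{B}$ consists of $f\in H(\mathbb{D})$ with $\|f\|_{\mathcal{B}}=|f(0)|+\sup_{z\in\mathbb{D}}(1-|z|^2)|f'(z)|<\infty$. For $s>1$, the mean Lipschitz space $\Lambda^s_{1/s}$ consists of $f\in H(\mathbb{D})$ with $$\|f\|_{\Lambda^s_{1/s}}=|f(0)|+\sup_{0<r<1}(1-r)^{1-\frac1s}M_s(r,f')<\infty,\qquad M_s(r,f')=\Big(\frac1{2\pi}\int_0^{2\pi}|f'(re^{i\theta})|^s\,\mathrm{d}\theta\Big)^{1/s}.$$ For $0\le\alpha<\infty$ and $0<\sigma<\infty$, a finite positive Borel measure $\nu$ on $[0,1)$ is a vanishing $\alpha$-logarithmic $\sigma$-Carleson measure if $$\lim_{t\to1^-}\frac{\nu([t,1))\big(\log\frac{e}{1-t}\big)^\alpha}{(1-t)^\sigma}=0.$$ *)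

theory Defs
  imports "HOL-Analysis.Analysis"
begin

abbreviation unit_disk :: "complex set" where
  "unit_disk \<equiv> ball 0 1"

text \<open>
  A function on the disk is represented by the total function that extends it by 0, so that
  equality of elements of \<open>hol_disk\<close> is equality on the disk.
\<close>

definition hol_disk :: "(complex \<Rightarrow> complex) set" where
  "hol_disk = {f. f holomorphic_on unit_disk \<and> (\<forall>z. z \<notin> unit_disk \<longrightarrow> f z = 0)}"

text \<open>
  The library's metric spaces require a distance that is symmetric and nonnegative on the whole
  type, while nothing is assumed about a norm \<open>N\<close> off its space \<open>X\<close>; hence the value 0 there.
\<close>

definition norm_dist ::
    "(complex \<Rightarrow> complex) set \<Rightarrow> ((complex \<Rightarrow> complex) \<Rightarrow> real) \<Rightarrow>
     (complex \<Rightarrow> complex) \<Rightarrow> (complex \<Rightarrow> complex) \<Rightarrow> real" where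
  "norm_dist X N f g = (if f \<in> X \<and> g \<in> X then N (\<lambda>z. f z - g z) else 0)"

abbreviation norm_topology ::
    "(complex \<Rightarrow> complex) set \<Rightarrow> ((complex \<Rightarrow> complex) \<Rightarrow> real) \<Rightarrow> (complex \<Rightarrow> complex) topology" where
  "norm_topology X N \<equiv> Metric_space.mtopology X (norm_dist X N)"

locale normed_function_space =
  fixes X :: "(complex \<Rightarrow> complex) set" and N :: "(complex \<Rightarrow> complex) \<Rightarrow> real"
  assumes zero_mem: "(\<lambda>z. 0) \<in> X"
    and add_mem: "\<And>f g. f \<in> X \<Longrightarrow> g \<in> X \<Longrightarrow> (\<lambda>z. f z + g z) \<in> X"
    and scale_mem: "\<And>c f. f \<in> X \<Longrightarrow> (\<lambda>z. c * f z) \<in> X"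
    and norm_nonneg: "\<And>f. f \<in> X \<Longrightarrow> 0 \<le> N f"
    and norm_eq_zero: "\<And>f. f \<in> X \<Longrightarrow> N f = 0 \<longleftrightarrow> f = (\<lambda>z. 0)"
    and norm_triangle: "\<And>f g. f \<in> X \<Longrightarrow> g \<in> X \<Longrightarrow> N (\<lambda>z. f z + g z) \<le> N f + N g"
    and norm_scale: "\<And>c f. f \<in> X \<Longrightarrow> N (\<lambda>z. c * f z) = cmod c * N f"
begin

lemma diff_mem: "f \<in> X \<Longrightarrow> g \<in> X \<Longrightarrow> (\<lambda>z. f z - g z) \<in> X"
  using add_mem[of f "\<lambda>z. (-1) * g z"] scale_mem[of g "-1"] by simp

lemma norm_minus_commute: "f \<in> X \<Longrightarrow> g \<in> X \<Longrightarrow> N (\<lambda>z. f z - g z) = N (\<lambda>z. g z - f z)"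
  using norm_scale[of "\<lambda>z. f z - g z" "-1"] diff_mem[of f g] by simp

lemma Metric_space_norm_dist: "Metric_space X (norm_dist X N)"
proof
  fix f g h
  show "0 \<le> norm_dist X N f g"
    by (simp add: norm_dist_def norm_nonneg diff_mem)
  show "norm_dist X N f g = norm_dist X N g f"
    using norm_minus_commute[of f g] by (simp add: norm_dist_def)
  show "norm_dist X N f g = 0 \<longleftrightarrow> f = g" if "f \<in> X" "g \<in> X"
    using that by (simp add: norm_dist_def norm_eq_zero diff_mem fun_eq_iff)
  show "norm_dist X N f h \<le> norm_dist X N f g + norm_dist X N g h"
    if "f \<in> X" "g \<in> X" "h \<in> X"
    using norm_triangle[of "\<lambda>z. f z - g z" "\<lambda>z. g z - h z"] that
    by (simp add: norm_dist_def diff_mem)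
qed

end

locale banach_space_of_analytic_functions = normed_function_space X N for X N +
  assumes subset_hol_disk: "X \<subseteq> hol_disk"
    and complete: "Metric_space.mcomplete X (norm_dist X N)"
    and continuous_eval: "\<And>z. z \<in> unit_disk \<Longrightarrow> continuous_map (norm_topology X N) euclidean (\<lambda>f. f z)"

definition linear_map ::
    "(complex \<Rightarrow> complex) set \<Rightarrow> (complex \<Rightarrow> complex) set \<Rightarrow>
     ((complex \<Rightarrow> complex) \<Rightarrow> (complex \<Rightarrow> complex)) \<Rightarrow> bool" where
  "linear_map Y X T \<longleftrightarrow>
     T ` Y \<subseteq> X \<and>
     (\<forall>f\<in>Y. \<forall>g\<in>Y. T (\<lambda>z. f z + g z) = (\<lambda>z. T f z + T g z)) \<and>
     (\<forall>c. \<forall>f\<in>Y. T (\<lambda>z. c * f z) = (\<lambda>z. c * T f z))"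

definition compact_operator ::
    "(complex \<Rightarrow> complex) set \<Rightarrow> ((complex \<Rightarrow> complex) \<Rightarrow> real) \<Rightarrow>
     (complex \<Rightarrow> complex) set \<Rightarrow> ((complex \<Rightarrow> complex) \<Rightarrow> real) \<Rightarrow>
     ((complex \<Rightarrow> complex) \<Rightarrow> (complex \<Rightarrow> complex)) \<Rightarrow> bool" where
  "compact_operator Y NY X NX T \<longleftrightarrow>
     linear_map Y X T \<and>
     (\<forall>S\<subseteq>Y. bdd_above (NY ` S) \<longrightarrow>
        compactin (norm_topology X NX) (norm_topology X NX closure_of (T ` S)))"

definition disk_area :: "complex measure" where
  "disk_area = uniform_measure lborel unit_disk"

definition besov_space :: "real \<Rightarrow> (complex \<Rightarrow> complex) set" where
  "besov_space p = {f \<in> hol_disk.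
     set_integrable disk_area unit_disk
       (\<lambda>z. cmod (deriv f z) powr p * (1 - (cmod z)\<^sup>2) powr (p - 2))}"

definition besov_norm :: "real \<Rightarrow> (complex \<Rightarrow> complex) \<Rightarrow> real" where
  "besov_norm p f = cmod (f 0) +
     (LINT z:unit_disk|disk_area. cmod (deriv f z) powr p * (1 - (cmod z)\<^sup>2) powr (p - 2)) powr (1 / p)"

definition bloch_space :: "(complex \<Rightarrow> complex) set" where
  "bloch_space = {f \<in> hol_disk. bdd_above ((\<lambda>z. (1 - (cmod z)\<^sup>2) * cmod (deriv f z)) ` unit_disk)}"

definition integral_mean :: "real \<Rightarrow> real \<Rightarrow> (complex \<Rightarrow> complex) \<Rightarrow> real" where
  "integral_mean s r g = (1 / (2 * pi) * integral {0..2 * pi} (\<lambda>\<theta>. cmod (g (rcis r \<theta>)) powr s)) powr (1 / s)"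

definition mean_lipschitz_space :: "real \<Rightarrow> (complex \<Rightarrow> complex) set" where
  "mean_lipschitz_space s = {f \<in> hol_disk.
     bdd_above ((\<lambda>r. (1 - r) powr (1 - 1 / s) * integral_mean s r (deriv f)) ` {0<..<1})}"

definition finite_borel_measure_01 :: "real measure \<Rightarrow> bool" where
  "finite_borel_measure_01 \<mu> \<longleftrightarrow> sets \<mu> = sets (restrict_space borel {0..<1}) \<and> finite_measure \<mu>"

definition vanishing_log_carleson :: "real \<Rightarrow> real \<Rightarrow> real measure \<Rightarrow> bool" where
  "vanishing_log_carleson \<alpha> \<sigma> \<nu> \<longleftrightarrow>
     ((\<lambda>t. measure \<nu> {t..<1} * ln (exp 1 / (1 - t)) powr \<alpha> / (1 - t) powr \<sigma>) \<longlongrightarrow> 0) (at_left 1)"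

definition moment :: "real measure \<Rightarrow> nat \<Rightarrow> real" where
  "moment \<mu> n = (LINT t|\<mu>. t ^ n)"

definition taylor_coeff :: "(complex \<Rightarrow> complex) \<Rightarrow> nat \<Rightarrow> complex" where
  "taylor_coeff f n = (deriv ^^ n) f 0 / fact n"

definition cesaro_op :: "real measure \<Rightarrow> (complex \<Rightarrow> complex) \<Rightarrow> (complex \<Rightarrow> complex)" where
  "cesaro_op \<mu> f z =
     (if z \<in> unit_disk
      then \<Sum>n. (of_real (moment \<mu> n) * (\<Sum>k\<le>n. taylor_coeff f k)) * z ^ n
      else 0)"

end

theory Submission
  imports Defs "HOL-Complex_Analysis.Complex_Analysis"
begin

text \<open>
  The Taylor coefficients of \<open>f(w) / (1 - w)\<close> are the partial sums of those of \<open>f\<close>, so the series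
  defining the operator is \<open>\<integral> f(tz) / (1 - tz) d\<mu>(t)\<close>, and it may be differentiated under the integral.
  Both implications are read off this formula. Put \<open>\<alpha> = 1/q = 1 - 1/p\<close>.

  The Carleson condition is sufficient. A function in the Besov space grows at most like
  \<open>(ln (e / (1 - |z|)))\<^sup>\<alpha>\<close> and its derivative at most like \<open>1 / (1 - |z|)\<close> (\<open>besov_growth\<close>). Inserted in
  the differentiated integral, these bounds and the Carleson condition give, for each \<open>\<delta>\<close> in \<open>(0, 1)\<close>,
  a pointwise bound of the derivative of the image by a constant times
  \<open>(1 - |z|) powr - \<delta> * |1 - z| powr - (1 - \<delta>)\<close>; the logarithm of the growth and the logarithm of the
  Carleson condition cancel, and the constant is small if \<open>f\<close> is small on a large compact disk and the
  tail of \<open>\<mu>\<close> is small (\<open>deriv_cesaro_op_bound\<close>). The functions that satisfy such a bound form a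
  Banach space, the slit space below. It lies in the mean Lipschitz space as soon as \<open>(1 - \<delta>) s > 1\<close>,
  because the mean of \<open>|1 - r e^(i \<theta>)| powr - \<sigma>\<close> is at most of order \<open>(1 - r) powr (1 - \<sigma>)\<close> for \<open>\<sigma> > 1\<close>. A pointwise
  bound takes the place of Minkowski's integral inequality, and of the completeness of the mean Lipschitz
  space. A closed graph argument makes the inclusion of the slit space in \<open>X\<close> bounded. By Montel's theorem
  a bounded sequence in the Besov space has a locally uniformly convergent subsequence, and
  the images of its differences are small in the slit space, hence in \<open>X\<close>.

  The Carleson condition is necessary. The functions \<open>(ln (e / (1 - a))) powr (- 1/p) * (1 - Ln (1 - a z))\<close>
  are bounded in the Besov space and tend to 0 locally uniformly as \<open>a\<close> tends to 1. Compactness therefore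
  sends their images to 0 in \<open>X\<close>, and a closed graph argument sends them to 0 in the Bloch seminorm. At the point
  \<open>z = a\<close> the integrand of the differentiated formula is nonnegative, and its part over \<open>[a, 1)\<close> is already of
  order \<open>\<mu>[a, 1) (ln (e / (1 - a)))\<^sup>\<alpha> / (1 - a)\<^sup>2\<close>. Multiplied by \<open>1 - a\<^sup>2\<close>, this is the Carleson quotient.

  Three tools carry the estimates: integration in polar coordinates (\<open>nn_integral_polar\<close>), which gives the
  submean value property over disks and the norm of the test functions; dyadic decomposition near the
  circle, used for the growth of Besov functions and for the integrals against \<open>\<mu>\<close>; and Zabreiko's lemma
  that a countably subadditive seminorm on a Banach space is bounded
  (\<open>bounded_if_countably_subadditive\<close>), which supplies all closed graph arguments.
\<close>

(* Here $ denotes vector components only. *)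
no_notation fps_nth (infixl "$" 75)

section \<open>Polar coordinates\<close>

definition polar :: "real^2 \<Rightarrow> real^2" where
  "polar v = vector [v$1 * cos (v$2), v$1 * sin (v$2)]"

definition polar_deriv :: "real^2 \<Rightarrow> real^2 \<Rightarrow> real^2" where
  "polar_deriv v h = vector [h$1 * cos (v$2) - v$1 * sin (v$2) * h$2,
      h$1 * sin (v$2) + v$1 * cos (v$2) * h$2]"

text \<open>
  The change of variables theorem speaks about \<open>real^2\<close> and Fubini's theorem about products, so the area
  measure is carried from \<open>complex\<close> to \<open>real^2\<close> and from there to \<open>real \<times> real\<close>. It suffices to compare boxes.
\<close>

lemma lborel_eq_distr_complex: "lborel = distr (lborel :: (real^2) measure) borel (\<lambda>v. Complex (v$1) (v$2))"
proof (rule lborel_eqI)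
  fix l u :: complex
  assume le: "\<And>b. b \<in> Basis \<Longrightarrow> l \<bullet> b \<le> u \<bullet> b"
  have eq: "(\<lambda>v. Complex (v$1) (v$2)) -` box l u
      = box (vector [Re l, Im l] :: real^2) (vector [Re u, Im u])"
    by (auto simp: in_box_complex_iff mem_box_cart forall_2)
  have m: "(\<lambda>v::real^2. Complex (v$1) (v$2)) \<in> borel_measurable borel"
    by (intro borel_measurable_continuous_onI) (auto simp: Complex_eq intro!: continuous_intros)
  have "Re l \<le> Re u" "Im l \<le> Im u"
    using le[of 1] le[of \<i>] by (auto simp: Basis_complex_def)
  then have le2: "\<forall>b\<in>Basis. (vector [Re l, Im l] :: real^2) \<bullet> b \<le> vector [Re u, Im u] \<bullet> b"
    by (auto simp: Basis_vec_def inner_axis UNIV_2)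
  have "emeasure (distr lborel borel (\<lambda>v::real^2. Complex (v$1) (v$2))) (box l u)
      = emeasure lborel (box (vector [Re l, Im l] :: real^2) (vector [Re u, Im u]))"
    using m by (subst emeasure_distr) (simp_all add: eq)
  also have "\<dots> = (\<Prod>b\<in>Basis. (u - l) \<bullet> b)"
    using le2 by (simp add: emeasure_lborel_box_eq Basis_complex_def)
      (simp add: Basis_vec_def inner_axis UNIV_2 axis_eq_axis forall_2)
  finally show "emeasure (distr lborel borel (\<lambda>v::real^2. Complex (v$1) (v$2))) (box l u)
      = (\<Prod>b\<in>Basis. (u - l) \<bullet> b)" .
qed simp

lemma borel_measurable_vector_2: "(\<lambda>(x, y). vector [x, y] :: real^2) \<in> borel_measurable borel"
  proof -
    have "(\<lambda>(x, y). vector [x, y] :: real^2) = (\<lambda>p. fst p *\<^sub>R axis 1 1 + snd p *\<^sub>R axis 2 1)"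
      by (auto simp: fun_eq_iff vec_eq_iff forall_2 axis_def)
    then show ?thesis
      by (auto intro!: borel_measurable_continuous_onI continuous_intros)
  qed

lemma lborel_eq_distr_pair: "lborel = distr (lborel :: (real \<times> real) measure) borel (\<lambda>(x, y). vector [x, y] :: real^2)"
proof (rule lborel_eqI)
  fix l u :: "real^2"
  assume le: "\<And>b. b \<in> Basis \<Longrightarrow> l \<bullet> b \<le> u \<bullet> b"
  have eq: "(\<lambda>(x, y). vector [x, y] :: real^2) -` box l u
      = box (l$1, l$2) (u$1, u$2)"
    by (auto simp: box_def Basis_prod_def mem_box_cart forall_2 Basis_vec_def inner_axis UNIV_2)
  note m = borel_measurable_vector_2
  have "l$1 \<le> u$1" "l$2 \<le> u$2"
    using le[of "axis 1 1"] le[of "axis 2 1"] by (auto simp: axis_in_Basis_iff inner_axis)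
  then have le2: "\<forall>b\<in>Basis. (l$1, l$2) \<bullet> b \<le> (u$1, u$2) \<bullet> b"
    by (auto simp: Basis_prod_def)
  have "emeasure (distr lborel borel (\<lambda>(x, y). vector [x, y] :: real^2)) (box l u)
      = emeasure lborel (box (l$1, l$2) (u$1, u$2))"
    using m by (subst emeasure_distr) (simp_all add: eq)
  also have "\<dots> = (\<Prod>b\<in>Basis. (u - l) \<bullet> b)"
    using le2 by (simp add: emeasure_lborel_box_eq Basis_vec_def inner_axis UNIV_2 axis_eq_axis)
      (simp add: Basis_prod_def)
  finally show "emeasure (distr lborel borel (\<lambda>(x, y). vector [x, y] :: real^2)) (box l u)
      = (\<Prod>b\<in>Basis. (u - l) \<bullet> b)" .
qed simp

lemma has_derivative_polar: "(polar has_derivative polar_deriv v) (at v within S)"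
proof -
  have d: "((\<lambda>v. v$i) has_derivative (\<lambda>h. h$i)) (at v within S)" for i and v :: "real^2"
    by (rule bounded_linear_imp_has_derivative[OF bounded_linear_vec_nth])
  have c: "((\<lambda>v. v$1 * cos (v$2)) has_derivative (\<lambda>h. h$1 * cos (v$2) - v$1 * sin (v$2) * h$2)) (at v within S)"
    by (rule has_derivative_eq_rhs[OF has_derivative_mult[OF d has_derivative_cos[OF d]]]) auto
  have s: "((\<lambda>v. v$1 * sin (v$2)) has_derivative (\<lambda>h. h$1 * sin (v$2) + v$1 * cos (v$2) * h$2)) (at v within S)"
    by (rule has_derivative_eq_rhs[OF has_derivative_mult[OF d has_derivative_sin[OF d]]]) auto
  have p: "polar = (\<lambda>v. (v$1 * cos (v$2)) *\<^sub>R axis 1 1 + (v$1 * sin (v$2)) *\<^sub>R axis 2 1)"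
    by (auto simp: polar_def fun_eq_iff vec_eq_iff forall_2 axis_def)
  have q: "polar_deriv v = (\<lambda>h. (h$1 * cos (v$2) - v$1 * sin (v$2) * h$2) *\<^sub>R axis 1 1
      + (h$1 * sin (v$2) + v$1 * cos (v$2) * h$2) *\<^sub>R axis 2 1)"
    by (auto simp: polar_deriv_def fun_eq_iff vec_eq_iff forall_2 axis_def)
  show ?thesis unfolding p q
    by (intro has_derivative_add has_derivative_scaleR_left c s)
qed

lemma det_polar_deriv: "det (matrix (polar_deriv v)) = v$1"
proof -
  have "det (matrix (polar_deriv v)) = v$1 * (cos (v$2))\<^sup>2 + v$1 * (sin (v$2))\<^sup>2"
    by (simp add: det_2 matrix_def axis_def polar_deriv_def power2_eq_square)
  then show ?thesis by (simp add: distrib_left[symmetric])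
qed

lemma inj_on_polar: "inj_on polar {v. 0 < v$1 \<and> 0 < v$2 \<and> v$2 < 2 * pi}"
proof (rule inj_onI)
  fix v w :: "real^2"
  assume v: "v \<in> {v. 0 < v$1 \<and> 0 < v$2 \<and> v$2 < 2 * pi}"
    and w: "w \<in> {v. 0 < v$1 \<and> 0 < v$2 \<and> v$2 < 2 * pi}" and eq: "polar v = polar w"
  have e: "rcis (v$1) (v$2) = rcis (w$1) (w$2)"
    using eq by (auto simp: polar_def complex_eq_iff vec_eq_iff forall_2)
  have 1: "v$1 = w$1" using arg_cong[OF e, of cmod] v w by simp
  have a: "Arg2pi (rcis r t) = t" if "0 < r" "0 < t" "t < 2*pi" for r t
    using that by (intro Arg2pi_unique[of r]) (auto simp: rcis_def cis_conv_exp)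
  have 2: "v$2 = w$2" using arg_cong[OF e, of Arg2pi] v w by (simp add: a)
  show "v = w" using 1 2 by (simp add: vec_eq_iff forall_2)
qed

lemma polar_image: "{v. v$2 \<noteq> 0} \<subseteq> polar ` {v. 0 < v$1 \<and> 0 < v$2 \<and> v$2 < 2 * pi}"
proof
  fix v :: "real^2" assume v: "v \<in> {v. v$2 \<noteq> 0}"
  let ?z = "Complex (v$1) (v$2)"
  have nz: "?z \<noteq> 0" using v by (auto simp: complex_eq_iff)
  have "Arg2pi ?z \<noteq> 0" using v by (auto simp: Arg2pi_eq_0 complex_is_Real_iff)
  then have t: "0 < Arg2pi ?z" "Arg2pi ?z < 2 * pi"
    using Arg2pi_ge_0[of ?z] Arg2pi_lt_2pi[of ?z] by auto
  have e: "?z = rcis (cmod ?z) (Arg2pi ?z)"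
    using Arg2pi_eq[of ?z] by (simp add: rcis_def cis_conv_exp)
  have "polar (vector [cmod ?z, Arg2pi ?z]) = v"
    using arg_cong[OF e, of Re] arg_cong[OF e, of Im] by (simp add: polar_def vec_eq_iff forall_2)
  moreover have "(vector [cmod ?z, Arg2pi ?z] :: real^2) \<in> {v. 0 < v$1 \<and> 0 < v$2 \<and> v$2 < 2 * pi}"
    using t nz by simp
  ultimately show "v \<in> polar ` {v. 0 < v$1 \<and> 0 < v$2 \<and> v$2 < 2 * pi}" by (rule image_eqI[OF sym])
qed

lemma continuous_on_polar: "continuous_on A polar"
  by (rule continuous_at_imp_continuous_on) (auto intro: has_derivative_continuous[OF has_derivative_polar])

lemma open_polar_region:
  assumes "open B"
  shows "open {v. 0 < v$1 \<and> 0 < v$2 \<and> v$2 < 2 * pi \<and> polar v \<in> B}"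
proof -
  have "{v. 0 < v$1 \<and> 0 < v$2 \<and> v$2 < 2 * pi \<and> polar v \<in> B}
      = {v. 0 < v$1} \<inter> {v. 0 < v$2} \<inter> {v. v$2 < 2*pi} \<inter> polar -` B"
    by auto
  moreover have "open (polar -` B)"
    using continuous_on_polar[of UNIV] assms by (simp add: continuous_on_open_vimage)
  ultimately show ?thesis
    by (auto intro!: open_Int open_halfspace_component_gt_cart open_halfspace_component_lt_cart)
qed

text \<open>
  On the open half-strip \<open>polar\<close> is injective and misses only a half-line, a null set, so the change of
  variables theorem with Jacobian \<open>v$1\<close> computes the measure of \<open>B\<close>.
\<close>

lemma measure_polar_vimage:
  fixes B :: "(real^2) set"
  assumes B: "open B" "bounded B"
  defines "S \<equiv> {v. 0 < v$1 \<and> 0 < v$2 \<and> v$2 < 2 * pi \<and> polar v \<in> B}"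
  shows "(\<integral>\<^sup>+v. ennreal (indicator S v * v$1) \<partial>lborel) = emeasure lborel B"
proof -
  have oS: "open S" unfolding S_def by (rule open_polar_region[OF B(1)])
  have inj: "inj_on polar S" by (rule inj_on_subset[OF inj_on_polar]) (auto simp: S_def)
  have sub: "polar ` S \<subseteq> B" by (auto simp: S_def)
  have "B - polar ` S \<subseteq> {v. v$2 = 0}" using polar_image by (auto simp: S_def)
  moreover have "negligible {v::real^2. v$2 = 0}" by (rule negligible_standard_hyperplane_cart)
  ultimately have neg: "negligible (B - polar ` S)" using negligible_subset by blast
  have Bm: "B \<in> lmeasurable" using B by (simp add: lmeasurable_open)
  have "sym_diff B (polar ` S) = B - polar ` S" using sub by auto
  then have negs: "negligible (sym_diff B (polar ` S))" using neg by simp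
  have "polar ` S \<in> lmeasurable" and "measure lebesgue (polar ` S) = measure lebesgue B"
    using lmeasurable_negligible_symdiff[OF Bm negs] measure_negligible_symdiff[of B "polar ` S"] Bm negs by (auto simp: fmeasurableD)
  then have "((\<lambda>v. \<bar>det (matrix (polar_deriv v))\<bar>) has_integral measure lebesgue B) S"
    using has_measure_differentiable_image[OF _ has_derivative_polar inj, of "measure lebesgue B"] oS
    by simp
  then have "((\<lambda>v. v$1) has_integral measure lebesgue B) S"
    by (rule has_integral_eq[rotated]) (auto simp: det_polar_deriv S_def)
  then have hi: "((\<lambda>v. indicator S v * v$1) has_integral measure lebesgue B) UNIV"
  proof -
    have "(\<lambda>v. indicator S v * v$1) = (\<lambda>v. if v \<in> S then v$1 else 0)" by (auto simp: indicator_def)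
    then show ?thesis
      using \<open>((\<lambda>v. v$1) has_integral measure lebesgue B) S\<close> by (simp only: has_integral_restrict_UNIV)
  qed
  have "(\<integral>\<^sup>+v. ennreal (indicator S v * v$1) \<partial>lborel) = ennreal (measure lebesgue B)"
  proof (rule nn_integral_has_integral_lborel[OF _ _ hi])
    show "(\<lambda>v. indicator S v * v $ 1) \<in> borel_measurable borel"
      using oS by (auto intro!: borel_measurable_times borel_measurable_indicator borel_measurable_continuous_onI continuous_intros)
    show "0 \<le> indicator S v * v $ 1" for v by (auto simp: S_def indicator_def)
  qed
  also have "\<dots> = emeasure lborel B"
    using emeasure_bounded_finite[OF B(2)] B(1) by (simp add: emeasure_eq_ennreal_measure less_top)
  finally show ?thesis .
qed

abbreviation polar_density :: "real \<Rightarrow> real \<Rightarrow> ennreal" where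
  "polar_density r \<theta> \<equiv> ennreal (indicator ({0<..} \<times> {0<..<2*pi}) (r, \<theta>) * r)"

text \<open>
  The image of \<open>r dr d\<theta>\<close> under \<open>(r, \<theta>) \<mapsto> rcis r \<theta>\<close> agrees with the area measure on boxes, hence everywhere.
\<close>

lemma nn_integral_polar:
  fixes F :: "complex \<Rightarrow> ennreal"
  assumes F [measurable]: "F \<in> borel_measurable borel"
  shows "(\<integral>\<^sup>+z. F z \<partial>lborel) =
    (\<integral>\<^sup>+r. \<integral>\<^sup>+\<theta>. polar_density r \<theta> * F (rcis r \<theta>) \<partial>lborel \<partial>lborel)"
proof -
  define w :: "real \<times> real \<Rightarrow> ennreal" where "w = (\<lambda>p. ennreal (indicator ({0<..} \<times> {0<..<2*pi}) p * fst p))"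
  define P :: "real \<times> real \<Rightarrow> complex" where "P = (\<lambda>p. rcis (fst p) (snd p))"
  have [measurable]: "{0<..} \<times> {0<..<2*pi} \<in> sets (borel :: (real \<times> real) measure)"
    by (intro borel_open open_Times) auto
  have w[measurable]: "w \<in> borel_measurable borel" unfolding w_def
    by (auto intro!: measurable_compose[OF _ measurable_ennreal] borel_measurable_times borel_measurable_continuous_onI[OF continuous_on_fst[OF continuous_on_id]])
  have P[measurable]: "P \<in> borel_measurable borel"
    unfolding P_def rcis_def cis.ctr Complex_eq by (intro borel_measurable_continuous_onI continuous_intros)
  have v: "(\<lambda>(x, y). vector [x, y] :: real^2) \<in> borel_measurable borel"
    by (rule borel_measurable_vector_2)
  have cx: "(\<lambda>v::real^2. Complex (v$1) (v$2)) \<in> borel_measurable borel"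
    by (intro borel_measurable_continuous_onI) (auto simp: Complex_eq intro!: continuous_intros)
  have "lborel = distr (density lborel w) borel P"
  proof (rule lborel_eqI)
    fix l u :: complex
    assume le: "\<And>b. b \<in> Basis \<Longrightarrow> l \<bullet> b \<le> u \<bullet> b"
    define B where "B = (\<lambda>v::real^2. Complex (v$1) (v$2)) -` box l u"
    have B: "B = box (vector [Re l, Im l]) (vector [Re u, Im u])"
      unfolding B_def by (auto simp: in_box_complex_iff mem_box_cart forall_2)
    define S where "S = {v. 0 < v$1 \<and> 0 < v$2 \<and> v$2 < 2 * pi \<and> polar v \<in> B}"
    have oB: "open B" "bounded B" by (auto simp: B)
    have S: "S \<in> sets borel"
      unfolding S_def using open_polar_region[OF oB(1)] by auto
    have "emeasure (distr (density lborel w) borel P) (box l u) = (\<integral>\<^sup>+p. w p * indicator (box l u) (P p) \<partial>lborel)"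
    proof -
      have "P -` box l u \<in> sets borel"
        using measurable_sets_borel[OF P, of "box l u"] by simp
      then show ?thesis
        using P w by (subst emeasure_distr) (simp_all add: emeasure_density indicator_vimage[symmetric] indicator_def)
    qed
    also have "\<dots> = (\<integral>\<^sup>+p. ennreal (indicator S (vector [fst p, snd p] :: real^2) * fst p) \<partial>lborel)"
      by (rule nn_integral_cong) (auto simp: w_def P_def S_def B_def polar_def indicator_def rcis_def complex_eq_iff cis.ctr in_box_complex_iff)
    also have "\<dots> = (\<integral>\<^sup>+v. ennreal (indicator S v * v$1) \<partial>distr lborel borel (\<lambda>(x, y). vector [x, y] :: real^2))"
      using v S by (subst nn_integral_distr) (auto simp: case_prod_unfold intro!: borel_measurable_continuous_onI continuous_intros)
    also have "\<dots> = emeasure lborel B"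
      using measure_polar_vimage[OF oB] unfolding S_def lborel_eq_distr_pair[symmetric] by simp
    also have "\<dots> = emeasure (distr (lborel :: (real^2) measure) borel (\<lambda>v. Complex (v$1) (v$2))) (box l u)"
      using cx by (subst emeasure_distr) (auto simp: B_def)
    also have "\<dots> = (\<Prod>b\<in>Basis. (u - l) \<bullet> b)"
      unfolding lborel_eq_distr_complex[symmetric] using le by (simp add: emeasure_lborel_box_eq)
    finally show "emeasure (distr (density lborel w) borel P) (box l u) = (\<Prod>b\<in>Basis. (u - l) \<bullet> b)" .
  qed simp
  then have "(\<integral>\<^sup>+z. F z \<partial>lborel) = (\<integral>\<^sup>+z. F z \<partial>distr (density lborel w) borel P)" by simp
  also have "\<dots> = (\<integral>\<^sup>+p. w p * F (P p) \<partial>(lborel \<Otimes>\<^sub>M lborel))"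
    using P w by (simp add: nn_integral_distr nn_integral_density lborel_prod)
  also have "\<dots> = (\<integral>\<^sup>+r. \<integral>\<^sup>+\<theta>. w (r, \<theta>) * F (P (r, \<theta>)) \<partial>lborel \<partial>lborel)"
    by (rule lborel.nn_integral_fst[symmetric]) (unfold lborel_prod, use P w in measurable)
  finally show ?thesis by (simp add: w_def P_def)
qed

section \<open>Dyadic estimates for logarithmic Carleson measures\<close>

text \<open>
  The order of growth of Besov functions, with \<open>\<alpha> = 1 - 1/p\<close>.
\<close>

definition log_weight :: "real \<Rightarrow> real \<Rightarrow> real" where
  "log_weight \<alpha> x = ln (exp 1 / (1 - x)) powr \<alpha>"

lemma ln_e_div: "x < 1 \<Longrightarrow> ln (exp 1 / (1 - x)) = 1 + ln (1 / (1 - x))" for x :: real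
  by (simp add: ln_div)

lemma log_weight_mono:
  assumes "0 \<le> \<alpha>" "0 \<le> x" "x \<le> y" "y < 1"
  shows "log_weight \<alpha> x \<le> log_weight \<alpha> y"
proof -
  have "ln (1 / (1 - x)) \<le> ln (1 / (1 - y))" "0 \<le> ln (1 / (1 - x))"
    using assms by (auto simp: field_simps)
  then show ?thesis using assms by (auto simp: log_weight_def ln_e_div intro!: powr_mono2)
qed

lemma log_weight_ge_1:
  assumes "0 \<le> \<alpha>" "0 \<le> x" "x < 1"
  shows "1 \<le> log_weight \<alpha> x"
proof -
  have "0 \<le> ln (1 / (1 - x))" using assms by (auto simp: field_simps)
  then show ?thesis using assms by (auto simp: log_weight_def ln_e_div intro!: ge_one_powr_ge_zero)
qed

lemma dyadic_scale:
  fixes x :: real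
  assumes "0 < x" "x \<le> 1"
  obtains K :: nat where "(1/2) ^ Suc K < x" "x \<le> (1/2) ^ K"
proof -
  obtain n :: nat where n: "(1/2) ^ n < x" using real_arch_pow_inv[of x "1/2"] assms by auto
  define m where "m = (LEAST n. (1/2::real) ^ n < x)"
  have m: "(1/2) ^ m < x" unfolding m_def using n by (rule LeastI)
  then obtain K where K: "m = Suc K" using assms by (cases m) auto
  have "\<not> (1/2) ^ K < x" using not_less_Least[of K "\<lambda>n. (1/2::real) ^ n < x"] K by (auto simp: m_def)
  with m K that show ?thesis by auto
qed

text \<open>
  At \<open>1 - 2^-k\<close> the weight is \<open>(1 + k ln 2) powr \<alpha>\<close>, so it varies slowly from one dyadic point to the next.
\<close>

lemma log_weight_dyadic_step:
  assumes "0 \<le> \<alpha>" "\<alpha> \<le> 1"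
  shows "log_weight \<alpha> (1 - (1/2) ^ Suc k) \<le> 2 * log_weight \<alpha> (1 - (1/2) ^ k)"
proof -
  have e: "ln (exp 1 / (1 - (1 - (1/2) ^ k))) = 1 + real k * ln 2" for k
    by (subst ln_e_div) (auto simp: ln_div ln_realpow power_one_over)
  have "(1 + real (Suc k) * ln 2) powr \<alpha> \<le> (2 * (1 + real k * ln 2)) powr \<alpha>"
  proof (intro powr_mono2)
    have "ln 2 \<le> 1 + real k * ln 2" using ln_2_less_1 by (intro add_increasing2) auto
    then show "1 + real (Suc k) * ln 2 \<le> 2 * (1 + real k * ln 2)" by (simp add: algebra_simps)
  qed (use assms in auto)
  also have "\<dots> = 2 powr \<alpha> * (1 + real k * ln 2) powr \<alpha>" by (rule powr_mult)
  also have "\<dots> \<le> 2 powr 1 * (1 + real k * ln 2) powr \<alpha>"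
    using assms by (intro mult_right_mono powr_mono) auto
  finally show ?thesis unfolding log_weight_def e by simp
qed

lemma half_power_powr_minus: "((1/2) ^ n) powr - a = 2 powr (real n * a)" for a :: real
proof -
  have "(1/2::real) ^ n = 2 powr - real n"
    by (simp add: powr_minus powr_realpow power_one_over inverse_eq_divide)
  then show ?thesis by (simp add: powr_powr)
qed

lemma tail_in_sets:
  assumes "finite_borel_measure_01 \<mu>" "0 \<le> a"
  shows "{a..<1} \<in> sets \<mu>"
  using assms by (auto simp: finite_borel_measure_01_def sets_restrict_space image_iff intro!: bexI[of _ "{a..<1}"])

lemma log_carleson_const_nonneg:
  assumes "0 \<le> \<alpha>" "0 \<le> \<rho>" "\<rho> < 1" "measure \<mu> {\<rho>..<1} * log_weight \<alpha> \<rho> \<le> \<epsilon> * (1 - \<rho>)"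
  shows "0 \<le> \<epsilon>"
proof -
  have "0 \<le> measure \<mu> {\<rho>..<1} * log_weight \<alpha> \<rho>" by (simp add: log_weight_def)
  then have "0 \<le> \<epsilon> * (1 - \<rho>)" using assms(4) by linarith
  then show ?thesis using assms(3) by (simp add: zero_le_mult_iff)
qed

text \<open>
  The integrand is dominated by a sum of multiples \<open>c k\<close> of indicators of the intervals \<open>[1 - 2^-k, 1)\<close>.
  Since \<open>1 - t r \<ge> 1 - r\<close>, the indices up to the first one with \<open>2^-(k+1) < 1 - r\<close> suffice. The logarithm
  in \<open>c k\<close> cancels against the one in the hypothesis on \<open>\<mu>\<close>; what remains is the
  geometric sum of \<open>2 powr (k \<delta>)\<close>, which is of the size of its last term \<open>(1 - r) powr - \<delta>\<close>.
\<close>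

lemma carleson_kernel_bound:
  fixes \<mu> :: "real measure"
  assumes \<mu>: "finite_borel_measure_01 \<mu>"
    and \<delta>: "0 < \<delta>" and \<alpha>: "0 \<le> \<alpha>" "\<alpha> \<le> 1" and r: "0 \<le> r" "r < 1" and \<rho>: "0 \<le> \<rho>"  "\<rho> < 1"
    and \<epsilon>: "\<And>t. \<rho> \<le> t \<Longrightarrow> t < 1 \<Longrightarrow> measure \<mu> {t..<1} * log_weight \<alpha> t \<le> \<epsilon> * (1 - t)"
  shows "(LINT t:{\<rho>..<1}|\<mu>. log_weight \<alpha> (t * r) * (1 - t * r) powr (- 1 - \<delta>))
      \<le> 2 powr (2 + \<delta>) / (1 - 2 powr - \<delta>) * \<epsilon> * (1 - r) powr - \<delta>"
proof -
  interpret finite_measure \<mu> using \<mu> by (simp add: finite_borel_measure_01_def)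
  note sets = tail_in_sets[OF \<mu>]
  have e0: "0 \<le> \<epsilon>" by (rule log_carleson_const_nonneg[OF \<alpha>(1) \<rho> \<epsilon>]) (use \<rho> in auto)
  define \<tau> where "\<tau> k = 1 - (1/2::real) ^ k" for k :: nat
  have \<tau>: "0 \<le> \<tau> k" "\<tau> k < 1" for k by (auto simp: \<tau>_def power_le_one)
  define c where "c k = log_weight \<alpha> (\<tau> (Suc k)) * 2 powr (real (Suc k) * (1 + \<delta>))" for k
  have c0: "0 \<le> c k" for k by (auto simp: c_def log_weight_def)
  obtain K where K: "(1/2) ^ Suc K < 1 - r" "1 - r \<le> (1/2) ^ K"
    using dyadic_scale[of "1 - r"] r by auto
  have ex: "\<exists>k\<le>J. \<tau> k \<le> t \<and> (t < \<tau> (Suc k) \<or> k = J)" if "0 \<le> t" "t < 1" for t J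
  proof (induction J)
    case 0 then show ?case using that by (auto simp: \<tau>_def)
  next
    case (Suc J)
    then obtain k where k: "k \<le> J" "\<tau> k \<le> t" "t < \<tau> (Suc k) \<or> k = J" by auto
    show ?case
    proof (cases "t < \<tau> (Suc k)")
      case True then show ?thesis using k by (intro exI[of _ k]) auto
    next
      case False then show ?thesis using k by (intro exI[of _ "Suc J"]) auto
    qed
  qed
  have pw: "log_weight \<alpha> (t * r) * (1 - t * r) powr (- 1 - \<delta>) \<le> (\<Sum>k\<le>K. c k * indicator {max \<rho> (\<tau> k)..<1} t)"
    if t: "\<rho> \<le> t" "t < 1" for t
  proof -
    obtain k where k: "k \<le> K" "\<tau> k \<le> t" "t < \<tau> (Suc k) \<or> k = K" using ex[of t K] t \<rho> by auto
    have tr: "t * r \<le> t" "t * r \<le> r" "0 \<le> t * r" using t r \<rho> by (auto simp: mult_left_le mult_left_le_one_le)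
    have lt: "t * r < \<tau> (Suc k)" using k(3) tr K(1) by (auto simp: \<tau>_def)
    have "(1 - t * r) powr (- 1 - \<delta>) \<le> ((1/2) ^ Suc k) powr (- 1 - \<delta>)"
      using lt \<delta> by (intro powr_mono2') (auto simp: \<tau>_def)
    also have "\<dots> = 2 powr (real (Suc k) * (1 + \<delta>))"
      using half_power_powr_minus[of "Suc k" "1 + \<delta>"] by simp
    finally have "log_weight \<alpha> (t * r) * (1 - t * r) powr (- 1 - \<delta>) \<le> c k"
      unfolding c_def using lt tr \<tau> \<alpha> by (intro mult_mono log_weight_mono) (auto simp: log_weight_def)
    also have "c k = c k * indicator {max \<rho> (\<tau> k)..<1} t" using t k by auto
    also have "\<dots> \<le> (\<Sum>k\<le>K. c k * indicator {max \<rho> (\<tau> k)..<1} t)"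
      using k(1) c0 by (intro member_le_sum) auto
    finally show ?thesis .
  qed
  have "(LINT t:{\<rho>..<1}|\<mu>. log_weight \<alpha> (t * r) * (1 - t * r) powr (- 1 - \<delta>))
      \<le> (LINT t|\<mu>. (\<Sum>k\<le>K. c k * indicator {max \<rho> (\<tau> k)..<1} t))"
    unfolding set_lebesgue_integral_def
  proof (rule integral_mono')
    show "integrable \<mu> (\<lambda>t. \<Sum>k\<le>K. c k * indicator {max \<rho> (\<tau> k)..<1} t)"
      using sets \<rho> by (intro Bochner_Integration.integrable_sum integrable_mult_right integrable_real_indicator) (auto simp: less_top[symmetric])
    show "indicator {\<rho>..<1} t *\<^sub>R (log_weight \<alpha> (t * r) * (1 - t * r) powr (- 1 - \<delta>))
        \<le> (\<Sum>k\<le>K. c k * indicator {max \<rho> (\<tau> k)..<1} t)" if "t \<in> space \<mu>" for t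
      using pw[of t] c0 by (auto simp: indicator_def split: if_splits intro!: sum_nonneg)
    show "0 \<le> (\<Sum>k\<le>K. c k * indicator {max \<rho> (\<tau> k)..<1} t)" for t
      using c0 by (intro sum_nonneg) auto
  qed
  also have "\<dots> = (\<Sum>k\<le>K. c k * measure \<mu> {max \<rho> (\<tau> k)..<1})"
    using sets \<rho> by (subst Bochner_Integration.integral_sum) (auto simp: less_top[symmetric] max.coboundedI1 sets.Int_space_eq2 intro!: integrable_mult_right integrable_real_indicator sum.cong)
  also have "\<dots> \<le> (\<Sum>k\<le>K. \<epsilon> * 2 powr (2 + \<delta>) * (2 powr \<delta>) ^ k)"
  proof (rule sum_mono)
    fix k
    let ?T = "max \<rho> (\<tau> k)"
    have "measure \<mu> {?T..<1} * log_weight \<alpha> (\<tau> k) \<le> measure \<mu> {?T..<1} * log_weight \<alpha> ?T"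
      using \<alpha> \<tau> \<rho> by (intro mult_left_mono log_weight_mono) auto
    also have "\<dots> \<le> \<epsilon> * (1 - ?T)" using \<rho> \<tau> by (intro \<epsilon>) auto
    also have "\<dots> \<le> \<epsilon> * (1/2) ^ k" using e0 by (intro mult_left_mono) (auto simp: \<tau>_def)
    finally have m: "measure \<mu> {?T..<1} * log_weight \<alpha> (\<tau> k) \<le> \<epsilon> * (1/2) ^ k" .
    have "c k * measure \<mu> {?T..<1} \<le> (2 * log_weight \<alpha> (\<tau> k)) * 2 powr (real (Suc k) * (1 + \<delta>)) * measure \<mu> {?T..<1}"
      unfolding c_def \<tau>_def using \<alpha> by (intro mult_right_mono log_weight_dyadic_step) auto
    also have "\<dots> = 2 * 2 powr (real (Suc k) * (1 + \<delta>)) * (measure \<mu> {?T..<1} * log_weight \<alpha> (\<tau> k))" by simp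
    also have "\<dots> \<le> 2 * 2 powr (real (Suc k) * (1 + \<delta>)) * (\<epsilon> * (1/2) ^ k)"
      using m by (intro mult_left_mono) auto
    also have "\<dots> = \<epsilon> * (2 powr 1 * 2 powr (real (Suc k) * (1 + \<delta>)) * 2 powr - real k)"
      by (simp add: powr_minus powr_realpow power_one_over inverse_eq_divide)
    also have "2 powr 1 * 2 powr (real (Suc k) * (1 + \<delta>)) * 2 powr - real k = 2 powr (2 + \<delta> + \<delta> * real k)"
      unfolding powr_add[symmetric] by (rule arg_cong[of _ _ "(powr) 2"]) (simp add: algebra_simps)
    also have "\<epsilon> * \<dots> = \<epsilon> * 2 powr (2 + \<delta>) * (2 powr \<delta>) ^ k"
      by (simp add: powr_add powr_realpow[symmetric] powr_powr)
    finally show "c k * measure \<mu> {?T..<1} \<le> \<epsilon> * 2 powr (2 + \<delta>) * (2 powr \<delta>) ^ k" .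
  qed
  also have "\<dots> = \<epsilon> * 2 powr (2 + \<delta>) * (\<Sum>k\<le>K. (2 powr \<delta>) ^ k)" by (simp add: sum_distrib_left)
  also have "\<dots> \<le> \<epsilon> * 2 powr (2 + \<delta>) * ((2 powr \<delta>) ^ K / (1 - 2 powr - \<delta>))"
  proof -
    have x: "1 < 2 powr \<delta>" using \<delta> by simp
    have "(\<Sum>k\<le>K. (2 powr \<delta>) ^ k) = ((2 powr \<delta>) ^ Suc K - 1) / (2 powr \<delta> - 1)"
      using geometric_sum[of "2 powr \<delta>" "Suc K"] x by (simp only: lessThan_Suc_atMost)
    also have "\<dots> \<le> (2 powr \<delta>) ^ Suc K / (2 powr \<delta> - 1)" using x by (intro divide_right_mono) auto
    also have "\<dots> = (2 powr \<delta>) ^ K / (1 - 2 powr - \<delta>)"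
      using x by (simp add: powr_minus field_simps)
    finally show ?thesis using e0 by (intro mult_left_mono) auto
  qed
  also have "\<dots> \<le> \<epsilon> * 2 powr (2 + \<delta>) * ((1 - r) powr - \<delta> / (1 - 2 powr - \<delta>))"
  proof -
    have "(2 powr \<delta>) ^ K = ((1/2) ^ K) powr - \<delta>"
      using half_power_powr_minus[of K \<delta>] by (simp add: powr_realpow[symmetric] powr_powr mult.commute)
    also have "\<dots> \<le> (1 - r) powr - \<delta>" using r K \<delta> by (intro powr_mono2') auto
    finally show ?thesis using e0 \<delta> by (intro mult_left_mono divide_right_mono)
        (auto simp: powr_minus_divide ge_one_powr_ge_zero)
  qed
  finally show ?thesis by (simp add: mult_ac)
qed

section \<open>The kernel on circles\<close>

text \<open>
  Replaces the singularity of the kernel at \<open>t z\<close> by the one at \<open>z\<close>, which does not depend on \<open>t\<close>.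
\<close>

lemma cmod_one_minus_ge:
  assumes "0 \<le> t" "t \<le> 1" "cmod z \<le> 1"
  shows "cmod (1 - z) \<le> 2 * cmod (1 - of_real t * z)"
proof -
  have "cmod (1 - z) = cmod ((1 - of_real t * z) - of_real (1 - t) * z)" by (simp add: algebra_simps)
  also have "\<dots> \<le> cmod (1 - of_real t * z) + cmod (of_real (1 - t) * z)" by (rule norm_triangle_ineq4)
  also have "cmod (of_real (1 - t) * z) \<le> 1 - t"
    using assms by (simp add: norm_mult mult_left_le del: of_real_diff)
  also have "1 - t \<le> 1 - cmod (of_real t * z)" using assms by (simp add: norm_mult mult_left_le)
  also have "\<dots> \<le> cmod (1 - of_real t * z)" using norm_triangle_ineq2[of 1 "of_real t * z"] by simp
  finally show ?thesis by simp
qed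

lemma sin_ge_half: "x / 2 \<le> sin x" if "0 \<le> x" "x \<le> pi / 2" for x :: real
proof -
  have x: "x \<le> 8/5" using that pi_less_4 pi_approx by simp
  have "\<bar>sin x - (\<Sum>m<3. sin_coeff m * x ^ m)\<bar> \<le> inverse (fact 3) * \<bar>x\<bar> ^ 3"
    by (rule Maclaurin_sin_bound)
  moreover have "(\<Sum>m<3. sin_coeff m * x ^ m) = x" by (simp add: eval_nat_numeral sin_coeff_def)
  ultimately have "x - x ^ 3 / 6 \<le> sin x" using that by (auto simp: fact_numeral abs_if split: if_splits)
  moreover have "x ^ 3 \<le> x * (8/5)\<^sup>2"
    using mult_left_mono[OF power_mono[OF x that(1), of 2] that(1)]
    by (simp add: power3_eq_cube power2_eq_square)
  ultimately show ?thesis using that by (simp add: power2_eq_square)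
qed

lemma cmod_one_minus_rcis_ge:
  assumes "0 \<le> r" "r < 1" "0 \<le> \<theta>" "\<theta> \<le> pi"
  shows "((1 - r) + \<theta>) / 8 \<le> cmod (1 - rcis r \<theta>)"
proof -
  have "cmod (1 - cis \<theta>) = 2 * sin (\<theta> / 2)"
  proof -
    have "(cmod (1 - cis \<theta>))\<^sup>2 = (1 - cos \<theta>)\<^sup>2 + (sin \<theta>)\<^sup>2" by (simp add: cmod_def)
    also have "\<dots> = 2 - 2 * cos (2 * (\<theta>/2))"
      using sin_cos_squared_add[of \<theta>] by (simp add: power2_eq_square algebra_simps)
    also have "\<dots> = (2 * sin (\<theta>/2))\<^sup>2" by (subst cos_double_sin) (simp add: power2_eq_square)
    finally show ?thesis 
      by (rule power2_eq_imp_eq) (use assms in \<open>auto intro!: sin_ge_zero\<close>)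
  qed
  moreover have "\<theta> / 2 / 2 \<le> sin (\<theta> / 2)" using assms by (intro sin_ge_half) auto
  moreover have "cmod (1 - cis \<theta>) \<le> 2 * cmod (1 - rcis r \<theta>)"
    using cmod_one_minus_ge[of r "cis \<theta>"] assms by (simp add: rcis_def)
  moreover have "1 - r \<le> cmod (1 - rcis r \<theta>)"
    using norm_triangle_ineq2[of 1 "rcis r \<theta>"] assms by simp
  ultimately show ?thesis using assms by (simp add: field_simps)
qed

text \<open>
  On the upper half of the circle \<open>|1 - r e^(i \<theta>)|\<close> is at least \<open>(1 - r + \<theta>) / 8\<close>, and conjugation exchanges
  the two halves; the power of \<open>1 - r + \<theta>\<close> has an explicit primitive.
\<close>

lemma integral_kernel_bound:
  assumes \<sigma>: "1 < \<sigma>" and r: "0 \<le> r" "r < 1"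
  shows "integral {0..2 * pi} (\<lambda>\<theta>. cmod (1 - rcis r \<theta>) powr - \<sigma>)
      \<le> 2 * 8 powr \<sigma> / (\<sigma> - 1) * (1 - r) powr (1 - \<sigma>)"
proof -
  define a where "a = 1 - r"
  have a: "0 < a" using r by (simp add: a_def)
  define G where "G \<theta> = (a + \<theta>) powr (1 - \<sigma>) / (1 - \<sigma>)" for \<theta>
  have dG: "(G has_real_derivative (a + x) powr - \<sigma>) (at x within S)" if "0 < a + x" for x S
  proof -
    have "(G has_real_derivative ((1 - \<sigma>) * (a + x) powr (1 - \<sigma> - 1)) / (1 - \<sigma>)) (at x within S)"
      unfolding G_def using that by (auto intro!: derivative_eq_intros)
    then show ?thesis using \<sigma> by simp
  qed
  have dG': "((\<lambda>x. - G (2 * pi - x)) has_real_derivative (a + (2 * pi - x)) powr - \<sigma>) (at x within S)"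
    if "0 < a + (2 * pi - x)" for x S
  proof -
    have d: "((\<lambda>x. 2 * pi - x) has_real_derivative -1) (at x within S)"
      by (auto intro!: derivative_eq_intros)
    show ?thesis using DERIV_minus[OF DERIV_chain2[OF dG[OF that, of UNIV] d]] by simp
  qed
  have I1: "((\<lambda>\<theta>. (a + \<theta>) powr - \<sigma>) has_integral G (2 * pi) - G 0) {0..2 * pi}"
    using a by (intro fundamental_theorem_of_calculus)
      (auto simp: has_real_derivative_iff_has_vector_derivative[symmetric] intro!: dG)
  have I2: "((\<lambda>\<theta>. (a + (2 * pi - \<theta>)) powr - \<sigma>) has_integral - G (2 * pi - 2 * pi) - - G (2 * pi - 0)) {0..2 * pi}"
    using a by (intro fundamental_theorem_of_calculus)
      (auto simp: has_real_derivative_iff_has_vector_derivative[symmetric] intro!: dG')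
  have I: "((\<lambda>\<theta>. 8 powr \<sigma> * ((a + \<theta>) powr - \<sigma> + (a + (2 * pi - \<theta>)) powr - \<sigma>)) has_integral
      8 powr \<sigma> * ((G (2 * pi) - G 0) + (- G (2 * pi - 2 * pi) - - G (2 * pi - 0)))) {0..2 * pi}"
    by (intro has_integral_mult_right has_integral_add I1 I2)
  have nz: "1 - rcis r \<theta> \<noteq> 0" for \<theta>
  proof
    assume "1 - rcis r \<theta> = 0"
    then have "cmod (rcis r \<theta>) = 1" by (metis eq_iff_diff_eq_0 norm_one)
    then show False using r by simp
  qed
  have conv: "(a' / 8) powr - \<sigma> = 8 powr \<sigma> * a' powr - \<sigma>" if "0 < a'" for a'
    using that by (simp add: powr_divide powr_minus field_simps)
  have bound: "cmod (1 - rcis r \<theta>) powr - \<sigma> \<le> 8 powr \<sigma> * ((a + \<theta>) powr - \<sigma> + (a + (2 * pi - \<theta>)) powr - \<sigma>)"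
    if \<theta>: "\<theta> \<in> {0..2 * pi}" for \<theta>
  proof (cases "\<theta> \<le> pi")
    case True
    have "cmod (1 - rcis r \<theta>) powr - \<sigma> \<le> ((a + \<theta>) / 8) powr - \<sigma>"
      using cmod_one_minus_rcis_ge[OF r _ True] \<theta> \<sigma> a by (intro powr_mono2') (auto simp: a_def)
    also have "\<dots> = 8 powr \<sigma> * (a + \<theta>) powr - \<sigma>" using a \<theta> by (intro conv) auto
    finally show ?thesis by (simp add: distrib_left add_increasing2)
  next
    case False
    have "cnj (rcis r (2 * pi - \<theta>)) = rcis r \<theta>"
      by (auto simp: complex_eq_iff cos_diff sin_diff)
    then have "cmod (1 - rcis r \<theta>) = cmod (1 - rcis r (2 * pi - \<theta>))"
      by (metis complex_cnj_diff complex_cnj_one complex_mod_cnj)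
    then have "cmod (1 - rcis r \<theta>) powr - \<sigma> \<le> ((a + (2 * pi - \<theta>)) / 8) powr - \<sigma>"
      using cmod_one_minus_rcis_ge[OF r, of "2 * pi - \<theta>"] False \<theta> \<sigma> a by (intro powr_mono2') (auto simp: a_def)
    also have "\<dots> = 8 powr \<sigma> * (a + (2 * pi - \<theta>)) powr - \<sigma>" using a \<theta> by (intro conv) auto
    finally show ?thesis by (simp add: distrib_left add_increasing)
  qed
  have "integral {0..2 * pi} (\<lambda>\<theta>. cmod (1 - rcis r \<theta>) powr - \<sigma>)
     \<le> 8 powr \<sigma> * ((G (2 * pi) - G 0) + (- G (2 * pi - 2 * pi) - - G (2 * pi - 0)))"
    unfolding integral_unique[OF I, symmetric]
  proof (rule integral_le)
    show "(\<lambda>\<theta>. cmod (1 - rcis r \<theta>) powr - \<sigma>) integrable_on {0..2 * pi}"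
      using nz by (intro integrable_continuous_real continuous_intros) (auto simp: rcis_def cis.ctr Complex_eq intro!: continuous_intros)
  qed (use I bound in auto)
  also have "\<dots> = 8 powr \<sigma> * 2 * (G (2 * pi) - G 0)" by simp
  also have "\<dots> \<le> 8 powr \<sigma> * 2 * (a powr (1 - \<sigma>) / (\<sigma> - 1))"
  proof (intro mult_left_mono)
    have "G 0 = - (a powr (1 - \<sigma>) / (\<sigma> - 1))"
      using minus_divide_right[of "a powr (1 - \<sigma>)" "\<sigma> - 1"] by (simp add: G_def)
    moreover have "G (2 * pi) \<le> 0" using \<sigma> by (auto simp: G_def intro!: divide_nonneg_neg)
    ultimately show "G (2 * pi) - G 0 \<le> a powr (1 - \<sigma>) / (\<sigma> - 1)" by simp
  qed auto
  finally show ?thesis by (simp add: a_def mult_ac)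
qed

section \<open>Countably subadditive seminorms\<close>

context normed_function_space
begin

lemma minus_mem: "f \<in> X \<Longrightarrow> (\<lambda>z. - f z) \<in> X"
  using scale_mem[of f "-1"] by simp

lemma norm_minus: "f \<in> X \<Longrightarrow> N (\<lambda>z. - f z) = N f"
  using norm_scale[of f "-1"] by simp

text \<open>
  Baire's theorem: countably many sets covering a complete space cannot all be nowhere dense.
\<close>

lemma ball_of_closure_of_sublevel:
  assumes complete: "Metric_space.mcomplete X (norm_dist X N)" and cover: "\<And>f. f \<in> X \<Longrightarrow> \<exists>m. f \<in> A m" and sub: "\<And>m. A m \<subseteq> X"
  shows "\<exists>m::nat. \<exists>f0\<in>X. \<exists>e>0. \<forall>g\<in>X. N (\<lambda>z. g z - f0 z) < e \<longrightarrow>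
      (\<forall>\<eta>>0. \<exists>u\<in>A m. N (\<lambda>z. g z - u z) < \<eta>)"
proof -
  interpret M: Metric_space X "norm_dist X N" by (rule Metric_space_norm_dist)
  let ?cl = "\<lambda>m. M.mtopology closure_of A m"
  have "\<exists>m. M.mtopology interior_of (?cl m) \<noteq> {}"
  proof (rule ccontr)
    assume "\<not> ?thesis"
    then have "M.mtopology interior_of (\<Union>(range ?cl)) = {}"
      using complete by (intro M.metric_Baire_category_alt) auto
    moreover have "X \<subseteq> \<Union>(range ?cl)"
    proof
      fix f assume "f \<in> X"
      then obtain m where "f \<in> A m" using cover by blast
      moreover have "A m \<subseteq> ?cl m" using sub by (intro closure_of_subset) simp
      ultimately have "f \<in> ?cl m" by blast
      then show "f \<in> \<Union>(range ?cl)" by blast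
    qed
    then have "X \<subseteq> M.mtopology interior_of (\<Union>(range ?cl))"
      by (intro interior_of_maximal) auto
    ultimately show False using zero_mem by auto
  qed
  then obtain m f0 where f0: "f0 \<in> M.mtopology interior_of (?cl m)" by auto
  then obtain e where e: "0 < e" "M.mball f0 e \<subseteq> M.mtopology interior_of (?cl m)"
    using openin_interior_of[of M.mtopology "?cl m"] unfolding M.openin_mtopology by blast
  have f0X: "f0 \<in> X" using f0 interior_of_subset_topspace[of M.mtopology] by auto
  show ?thesis
  proof (rule exI[of _ m], rule bexI[OF _ f0X], rule exI[of _ e], intro conjI ballI allI impI e(1))
    fix g \<eta> assume g: "g \<in> X" "N (\<lambda>z. g z - f0 z) < e" "0 < (\<eta>::real)"
    have "g \<in> M.mball f0 e"
      using g f0X norm_minus_commute[OF g(1) f0X] by (simp add: norm_dist_def)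
    then have "g \<in> ?cl m" using e(2) interior_of_subset[of M.mtopology "?cl m"] by blast
    then obtain u where "u \<in> A m" "u \<in> M.mball g \<eta>"
      using g(3) unfolding M.metric_closure_of by blast
    then show "\<exists>u\<in>A m. N (\<lambda>z. g z - u z) < \<eta>" by (auto simp: norm_dist_def)
  qed
qed

text \<open>
  Zabreiko's lemma, a convenient form of the closed graph theorem. By Baire's theorem the closure of some
  sublevel set \<open>{P \<le> m}\<close> contains a ball; averaging moves it to the origin. So every \<open>g\<close> in the unit ball is
  approximated up to an error of norm \<open>1/2\<close> by an \<open>h\<close> with \<open>P h \<le> K\<close>. Repeating this for the
  error writes \<open>g\<close> as a series of functions \<open>h n\<close> with \<open>P (h n) \<le> K 2^-n\<close>, and the countable
  subadditivity gives \<open>P g \<le> 2 K\<close>.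
\<close>

proposition bounded_if_countably_subadditive:
  fixes P :: "(complex \<Rightarrow> complex) \<Rightarrow> real"
  assumes complete: "Metric_space.mcomplete X (norm_dist X N)"
    and P_add: "\<And>f g. f \<in> X \<Longrightarrow> g \<in> X \<Longrightarrow> P (\<lambda>z. f z + g z) \<le> P f + P g"
    and P_scale: "\<And>c f. f \<in> X \<Longrightarrow> P (\<lambda>z. c * f z) \<le> cmod c * P f"
    and P_nonneg: "\<And>f. f \<in> X \<Longrightarrow> 0 \<le> P f"
    and P_suminf: "\<And>f h. f \<in> X \<Longrightarrow> (\<And>n. h n \<in> X) \<Longrightarrow> summable (\<lambda>n. P (h n)) \<Longrightarrow>
        (\<lambda>n. N (\<lambda>z. f z - (\<Sum>i<n. h i z))) \<longlonglongrightarrow> 0 \<Longrightarrow> P f \<le> (\<Sum>n. P (h n))"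
  obtains C where "0 \<le> C" "\<And>f. f \<in> X \<Longrightarrow> P f \<le> C * N f"
proof -
  have cover: "\<exists>m. f \<in> {f \<in> X. P f \<le> real m}" if "f \<in> X" for f
    using that real_arch_simple[of "P f"] by blast
  obtain m f0 e where f0: "f0 \<in> X" and e: "0 < e" and
    cl': "\<forall>g\<in>X. N (\<lambda>z. g z - f0 z) < e \<longrightarrow>
        (\<forall>\<eta>>0. \<exists>u\<in>{f \<in> X. P f \<le> real m}. N (\<lambda>z. g z - u z) < \<eta>)"
    using ball_of_closure_of_sublevel[OF complete, of "\<lambda>m. {f \<in> X. P f \<le> real m}", OF cover]
    by auto
  have cl: "\<exists>u. u \<in> X \<and> P u \<le> real m \<and> N (\<lambda>z. g z - u z) < \<eta>"
    if "g \<in> X" "N (\<lambda>z. g z - f0 z) < e" "0 < \<eta>" for g \<eta>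
    using cl' that by blast
  \<comment> \<open>averaging approximants of \<open>f0 + g\<close> and \<open>f0 - g\<close> moves the ball to the origin\<close>
  have near0: "\<exists>h\<in>X. P h \<le> real m \<and> N (\<lambda>z. g z - h z) < \<eta>"
    if g: "g \<in> X" "N g < e" and \<eta>: "0 < \<eta>" for g \<eta>
  proof -
    have "(\<lambda>z. f0 z + g z) \<in> X" "N (\<lambda>z. (f0 z + g z) - f0 z) < e"
      using add_mem[OF f0 g(1)] g by auto
    then obtain u where u: "u \<in> X" "P u \<le> real m" "N (\<lambda>z. (f0 z + g z) - u z) < \<eta>"
      using cl[OF _ _ \<eta>] by blast
    have "(\<lambda>z. f0 z - g z) \<in> X" "N (\<lambda>z. (f0 z - g z) - f0 z) < e"
      using diff_mem[OF f0 g(1)] norm_minus[OF g(1)] g by auto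
    then obtain v where v: "v \<in> X" "P v \<le> real m" "N (\<lambda>z. (f0 z - g z) - v z) < \<eta>"
      using cl[OF _ _ \<eta>] by blast
    have v': "(\<lambda>z. (-1) * v z) \<in> X" by (rule scale_mem[OF v(1)])
    have uv: "(\<lambda>z. u z + (-1) * v z) \<in> X" by (rule add_mem[OF u(1) v'])
    define h where "h = (\<lambda>z. (1/2) * (u z + (-1) * v z))"
    have hX: "h \<in> X" unfolding h_def by (rule scale_mem[OF uv])
    have "P h \<le> (1/2) * P (\<lambda>z. u z + (-1) * v z)" unfolding h_def using P_scale[OF uv, of "1/2"] by simp
    also have "\<dots> \<le> (1/2) * (P u + P v)"
      using P_add[OF u(1) v'] P_scale[OF v(1), of "-1"] by simp
    also have "\<dots> \<le> real m" using u v by simp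
    finally have Ph: "P h \<le> real m" .
    have a: "(\<lambda>z. (f0 z + g z) - u z) \<in> X" by (intro diff_mem add_mem f0 g u)
    have b: "(\<lambda>z. (f0 z - g z) - v z) \<in> X" by (intro diff_mem f0 g v)
    have "(\<lambda>z. g z - h z) = (\<lambda>z. (1/2) * (((f0 z + g z) - u z) - ((f0 z - g z) - v z)))"
      by (auto simp: h_def field_simps)
    then have "N (\<lambda>z. g z - h z) = (1/2) * N (\<lambda>z. ((f0 z + g z) - u z) - ((f0 z - g z) - v z))"
      using norm_scale[OF diff_mem[OF a b], of "1/2"] by simp
    also have "\<dots> \<le> (1/2) * (N (\<lambda>z. (f0 z + g z) - u z) + N (\<lambda>z. (f0 z - g z) - v z))"
      using norm_triangle[OF a minus_mem[OF b]] norm_minus[OF b] by simp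
    also have "\<dots> < \<eta>" using u v by simp
    finally show ?thesis using hX Ph by blast
  qed
  \<comment> \<open>rescaling to the radius \<open>e / 2\<close> turns the level \<open>m\<close> into \<open>2 m / e\<close> per unit of norm\<close>
  define K where "K = 2 * real m / e"
  have K: "0 \<le> K" using e by (simp add: K_def)
  have step: "\<exists>h\<in>X. P h \<le> K * (1/2) ^ n \<and> N (\<lambda>z. g z - h z) \<le> (1/2) ^ Suc n"
    if g: "g \<in> X" "N g \<le> (1/2) ^ n" for g n
  proof -
    define s where "s = (e / 2) * 2 ^ n"
    have s: "0 < s" "inverse s = (2 / e) * (1/2) ^ n" using e by (auto simp: s_def power_one_over field_simps)
    have "N (\<lambda>z. of_real s * g z) = s * N g" using norm_scale[OF g(1), of "of_real s"] s by simp
    also have "\<dots> \<le> s * (1/2) ^ n" using g s by (intro mult_left_mono) auto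
    also have "\<dots> < e" using e by (simp add: s_def power_one_over)
    finally have "N (\<lambda>z. of_real s * g z) < e" .
    then obtain h' where h': "h' \<in> X" "P h' \<le> real m" "N (\<lambda>z. of_real s * g z - h' z) < s * (1/2) ^ Suc n"
      using near0[OF scale_mem[OF g(1)], of "of_real s" "s * (1/2) ^ Suc n"] s by auto
    define h where "h = (\<lambda>z. of_real (inverse s) * h' z)"
    have hX: "h \<in> X" unfolding h_def by (rule scale_mem[OF h'(1)])
    have "P h \<le> inverse s * P h'" unfolding h_def using P_scale[OF h'(1), of "of_real (inverse s)"] s(1) by (simp add: norm_inverse)
    also have "\<dots> \<le> inverse s * real m" using h' s(1) by (intro mult_left_mono) auto
    also have "\<dots> = K * (1/2) ^ n" unfolding s K_def by simp
    finally have Ph: "P h \<le> K * (1/2) ^ n" .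
    have "(\<lambda>z. g z - h z) = (\<lambda>z. of_real (inverse s) * (of_real s * g z - h' z))"
      using s by (auto simp: h_def field_simps)
    then have "N (\<lambda>z. g z - h z) = inverse s * N (\<lambda>z. of_real s * g z - h' z)"
      using norm_scale[OF diff_mem[OF scale_mem[OF g(1)] h'(1)], of "of_real (inverse s)" "of_real s"] s(1) by (simp add: norm_inverse)
    also have "\<dots> \<le> inverse s * (s * (1/2) ^ Suc n)" using h' s(1) by (intro mult_left_mono) auto
    also have "\<dots> = (1/2) ^ Suc n" using s(1) by (simp add: norm_inverse)
    finally show ?thesis using hX Ph by blast
  qed
  define H where "H n g = (SOME h. h \<in> X \<and> P h \<le> K * (1/2) ^ n \<and> N (\<lambda>z. g z - h z) \<le> (1/2) ^ Suc n)" for n g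
  have H: "H n g \<in> X \<and> P (H n g) \<le> K * (1/2) ^ n \<and> N (\<lambda>z. g z - H n g z) \<le> (1/2) ^ Suc n"
    if g: "g \<in> X" "N g \<le> (1/2) ^ n" for g n
  proof -
    have "\<exists>h. h \<in> X \<and> P h \<le> K * (1/2) ^ n \<and> N (\<lambda>z. g z - h z) \<le> (1/2) ^ Suc n"
      using step[OF g] by blast
    then show ?thesis unfolding H_def by (rule someI_ex)
  qed
  have unit: "P g \<le> 2 * K" if g: "g \<in> X" "N g \<le> 1" for g
  proof -
    define r where "r = rec_nat g (\<lambda>n u z. u z - H n u z)"
    have r0: "r 0 = g" and rS: "r (Suc n) = (\<lambda>z. r n z - H n (r n) z)" for n by (auto simp: r_def)
    have r: "r n \<in> X \<and> N (r n) \<le> (1/2) ^ n" for n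
    proof (induction n)
      case (Suc n)
      then show ?case unfolding rS using H[of "r n" n] diff_mem[of "r n" "H n (r n)"] by auto
    qed (use g r0 in auto)
    define h where "h n = H n (r n)" for n
    have h: "h n \<in> X" "P (h n) \<le> K * (1/2) ^ n" for n using H[of "r n" n] r[of n] by (auto simp: h_def)
    have rem: "r n = (\<lambda>z. g z - (\<Sum>i<n. h i z))" for n
      by (induction n) (auto simp: r0 rS h_def)
    have geo: "summable (\<lambda>n. K * (1/2) ^ n)" by (intro summable_mult summable_geometric) auto
    have sm: "summable (\<lambda>n. P (h n))"
      by (rule summable_comparison_test'[OF geo, of 0]) (use h P_nonneg in auto)
    have "(\<lambda>n. N (r n)) \<longlonglongrightarrow> 0"
    proof (rule tendsto_sandwich[of "\<lambda>_. 0"])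
      show "(\<lambda>n. (1/2::real) ^ n) \<longlonglongrightarrow> 0" by (rule LIMSEQ_power_zero) auto
    qed (use r norm_nonneg in auto)
    then have "P g \<le> (\<Sum>n. P (h n))" using P_suminf[OF g(1) h(1) sm] by (simp add: rem)
    also have "\<dots> \<le> (\<Sum>n. K * (1/2) ^ n)" using h sm geo by (intro suminf_le) auto
    also have "\<dots> = 2 * K" by (subst suminf_mult) (auto simp: suminf_geometric summable_geometric)
    finally show ?thesis .
  qed
  show ?thesis
  proof (rule that)
    show "0 \<le> 2 * K" using K by simp
    fix f assume f: "f \<in> X"
    show "P f \<le> 2 * K * N f"
    proof (cases "N f = 0")
      case True
      then have "f = (\<lambda>z. 0 * f z)" using norm_eq_zero[OF f] by auto
      then have "P f \<le> 0" using P_scale[OF f, of 0] by simp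
      then show ?thesis using True by simp
    next
      case False
      then have pos: "0 < N f" using norm_nonneg[OF f] by simp
      have "P (\<lambda>z. of_real (inverse (N f)) * f z) \<le> 2 * K"
        using norm_scale[OF f, of "of_real (inverse (N f))"] pos
        by (intro unit scale_mem f) (auto simp: norm_inverse)
      then have "N f * P (\<lambda>z. of_real (inverse (N f)) * f z) \<le> N f * (2 * K)"
        using pos by (intro mult_left_mono) auto
      moreover have "(\<lambda>z. of_real (N f) * (of_real (inverse (N f)) * f z)) = f" using pos by auto
      then have "P f \<le> N f * P (\<lambda>z. of_real (inverse (N f)) * f z)"
        using P_scale[OF scale_mem[OF f], of "of_real (N f)" "of_real (inverse (N f))"] pos by simp
      ultimately show ?thesis by (simp add: mult_ac)
    qed
  qed
qed

end

section \<open>Submean values over disks\<close>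

lemma nn_integral_indicator_has_integral:
  fixes f :: "real \<Rightarrow> real"
  assumes I: "(f has_integral I) S" and S: "S \<in> sets borel" and f: "f \<in> borel_measurable borel"
    and nonneg: "\<And>x. x \<in> S \<Longrightarrow> 0 \<le> f x"
  shows "(\<integral>\<^sup>+x. ennreal (indicator S x * f x) \<partial>lborel) = ennreal I"
proof (rule nn_integral_has_integral_lborel)
  show "(\<lambda>x. indicator S x * f x) \<in> borel_measurable borel" using S f by measurable
  show "0 \<le> indicator S x * f x" for x using nonneg[of x] by (auto simp: indicator_def)
  have "(\<lambda>x. indicator S x * f x) = (\<lambda>x. if x \<in> S then f x else 0)" by (auto simp: indicator_def)
  then show "((\<lambda>x. indicator S x * f x) has_integral I) UNIV"
    using I by (simp only: has_integral_restrict_UNIV)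
qed

text \<open>
  Integrated or summed, and with \<open>c\<close> chosen afterwards, this replaces the inequalities of Jensen
  and Hoelder at the cost of a factor 2.
\<close>

lemma le_add_powr_scaled:
  fixes x c p :: real
  assumes "1 \<le> p" "0 < c" "0 \<le> x"
  shows "x \<le> c + c powr (1 - p) * x powr p"
proof (cases "x \<le> c")
  case True then show ?thesis by (simp add: add_increasing2)
next
  case False
  then have "x = x powr (1 - p) * x powr p" using assms by (simp add: powr_add[symmetric])
  also have "\<dots> \<le> c powr (1 - p) * x powr p"
    using False assms by (intro mult_right_mono powr_mono2') auto
  finally show ?thesis using assms by simp
qed

lemma sum_le_powr_sum:
  fixes a :: "nat \<Rightarrow> real"
  assumes p: "1 \<le> p" and a: "\<And>k. 0 \<le> a k" and B: "0 \<le> B" "(\<Sum>k<K. a k powr p) \<le> B powr p"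
  shows "(\<Sum>k<K. a k) \<le> 2 * B * real K powr (1 - 1 / p)"
proof (cases "K = 0 \<or> B = 0")
  case True
  then consider "K = 0" | "B = 0" by auto
  then show ?thesis
  proof cases
    case 2
    have "(\<Sum>k<K. a k powr p) = 0" 
      using sum_nonneg[of "{..<K}" "\<lambda>k. a k powr p"] B(2) 2 by simp
    then have "\<forall>k\<in>{..<K}. a k powr p = 0" by (subst (asm) sum_nonneg_eq_0_iff) auto
    then show ?thesis using B by simp
  qed simp
next
  case False
  \<comment> \<open>balances the two terms \<open>K c\<close> and \<open>c powr (1 - p) * B powr p\<close>\<close>
  define c where "c = B * real K powr (- 1 / p)"
  have c: "0 < c" using False B by (simp add: c_def)
  have "(\<Sum>k<K. a k) \<le> (\<Sum>k<K. c + c powr (1 - p) * a k powr p)"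
    using p c a by (intro sum_mono le_add_powr_scaled) auto
  also have "\<dots> = real K * c + c powr (1 - p) * (\<Sum>k<K. a k powr p)"
    by (simp add: sum.distrib sum_distrib_left)
  also have "\<dots> \<le> real K * c + c powr (1 - p) * B powr p"
    using B by (intro add_left_mono mult_left_mono) auto
  also have "c powr (1 - p) * B powr p = B * real K powr (1 - 1 / p)"
  proof -
    have "c powr (1 - p) = B powr (1 - p) * real K powr ((- 1 / p) * (1 - p))"
      unfolding c_def using False B by (simp add: powr_mult powr_powr)
    moreover have "(- 1 / p) * (1 - p) = 1 - 1 / p" using p by (simp add: field_simps)
    moreover have "B powr (1 - p) * B powr p = B" using False B by (simp add: powr_add[symmetric])
    ultimately show ?thesis by (simp add: mult_ac)
  qed
  also have "real K * c = B * real K powr (1 - 1 / p)"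
    using False powr_add[of "real K" 1 "- 1 / p"] by (simp add: c_def)
  finally show ?thesis by simp
qed

text \<open>
  The mean value property bounds \<open>|g z|\<close> by the mean of \<open>|g|\<close>; \<open>le_add_powr_scaled\<close> with \<open>c = |g z| / 2\<close>
  passes to the mean of \<open>|g| powr p\<close>.
\<close>

lemma circle_mean_powr:
  assumes g: "g holomorphic_on cball z r" and r: "0 < r" and p: "1 \<le> p"
  shows "2 * pi * (cmod (g z) / 2) powr p \<le> integral {0..2*pi} (\<lambda>t. cmod (g (z + rcis r t)) powr p)"
proof -
  have mem: "z + rcis r t \<in> cball z r" for t using r by (simp add: dist_norm)
  have cg: "continuous_on A (\<lambda>t. g (z + rcis r t))" for A
    by (rule continuous_on_compose2[OF holomorphic_on_imp_continuous_on[OF g]])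
      (use mem in \<open>auto simp: rcis_def cis.ctr Complex_eq intro!: continuous_intros\<close>)
  have cp: "continuous_on A (\<lambda>t. cmod (g (z + rcis r t)) powr p)" for A
    using p by (intro continuous_on_powr' continuous_intros cg) auto
  show ?thesis
  proof (cases "g z = 0")
  case True
  then show ?thesis using p
    by (simp add: Henstock_Kurzweil_Integration.integral_nonneg[OF integrable_continuous_real[OF cp]])
next
  case False
  have "((\<lambda>u. g u / (u - z)) has_contour_integral (2 * of_real pi * \<i> * g z)) (part_circlepath z r 0 (2 * pi))"
    using Cauchy_integral_circlepath_simple[OF g, of z] r by (simp add: circlepath_def)
  then have "((\<lambda>t. g (z + r * cis t) / (z + r * cis t - z) * r * \<i> * cis t) has_integral (2 * of_real pi * \<i> * g z)) {0..2 * pi}"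
    by (subst (asm) has_contour_integral_part_circlepath_iff) auto
  then have "((\<lambda>t. \<i> * g (z + rcis r t)) has_integral (2 * of_real pi * \<i> * g z)) {0..2 * pi}"
    by (rule has_integral_eq[rotated]) (use r in \<open>auto simp: rcis_def field_simps\<close>)
  then have "2 * of_real pi * \<i> * g z = integral {0..2*pi} (\<lambda>t. \<i> * g (z + rcis r t))" by (rule integral_unique[symmetric])
  then have "cmod (2 * of_real pi * \<i> * g z) \<le> integral {0..2*pi} (\<lambda>t. cmod (g (z + rcis r t)))"
    by (simp only:, intro integral_norm_bound_integral integrable_continuous_real continuous_intros cg) (auto simp: norm_mult)
  then have 1: "2 * pi * cmod (g z) \<le> integral {0..2*pi} (\<lambda>t. cmod (g (z + rcis r t)))" by (simp add: norm_mult)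
  define c where "c = cmod (g z) / 2"
  have c: "0 < c" using False by (simp add: c_def)
  note 1
  also have "integral {0..2*pi} (\<lambda>t. cmod (g (z + rcis r t)))
      \<le> integral {0..2*pi} (\<lambda>t. c + c powr (1 - p) * cmod (g (z + rcis r t)) powr p)"
    using p c by (intro integral_le integrable_continuous_real continuous_intros cg cp le_add_powr_scaled) auto
  also have "\<dots> = 2 * pi * c + c powr (1 - p) * integral {0..2*pi} (\<lambda>t. cmod (g (z + rcis r t)) powr p)"
    by (subst Henstock_Kurzweil_Integration.integral_add)
       (auto intro!: integrable_continuous_real continuous_intros cp)
  finally have "2 * pi * c \<le> c powr (1 - p) * integral {0..2*pi} (\<lambda>t. cmod (g (z + rcis r t)) powr p)"
    by (simp add: c_def algebra_simps)
  then have "c powr (p - 1) * (2 * pi * c) \<le> c powr (p - 1) * (c powr (1 - p) * integral {0..2*pi} (\<lambda>t. cmod (g (z + rcis r t)) powr p))"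
    by (intro mult_left_mono) auto
  moreover have e1: "c powr (p - 1) * (2 * pi * c) = 2 * pi * c powr p"
    using c powr_add[of c "p - 1" 1] by simp
  moreover have e2: "c powr (p - 1) * (c powr (1 - p) * I) = I" for I
    using c powr_add[of c "p - 1" "1 - p"] by (simp add: mult.assoc[symmetric])
  ultimately have "2 * pi * c powr p \<le> integral {0..2*pi} (\<lambda>t. cmod (g (z + rcis r t)) powr p)"
    by (simp only: e1 e2)
  then show ?thesis by (simp only: c_def)
  qed
qed

text \<open>
  \<open>circle_mean_powr\<close>, integrated over the radius.
\<close>

lemma area_submean_powr:
  assumes g: "g holomorphic_on ball z R" and R: "0 < R" and p: "1 \<le> p"
  shows "ennreal (pi * R\<^sup>2 * (cmod (g z) / 2) powr p)
      \<le> (\<integral>\<^sup>+w. ennreal (indicator (ball z R) w * cmod (g w) powr p) \<partial>lborel)"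
proof -
  define F where "F w = ennreal (indicator (ball z R) w * cmod (g w) powr p)" for w
  have cp: "continuous_on (ball z R) (\<lambda>w. cmod (g w) powr p)"
    using p by (intro continuous_on_powr' continuous_intros holomorphic_on_imp_continuous_on[OF g]) auto
  have [measurable]: "F \<in> borel_measurable borel"
    unfolding F_def using borel_measurable_continuous_on_indicator[OF _ cp] by simp
  define c where "c = (cmod (g z) / 2) powr p"
  have c0: "0 \<le> c" by (simp add: c_def)
  have inner: "ennreal (2 * pi * c) \<le> (\<integral>\<^sup>+t. ennreal (indicator {0<..<2*pi} t) * F (z + rcis r t) \<partial>lborel)"
    if r: "0 < r" "r < R" for r
  proof -
    let ?h = "\<lambda>t. cmod (g (z + rcis r t)) powr p"
    have g': "g holomorphic_on cball z r" by (rule holomorphic_on_subset[OF g]) (use r in auto)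
    have mem: "z + rcis r t \<in> ball z R" for t using r by (simp add: dist_norm)
    have ch: "continuous_on A ?h" for A
      by (rule continuous_on_compose2[OF cp])
        (use mem in \<open>auto simp: rcis_def cis.ctr Complex_eq intro!: continuous_intros\<close>)
    have "(?h has_integral integral {0..2*pi} ?h) {0..2*pi}"
      by (intro integrable_integral integrable_continuous_real ch)
    then have "(?h has_integral integral {0..2*pi} ?h) {0<..<2*pi}"
      using has_integral_open_interval[of ?h "integral {0..2*pi} ?h" 0 "2*pi"] by simp
    then have "(\<integral>\<^sup>+t. ennreal (indicator {0<..<2*pi} t * ?h t) \<partial>lborel) = ennreal (integral {0..2*pi} ?h)"
      by (rule nn_integral_indicator_has_integral) (auto intro: borel_measurable_continuous_onI[OF ch])
    moreover have "ennreal (indicator {0<..<2*pi} t * ?h t) = ennreal (indicator {0<..<2*pi} t) * F (z + rcis r t)" for t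
      using mem[of t] by (simp add: F_def indicator_def)
    ultimately show ?thesis using circle_mean_powr[OF g' r(1) p] by (simp add: c_def ennreal_leI)
  qed
  have "((\<lambda>r. r * (2 * pi * c)) has_integral (R\<^sup>2 * (pi * c) - 0\<^sup>2 * (pi * c))) {0..R}"
    using R by (intro fundamental_theorem_of_calculus)
      (auto intro!: derivative_eq_intros simp: has_real_derivative_iff_has_vector_derivative[symmetric])
  then have h1: "((\<lambda>r. r * (2 * pi * c)) has_integral (pi * R\<^sup>2 * c)) {0<..<R}"
    using has_integral_open_interval[of "\<lambda>r. r * (2 * pi * c)" "pi * R\<^sup>2 * c" 0 R] by (simp add: mult_ac)
  have "ennreal (pi * R\<^sup>2 * c) = (\<integral>\<^sup>+r. ennreal (indicator {0<..<R} r * (r * (2 * pi * c))) \<partial>lborel)"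
    by (rule nn_integral_indicator_has_integral[OF h1, symmetric]) (use c0 in auto)
  also have "\<dots> \<le> (\<integral>\<^sup>+r. \<integral>\<^sup>+t. polar_density r t * F (z + rcis r t) \<partial>lborel \<partial>lborel)"
  proof (rule nn_integral_mono)
    fix r
    show "ennreal (indicator {0<..<R} r * (r * (2 * pi * c)))
      \<le> (\<integral>\<^sup>+t. polar_density r t * F (z + rcis r t) \<partial>lborel)"
    proof (cases "0 < r \<and> r < R")
      case True
      have [measurable]: "(\<lambda>t. z + rcis r t) \<in> borel_measurable borel"
        by (intro borel_measurable_continuous_onI) (auto simp: rcis_def cis.ctr Complex_eq intro!: continuous_intros)
      have "ennreal (r * (2 * pi * c)) = ennreal r * ennreal (2 * pi * c)"
        using True c0 by (intro ennreal_mult) auto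
      also have "\<dots> \<le> ennreal r * (\<integral>\<^sup>+t. ennreal (indicator {0<..<2*pi} t) * F (z + rcis r t) \<partial>lborel)"
        using True by (intro mult_left_mono inner) auto
      also have "\<dots> = (\<integral>\<^sup>+t. ennreal r * (ennreal (indicator {0<..<2*pi} t) * F (z + rcis r t)) \<partial>lborel)"
        by (subst nn_integral_cmult) auto
      also have "\<dots> = (\<integral>\<^sup>+t. polar_density r t * F (z + rcis r t) \<partial>lborel)"
        using True by (intro nn_integral_cong) (auto simp: indicator_def)
      finally show ?thesis using True by simp
    next
      case False
      then show ?thesis by (auto simp: indicator_def)
    qed
  qed
  also have "\<dots> = (\<integral>\<^sup>+u. F (z + u) \<partial>lborel)" by (rule nn_integral_polar[symmetric]) measurable
  also have "\<dots> = (\<integral>\<^sup>+w. F w \<partial>distr lborel borel ((+) z))" by (subst nn_integral_distr) auto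
  also have "\<dots> = (\<integral>\<^sup>+w. F w \<partial>lborel)" by (simp add: lborel_distr_plus)
  finally show ?thesis by (simp add: c_def F_def)
qed

section \<open>Local and global energy of Besov functions\<close>

lemma hol_disk_deriv: "f \<in> hol_disk \<Longrightarrow> deriv f holomorphic_on unit_disk"
  by (auto simp: hol_disk_def intro: holomorphic_deriv)

lemma one_minus_cmod_sq: "cmod w < 1 \<Longrightarrow> 0 < 1 - (cmod w)\<^sup>2"
  by (simp add: abs_square_less_1)

text \<open>
  Nonnegative integrals over the whole plane need no integrability, so the Besov integral is
  moved there once and for all.
\<close>

lemma disk_integral_eq:
  fixes h :: "complex \<Rightarrow> real"
  assumes m: "(\<lambda>w. indicator unit_disk w * h w) \<in> borel_measurable borel"
    and nonneg: "\<And>w. w \<in> unit_disk \<Longrightarrow> 0 \<le> h w"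
  shows "set_integrable disk_area unit_disk h \<longleftrightarrow> (\<integral>\<^sup>+w. ennreal (indicator unit_disk w * h w) \<partial>lborel) < \<infinity>"
    and "(LINT w:unit_disk|disk_area. h w) = enn2real (\<integral>\<^sup>+w. ennreal (indicator unit_disk w * h w) \<partial>lborel) / pi"
proof -
  let ?I = "\<integral>\<^sup>+w. ennreal (indicator unit_disk w * h w) \<partial>lborel"
  have area: "emeasure lborel unit_disk = ennreal pi"
    using emeasure_ball[of 1 "0::complex"] by (simp add: eval_unit_ball_vol)
  have sets: "sets disk_area = sets borel" by (simp add: disk_area_def)
  have m': "(\<lambda>w. indicator unit_disk w * h w) \<in> borel_measurable disk_area"
    using m by (simp add: measurable_def sets disk_area_def)
  have "(\<integral>\<^sup>+w. ennreal (indicator unit_disk w * h w) \<partial>disk_area)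
      = (\<integral>\<^sup>+w. ennreal (indicator unit_disk w * h w) * indicator unit_disk w \<partial>lborel) / emeasure lborel unit_disk"
    unfolding disk_area_def using m by (intro nn_integral_uniform_measure) auto
  also have "(\<integral>\<^sup>+w. ennreal (indicator unit_disk w * h w) * indicator unit_disk w \<partial>lborel) = ?I"
    by (intro nn_integral_cong) (auto simp: indicator_def)
  finally have nn: "(\<integral>\<^sup>+w. ennreal (indicator unit_disk w * h w) \<partial>disk_area) = ?I / ennreal pi"
    by (simp add: area)
  have nonneg': "0 \<le> indicator unit_disk w * h w" for w using nonneg[of w] by (auto simp: indicator_def)
  have norm: "norm (indicator unit_disk w * h w) = indicator unit_disk w * h w" for w
    using nonneg'[of w] by simp
  have "set_integrable disk_area unit_disk h \<longleftrightarrow> ?I / ennreal pi < \<infinity>"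
    unfolding set_integrable_def real_scaleR_def integrable_iff_bounded norm nn using m' by simp
  also have "\<dots> \<longleftrightarrow> ?I < \<infinity>"
    by (simp add: less_top[symmetric] ennreal_divide_eq_top_iff)
  finally show "set_integrable disk_area unit_disk h \<longleftrightarrow> ?I < \<infinity>" .
  have "(LINT w:unit_disk|disk_area. h w) = enn2real (?I / ennreal pi)"
    unfolding set_lebesgue_integral_def real_scaleR_def
    using m' nonneg' by (subst integral_eq_nn_integral) (auto simp: nn)
  also have "\<dots> = enn2real ?I / pi"
    by (simp add: divide_ennreal_def enn2real_mult inverse_ennreal divide_inverse)
  finally show "(LINT w:unit_disk|disk_area. h w) = enn2real ?I / pi" .
qed

definition besov_density :: "real \<Rightarrow> (complex \<Rightarrow> complex) \<Rightarrow> complex \<Rightarrow> real" where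
  "besov_density p f w = indicator unit_disk w * (cmod (deriv f w) powr p * (1 - (cmod w)\<^sup>2) powr (p - 2))"

abbreviation besov_energy :: "real \<Rightarrow> (complex \<Rightarrow> complex) \<Rightarrow> ennreal" where
  "besov_energy p f \<equiv> \<integral>\<^sup>+w. ennreal (besov_density p f w) \<partial>lborel"

abbreviation local_besov_energy :: "real \<Rightarrow> (complex \<Rightarrow> complex) \<Rightarrow> complex set \<Rightarrow> ennreal" where
  "local_besov_energy p f S \<equiv> \<integral>\<^sup>+w. ennreal (besov_density p f w) * indicator S w \<partial>lborel"

lemma besov_density_nonneg: "0 \<le> besov_density p f w"
  by (simp add: besov_density_def)

lemma besov_density_measurable:
  assumes "f \<in> hol_disk" "1 \<le> p"
  shows "besov_density p f \<in> borel_measurable borel"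
proof -
  have "continuous_on unit_disk (\<lambda>w. cmod (deriv f w) powr p)"
    using assms by (intro continuous_on_powr' continuous_intros holomorphic_on_imp_continuous_on hol_disk_deriv) auto
  moreover have "continuous_on unit_disk (\<lambda>w. (1 - (cmod w)\<^sup>2) powr (p - 2))"
    by (intro continuous_on_powr continuous_intros) (use one_minus_cmod_sq in force)
  ultimately have "continuous_on unit_disk (\<lambda>w. cmod (deriv f w) powr p * (1 - (cmod w)\<^sup>2) powr (p - 2))"
    by (rule continuous_on_mult)
  from borel_measurable_continuous_on_indicator[OF _ this]
  show ?thesis unfolding besov_density_def [abs_def] by simp
qed

lemma besov_space_iff:
  assumes "1 \<le> p"
  shows "f \<in> besov_space p \<longleftrightarrow> f \<in> hol_disk \<and> besov_energy p f < \<infinity>"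
proof (cases "f \<in> hol_disk")
  case True
  show ?thesis
    using disk_integral_eq(1)[OF besov_density_measurable[OF True assms, unfolded besov_density_def [abs_def]]] True
    by (simp add: besov_space_def besov_density_def)
qed (simp add: besov_space_def)

lemma besov_norm_eq:
  assumes "f \<in> hol_disk" "1 \<le> p"
  shows "besov_norm p f = cmod (f 0) + (enn2real (besov_energy p f) / pi) powr (1 / p)"
  using disk_integral_eq(2)[OF besov_density_measurable[OF assms, unfolded besov_density_def [abs_def]]]
  by (simp add: besov_norm_def besov_density_def)

text \<open>
  On the disk about \<open>z\<close> whose radius is half the distance to the circle, \<open>1 - |w|\<^sup>2\<close> differs from \<open>1 - |z|\<close> by a
  factor of at most 3, so the weight can be taken out of the submean value inequality for \<open>deriv f\<close>.
\<close>

lemma deriv_powr_le_local_besov: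
  assumes f: "f \<in> hol_disk" and p: "1 \<le> p" and z: "cmod z < 1"
    and S: "S \<in> sets borel" "ball z ((1 - cmod z) / 2) \<subseteq> S"
  shows "ennreal ((cmod (deriv f z) * (1 - cmod z)) powr p)
      \<le> ennreal (4 * 2 powr p * 3 powr \<bar>p - 2\<bar> / pi) * local_besov_energy p f S"
proof -
  define x where "x = 1 - cmod z"
  define R where "R = x / 2"
  have x: "0 < x" "x \<le> 1" using z by (auto simp: x_def)
  have R: "0 < R" using x by (simp add: R_def)
  have near: "x / 2 < 1 - cmod w" "1 - cmod w < 3 * x / 2" if "w \<in> ball z R" for w
    using that norm_triangle_ineq2[of w z] norm_triangle_ineq2[of z w]
    by (auto simp: R_def x_def dist_norm norm_minus_commute)
  have sub: "ball z R \<subseteq> unit_disk" using near(1) x by fastforce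
  define A where "A = 3 powr \<bar>p - 2\<bar> * x powr (2 - p)"
  have A0: "0 \<le> A" by (simp add: A_def)
  have dens: "cmod (deriv f w) powr p \<le> A * besov_density p f w" if w: "w \<in> ball z R" for w
  proof -
    define y where "y = 1 - (cmod w)\<^sup>2"
    have wlt: "cmod w < 1" using sub w by auto
    have y_eq: "y = (1 - cmod w) * (1 + cmod w)" by (simp add: y_def power2_eq_square algebra_simps)
    have "1 - cmod w \<le> y" unfolding y_eq using wlt by (simp add: mult_left_le algebra_simps)
    then have y1: "x / 3 \<le> y" using near(1)[OF w] x by linarith
    have "y \<le> (1 - cmod w) * 2" unfolding y_eq using wlt by (intro mult_left_mono) auto
    then have y2: "y \<le> 3 * x" using near(2)[OF w] by (simp add: field_simps)
    have y0: "0 < y" using y1 x by linarith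
    have "1 \<le> 3 powr \<bar>p - 2\<bar> * (y / x) powr (p - 2)"
    proof (cases "2 \<le> p")
      case True
      have "(1/3) powr (p - 2) \<le> (y / x) powr (p - 2)"
        using True y1 x by (intro powr_mono2) (auto simp: field_simps)
      then have "3 powr (p - 2) * (1/3) powr (p - 2) \<le> 3 powr (p - 2) * (y / x) powr (p - 2)"
        by (intro mult_left_mono) auto
      then show ?thesis using True by (simp add: powr_mult[symmetric])
    next
      case False
      have "3 powr (p - 2) \<le> (y / x) powr (p - 2)"
        using False y2 y0 x by (intro powr_mono2') (auto simp: field_simps)
      then have "3 powr (2 - p) * 3 powr (p - 2) \<le> 3 powr (2 - p) * (y / x) powr (p - 2)"
        by (intro mult_left_mono) auto
      then show ?thesis using False by (simp add: powr_add[symmetric])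
    qed
    also have "(y / x) powr (p - 2) = x powr (2 - p) * y powr (p - 2)"
      using x y0 powr_minus[of x "p - 2"] by (simp add: powr_divide field_simps)
    finally have "1 \<le> A * y powr (p - 2)" by (simp add: A_def mult_ac)
    then have "cmod (deriv f w) powr p * 1 \<le> cmod (deriv f w) powr p * (A * y powr (p - 2))"
      by (intro mult_left_mono) auto
    then show ?thesis using wlt by (simp add: besov_density_def y_def mult_ac)
  qed
  have "ennreal (pi * R\<^sup>2 * (cmod (deriv f z) / 2) powr p)
      \<le> (\<integral>\<^sup>+w. ennreal (indicator (ball z R) w * cmod (deriv f w) powr p) \<partial>lborel)"
    by (rule area_submean_powr[OF holomorphic_on_subset[OF hol_disk_deriv[OF f] sub] R p])
  also have "\<dots> \<le> (\<integral>\<^sup>+w. ennreal A * (ennreal (besov_density p f w) * indicator S w) \<partial>lborel)"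
  proof (rule nn_integral_mono)
    fix w
    show "ennreal (indicator (ball z R) w * cmod (deriv f w) powr p) \<le> ennreal A * (ennreal (besov_density p f w) * indicator S w)"
    proof (cases "w \<in> ball z R")
      case True
      then have "w \<in> S" using S by (auto simp: R_def x_def)
      then show ?thesis using dens[OF True] True A0 besov_density_nonneg[of p f w]
        by (simp add: ennreal_mult[symmetric] ennreal_leI)
    qed simp
  qed
  also have "\<dots> = ennreal A * local_besov_energy p f S"
    using besov_density_measurable[OF f p] S(1) by (intro nn_integral_cmult) auto
  finally have main: "ennreal (pi * R\<^sup>2 * (cmod (deriv f z) / 2) powr p)
      \<le> ennreal A * local_besov_energy p f S" .
  define k where "k = 4 * 2 powr p / pi * x powr (p - 2)"
  have k0: "0 \<le> k" by (simp add: k_def)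
  have "k * (pi * R\<^sup>2 * (cmod (deriv f z) / 2) powr p) = (cmod (deriv f z) * x) powr p"
  proof -
    have "x powr (p - 2) * x\<^sup>2 = x powr p" using x by (simp add: powr_add[symmetric] flip: powr_numeral)
    then show ?thesis using x by (simp add: k_def R_def power_divide powr_divide powr_mult field_simps)
  qed
  moreover have "k * A = 4 * 2 powr p * 3 powr \<bar>p - 2\<bar> / pi"
  proof -
    have "x powr (p - 2) * x powr (2 - p) = 1" using x by (simp add: powr_add[symmetric])
    then show ?thesis by (simp add: k_def A_def field_simps)
  qed
  ultimately show ?thesis
    using mult_left_mono[OF main, of "ennreal k"] k0 A0
    by (simp add: ennreal_mult[symmetric] mult.assoc[symmetric] x_def)
qed

section \<open>Growth of Besov functions\<close>

text \<open>
  The shell \<open>2^-(k+1) \<le> 1 - |z| \<le> 2^-k\<close>, widened so that it contains the disks about its points of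
  half the distance to the circle.
\<close>

definition dyadic_annulus :: "nat \<Rightarrow> complex set" where
  "dyadic_annulus k = {w. (1/2) ^ (k + 2) < 1 - cmod w \<and> 1 - cmod w < 2 * (1/2) ^ k}"

lemma dyadic_annulus_borel: "dyadic_annulus k \<in> sets borel"
proof -
  have "open (dyadic_annulus k)"
    unfolding dyadic_annulus_def by (intro open_Collect_conj open_Collect_less continuous_intros)
  then show ?thesis by simp
qed

text \<open>
  On the logarithmic scale the annuli are open intervals of length 3 that advance by 1.
\<close>

lemma sum_indicator_dyadic_annulus_le: "(\<Sum>k<K. indicator (dyadic_annulus k) w) \<le> (3::ennreal)"
proof -
  define J where "J = {k. k < K \<and> w \<in> dyadic_annulus k}"
  have fin: "finite J" by (simp add: J_def)
  have "card J \<le> 3"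
  proof (cases "J = {}")
    case False
    define m where "m = Min J"
    have m: "m \<in> J" unfolding m_def using fin False by (rule Min_in)
    have "J \<subseteq> {m..<m+3}"
    proof
      fix l assume l: "l \<in> J"
      have "m \<le> l" unfolding m_def using fin l by (rule Min_le)
      moreover have "l < m + 3"
      proof (rule ccontr)
        assume "\<not> l < m + 3"
        then have "(1/2::real) ^ l \<le> (1/2) ^ (m + 3)" by (intro power_decreasing) auto
        moreover have "(1/2) ^ (m + 2) < 2 * (1/2::real) ^ l"
          using l m by (auto simp: J_def dyadic_annulus_def)
        ultimately show False by (simp add: power_add power3_eq_cube)
      qed
      ultimately show "l \<in> {m..<m+3}" by simp
    qed
    then have "card J \<le> card {m..<m+3}" by (intro card_mono) auto
    then show ?thesis by simp
  qed simp
  moreover have "(\<Sum>k<K. indicator (dyadic_annulus k) w) = (of_nat (card J) :: ennreal)"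
  proof -
    have "(\<Sum>k<K. indicator (dyadic_annulus k) w) = (\<Sum>k\<in>J. 1 :: ennreal)"
      by (rule sum.mono_neutral_cong_right) (auto simp: J_def)
    then show ?thesis by simp
  qed
  moreover have "of_nat (card J) \<le> (of_nat 3 :: ennreal)" using \<open>card J \<le> 3\<close> by (simp only: of_nat_le_iff)
  ultimately show ?thesis by simp
qed

lemma ball_subset_dyadic_annulus:
  assumes "(1/2) ^ Suc k \<le> 1 - cmod z" "1 - cmod z \<le> (1/2) ^ k"
  shows "ball z ((1 - cmod z) / 2) \<subseteq> dyadic_annulus k"
proof
  fix w assume "w \<in> ball z ((1 - cmod z) / 2)"
  then have "(1 - cmod z) / 2 < 1 - cmod w" "1 - cmod w < 3 * (1 - cmod z) / 2"
    using norm_triangle_ineq2[of w z] norm_triangle_ineq2[of z w]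
    by (auto simp: dist_norm norm_minus_commute field_simps)
  then show "w \<in> dyadic_annulus k" using assms by (simp add: dyadic_annulus_def)
qed

lemma sum_local_besov_le:
  assumes f: "f \<in> hol_disk" and p: "1 \<le> p"
  shows "(\<Sum>k<K. local_besov_energy p f (dyadic_annulus k)) \<le> 3 * besov_energy p f"
proof -
  note m = besov_density_measurable[OF f p]
  have "(\<Sum>k<K. local_besov_energy p f (dyadic_annulus k))
      = (\<integral>\<^sup>+w. (\<Sum>k<K. ennreal (besov_density p f w) * indicator (dyadic_annulus k) w) \<partial>lborel)"
    using m dyadic_annulus_borel by (intro nn_integral_sum[symmetric]) auto
  also have "\<dots> \<le> (\<integral>\<^sup>+w. 3 * ennreal (besov_density p f w) \<partial>lborel)"
  proof (rule nn_integral_mono)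
    fix w
    have "(\<Sum>k<K. ennreal (besov_density p f w) * indicator (dyadic_annulus k) w)
        = ennreal (besov_density p f w) * (\<Sum>k<K. indicator (dyadic_annulus k) w)"
      by (simp add: sum_distrib_left)
    also have "\<dots> \<le> ennreal (besov_density p f w) * 3"
      by (intro mult_left_mono sum_indicator_dyadic_annulus_le) simp
    finally show "(\<Sum>k<K. ennreal (besov_density p f w) * indicator (dyadic_annulus k) w)
        \<le> 3 * ennreal (besov_density p f w)" by (simp add: mult.commute)
  qed
  also have "\<dots> = 3 * besov_energy p f"
    using m by (intro nn_integral_cmult) auto
  finally show ?thesis .
qed

text \<open>
  On the radius through \<open>z\<close> the \<open>k\<close>-th shell has length at most \<open>2^-(k+1)\<close> and there \<open>|deriv f| \<le> 2^(k+1) a k\<close>, so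
  crossing it changes \<open>f\<close> by at most \<open>a k\<close>.
\<close>

lemma increment_le_dyadic_sum:
  assumes f: "f holomorphic_on unit_disk"
    and a0: "\<And>k. 0 \<le> a k"
    and a: "\<And>k z. (1/2) ^ Suc k \<le> 1 - cmod z \<Longrightarrow> 1 - cmod z \<le> (1/2) ^ k \<Longrightarrow>
              cmod (deriv f z) * (1 - cmod z) \<le> a k"
    and z: "(1/2) ^ K \<le> 1 - cmod z"
  shows "cmod (f z - f 0) \<le> (\<Sum>k<K. a k)"
  using z
proof (induction K arbitrary: z)
  case 0
  then have "z = 0" by simp
  then show ?case by simp
next
  case (Suc K)
  show ?case
  proof (cases "(1/2) ^ K \<le> 1 - cmod z")
    case True
    then show ?thesis using Suc.IH[OF True] a0[of K] by simp
  next
    case False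
    define x where "x = 1 - (1/2::real) ^ K"
    have x0: "0 \<le> x" by (simp add: x_def power_le_one)
    have xz: "x < cmod z" using False by (simp add: x_def)
    have zpos: "0 < cmod z" using x0 xz by linarith
    have z1: "cmod z < 1" using Suc.prems zero_less_power[of "1/2::real" "Suc K"] by linarith
    define y where "y = of_real (x / cmod z) * z"
    have y: "cmod y = x" using zpos x0 by (simp add: y_def norm_mult norm_divide)
    have IH: "cmod (f y - f 0) \<le> (\<Sum>k<K. a k)" by (rule Suc.IH) (simp add: y x_def)
    have "cmod (z - y) = cmod z - x"
    proof -
      have "z - y = of_real (1 - x / cmod z) * z" by (simp add: y_def algebra_simps)
      then have "cmod (z - y) = \<bar>1 - x / cmod z\<bar> * cmod z" by (simp only: norm_mult norm_of_real)
      also have "\<dots> = cmod z - x" using xz zpos by (simp add: field_simps abs_of_pos)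
      finally show ?thesis .
    qed
    then have dist: "cmod (z - y) \<le> (1/2) ^ Suc K" using Suc.prems by (simp add: x_def)
    have seg: "cmod u \<le> cmod z \<and> x \<le> cmod u" if "u \<in> closed_segment y z" for u
    proof -
      obtain t where t: "0 \<le> t" "t \<le> 1" "u = (1 - t) *\<^sub>R y + t *\<^sub>R z" using \<open>u \<in> closed_segment y z\<close> by (auto simp: closed_segment_def)
      define c where "c = (1 - t) * (x / cmod z) + t"
      have "u = of_real c * z" by (simp add: t(3) y_def c_def scaleR_conv_of_real algebra_simps)
      moreover have "0 \<le> c" using t x0 zpos by (auto simp: c_def)
      ultimately have "cmod u = c * cmod z" by (simp add: norm_mult)
      also have "\<dots> = (1 - t) * x + t * cmod z" using zpos by (simp add: c_def field_simps)
      finally have e: "cmod u = (1 - t) * x + t * cmod z" .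
      have "cmod u - x = t * (cmod z - x)" "cmod z - cmod u = (1 - t) * (cmod z - x)"
        unfolding e by (simp_all add: algebra_simps)
      then have "0 \<le> cmod u - x" "0 \<le> cmod z - cmod u" using t xz by (metis less_eq_real_def mult_nonneg_nonneg diff_ge_0_iff_ge)+
      then show ?thesis by simp
    qed
    have d: "cmod (deriv f u) \<le> 2 ^ Suc K * a K" if u: "u \<in> closed_segment y z" for u
    proof -
      have u1: "(1/2) ^ Suc K \<le> 1 - cmod u" "1 - cmod u \<le> (1/2) ^ K"
        using seg[OF u] Suc.prems by (auto simp: x_def)
      have "cmod (deriv f u) * (1/2) ^ Suc K \<le> cmod (deriv f u) * (1 - cmod u)"
        using u1(1) by (intro mult_left_mono) auto
      also have "\<dots> \<le> a K" using u1 by (rule a)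
      finally show ?thesis by (simp add: power_one_over field_simps)
    qed
    have "cmod (f z - f y) \<le> (2 ^ Suc K * a K) * cmod (z - y)"
    proof (rule field_differentiable_bound[of "closed_segment y z" f "deriv f"])
      fix u assume u: "u \<in> closed_segment y z"
      have "cmod u < 1" using seg[OF u] z1 by linarith
      then have "(f has_field_derivative deriv f u) (at u)"
        using holomorphic_derivI[OF f, of u] by simp
      then show "(f has_field_derivative deriv f u) (at u within closed_segment y z)"
        by (rule has_field_derivative_at_within)
      show "cmod (deriv f u) \<le> 2 ^ Suc K * a K" by (rule d[OF u])
    qed auto
    also have "\<dots> \<le> (2 ^ Suc K * a K) * (1/2) ^ Suc K"
      using dist a0 by (intro mult_left_mono) auto
    also have "\<dots> = a K" by (simp add: power_one_over)
    finally have "cmod (f z - f y) \<le> a K" .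
    moreover have "cmod (f z - f 0) \<le> cmod (f z - f y) + cmod (f y - f 0)"
      using norm_triangle_ineq[of "f z - f y" "f y - f 0"] by simp
    ultimately show ?thesis using IH a0[of K] by simp
  qed
qed

text \<open>
  About \<open>log 2 (1 / (1 - |z|))\<close> shells lie between 0 and \<open>z\<close>. The increments \<open>a k\<close> over them satisfy
  \<open>(\<Sum>k. a k powr p) \<le> (D S) powr p\<close>, where \<open>S\<close> is the Besov seminorm of \<open>f\<close>, because the
  annuli overlap boundedly. Hoelder's inequality then bounds their sum by \<open>S\<close> times the
  power \<open>1 - 1/p\<close> of the number of shells.
\<close>

proposition besov_growth:
  assumes p: "1 < p"
  obtains C where "0 < C"
    "\<And>f z. f \<in> besov_space p \<Longrightarrow> z \<in> unit_disk \<Longrightarrow>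
       cmod (f z) \<le> C * besov_norm p f * log_weight (1 - 1 / p) (cmod z)"
    "\<And>f z. f \<in> besov_space p \<Longrightarrow> z \<in> unit_disk \<Longrightarrow>
       cmod (deriv f z) * (1 - cmod z) \<le> C * besov_norm p f"
proof -
  have p1: "1 \<le> p" using p by simp
  define c where "c = 4 * 2 powr p * 3 powr \<bar>p - 2\<bar> / pi"
  have c0: "0 < c" by (simp add: c_def)
  define D where "D = (3 * c * pi) powr (1 / p)"
  have D0: "0 < D" using c0 by (simp add: D_def)
  define C where "C = 1 + 4 * D"
  have "cmod (f z) \<le> C * besov_norm p f * log_weight (1 - 1 / p) (cmod z) \<and>
      cmod (deriv f z) * (1 - cmod z) \<le> C * besov_norm p f"
    if f: "f \<in> besov_space p" and z: "z \<in> unit_disk" for f z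
  proof -
    have fh: "f \<in> hol_disk" and fin: "besov_energy p f < \<infinity>"
      using f p1 by (auto simp: besov_space_iff)
    define I where "I = enn2real (besov_energy p f)"
    have I: "besov_energy p f = ennreal I" "0 \<le> I"
      using fin by (auto simp: I_def less_top)
    define S where "S = (I / pi) powr (1 / p)"
    have S0: "0 \<le> S" by (simp add: S_def)
    have norm: "besov_norm p f = cmod (f 0) + S"
      using besov_norm_eq[OF fh p1] by (simp add: S_def I_def)
    define b where "b k = enn2real (local_besov_energy p f (dyadic_annulus k))" for k
    have bI: "local_besov_energy p f (dyadic_annulus k) = ennreal (b k)" for k
    proof -
      have "local_besov_energy p f (dyadic_annulus k) \<le> besov_energy p f"
        by (intro nn_integral_mono) (auto simp: indicator_def)
      also have "\<dots> < top" by (simp add: I(1))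
      finally show ?thesis by (simp add: b_def)
    qed
    have b0: "0 \<le> b k" for k by (simp add: b_def)
    have bsum: "(\<Sum>k<K. b k) \<le> 3 * I" for K
    proof -
      have "ennreal (\<Sum>k<K. b k) \<le> ennreal (3 * I)"
        using sum_local_besov_le[OF fh p1, of K] b0 I by (simp add: bI sum_ennreal ennreal_mult)
      then show ?thesis using I by (simp add: ennreal_le_iff)
    qed
    define a where "a k = (c * b k) powr (1 / p)" for k
    have a0: "0 \<le> a k" for k by (simp add: a_def)
    have local: "cmod (deriv f z) * (1 - cmod z) \<le> a k"
      if k: "(1/2) ^ Suc k \<le> 1 - cmod z" "1 - cmod z \<le> (1/2) ^ k" for z k
    proof -
      have z1: "cmod z < 1" using k(1) zero_less_power[of "1/2::real" "Suc k"] by linarith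
      have "ennreal ((cmod (deriv f z) * (1 - cmod z)) powr p) \<le> ennreal (c * b k)"
        using deriv_powr_le_local_besov[OF fh p1 z1 dyadic_annulus_borel ball_subset_dyadic_annulus[OF k]] c0 b0
        by (simp add: c_def[symmetric] bI ennreal_mult)
      then have "(cmod (deriv f z) * (1 - cmod z)) powr p \<le> c * b k"
        using c0 b0 by (simp add: ennreal_le_iff)
      then have "((cmod (deriv f z) * (1 - cmod z)) powr p) powr (1 / p) \<le> a k"
        unfolding a_def using p by (intro powr_mono2) auto
      then show ?thesis using z1 p by (simp add: powr_powr)
    qed
    have DS: "D * S = (3 * c * I) powr (1 / p)"
      using c0 I by (simp add: D_def S_def powr_mult[symmetric] mult.assoc)
    have apow: "a k powr p = c * b k" for k using p c0 b0[of k] by (simp add: a_def powr_powr)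
    have asum: "(\<Sum>k<K. a k powr p) \<le> (D * S) powr p" for K
    proof -
      have "(\<Sum>k<K. a k powr p) = c * (\<Sum>k<K. b k)" by (simp add: apow sum_distrib_left)
      also have "\<dots> \<le> c * (3 * I)" using c0 bsum by (intro mult_left_mono) auto
      also have "\<dots> = (D * S) powr p" using p c0 I by (simp add: DS powr_powr)
      finally show ?thesis .
    qed
    have z1: "0 < 1 - cmod z" "1 - cmod z \<le> 1" using z by auto
    obtain J where J: "(1/2) ^ Suc J < 1 - cmod z" "1 - cmod z \<le> (1/2) ^ J"
      using dyadic_scale[OF z1] by blast
    have "a J \<le> D * S"
    proof -
      have "a J powr p \<le> (D * S) powr p"
        using asum[of "Suc J"] sum_nonneg[of "{..<J}" "\<lambda>k. a k powr p"] by simp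
      moreover have "(D * S) powr p < a J powr p" if "D * S < a J"
        using that p D0 S0 by (intro powr_less_mono2) auto
      ultimately show ?thesis by (meson not_le)
    qed
    then have "cmod (deriv f z) * (1 - cmod z) \<le> D * S" using local[of J z] J by simp
    also have "\<dots> \<le> C * besov_norm p f"
      unfolding norm C_def using D0 S0 by (intro mult_mono) auto
    finally have 2: "cmod (deriv f z) * (1 - cmod z) \<le> C * besov_norm p f" .
    have hol: "f holomorphic_on unit_disk" using fh by (simp add: hol_disk_def)
    have "cmod (f z - f 0) \<le> (\<Sum>k<Suc J. a k)"
      using J by (intro increment_le_dyadic_sum[OF hol a0 local]) auto
    also have "\<dots> \<le> 2 * (D * S) * real (Suc J) powr (1 - 1 / p)"
      by (rule sum_le_powr_sum[OF p1 a0 _ asum]) (use D0 S0 in auto)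
    also have "real (Suc J) powr (1 - 1 / p) \<le> 2 * log_weight (1 - 1 / p) (cmod z)"
    proof -
      have "ln ((1/2) ^ J) \<ge> ln (1 - cmod z)" using J z1 by (subst ln_le_cancel_iff) auto
      then have "real J * ln 2 \<le> ln (1 / (1 - cmod z))" using z1 by (simp add: ln_div ln_realpow power_one_over)
      moreover have "real J * (1/2) \<le> real J * ln 2" using ln2_ge_two_thirds by (intro mult_left_mono) auto
      ultimately have "real (Suc J) \<le> 2 * ln (exp 1 / (1 - cmod z))" using z1 by (subst ln_e_div) auto
      then have "real (Suc J) powr (1 - 1 / p) \<le> (2 * ln (exp 1 / (1 - cmod z))) powr (1 - 1 / p)"
        using p by (intro powr_mono2) auto
      also have "\<dots> = 2 powr (1 - 1 / p) * log_weight (1 - 1 / p) (cmod z)"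
        by (simp add: powr_mult log_weight_def)
      also have "\<dots> \<le> 2 powr 1 * log_weight (1 - 1 / p) (cmod z)"
        using p by (intro mult_right_mono powr_mono) (auto simp: log_weight_def)
      finally show ?thesis by simp
    qed
    finally have "cmod (f z - f 0) \<le> 2 * (D * S) * (2 * log_weight (1 - 1 / p) (cmod z))"
      using D0 S0 by (simp add: mult_left_mono)
    moreover have "cmod (f z) \<le> cmod (f z - f 0) + cmod (f 0) * log_weight (1 - 1 / p) (cmod z)"
    proof -
      have "1 \<le> log_weight (1 - 1 / p) (cmod z)" using p z by (intro log_weight_ge_1) auto
      then have "cmod (f 0) * 1 \<le> cmod (f 0) * log_weight (1 - 1 / p) (cmod z)" by (intro mult_left_mono) auto
      then show ?thesis using norm_triangle_ineq[of "f z - f 0" "f 0"] by simp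
    qed
    ultimately have "cmod (f z) \<le> (4 * D * S + cmod (f 0)) * log_weight (1 - 1 / p) (cmod z)"
      by (simp add: algebra_simps)
    also have "\<dots> \<le> (C * besov_norm p f) * log_weight (1 - 1 / p) (cmod z)"
      unfolding norm C_def using D0 S0 by (intro mult_right_mono) (auto simp: algebra_simps log_weight_def)
    finally show ?thesis using 2 by simp
  qed
  moreover have "0 < C" using D0 by (simp add: C_def)
  ultimately show ?thesis using that by blast
qed

section \<open>The integral formula for the operator\<close>

lemma borel_measurable_01:
  assumes "finite_borel_measure_01 \<mu>" "h \<in> borel_measurable borel"
  shows "h \<in> borel_measurable \<mu>"
  using measurable_restrict_space1[OF assms(2), of "{0..<1}"] assms(1)
  by (simp add: finite_borel_measure_01_def cong: measurable_cong_sets)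

lemma space_01: "finite_borel_measure_01 \<mu> \<Longrightarrow> space \<mu> = {0..<1}"
  using sets_eq_imp_space_eq[of \<mu> "restrict_space borel {0..<1}"]
  by (simp add: finite_borel_measure_01_def space_restrict_space)

text \<open>
  Integration term by term, dominated by \<open>\<Sum>n. norm (e n)\<close> because \<open>0 \<le> t < 1\<close>.
\<close>

lemma moment_sums:
  fixes e :: "nat \<Rightarrow> complex"
  assumes \<mu>: "finite_borel_measure_01 \<mu>" and e: "summable (\<lambda>n. norm (e n))"
  shows "(\<lambda>n. e n * of_real (moment \<mu> (k n))) sums (LINT t|\<mu>. (\<Sum>n. e n * of_real (t ^ k n)))"
proof -
  interpret finite_measure \<mu> using \<mu> by (simp add: finite_borel_measure_01_def)
  have sp: "0 \<le> t \<and> t < 1" if "t \<in> space \<mu>" for t using that space_01[OF \<mu>] by auto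
  have m: "(\<lambda>t. t ^ j) \<in> borel_measurable \<mu>" for j :: nat
    by (rule borel_measurable_01[OF \<mu>]) simp
  have int: "integrable \<mu> (\<lambda>t. t ^ j)" for j :: nat
    by (rule integrable_const_bound[of _ 1])
      (use m sp in \<open>auto intro!: AE_I2 power_le_one dest: less_imp_le\<close>)
  have intc: "integrable \<mu> (\<lambda>t. e n * of_real (t ^ k n))" for n
    using int[of "k n"] by (intro integrable_mult_right integrable_of_real) auto
  have bnd: "norm (e n * of_real (t ^ k n)) \<le> norm (e n)" if "t \<in> space \<mu>" for n t
    using sp[OF that] by (simp add: norm_mult norm_power mult_left_le power_le_one)
  have eq: "(LINT t|\<mu>. e n * of_real (t ^ k n)) = e n * of_real (moment \<mu> (k n))" for n
    using int[of "k n"] by (simp add: moment_def flip: integral_complex_of_real)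
  have "(\<lambda>n. (LINT t|\<mu>. e n * of_real (t ^ k n))) sums (LINT t|\<mu>. (\<Sum>n. e n * of_real (t ^ k n)))"
  proof (rule sums_integral[OF intc])
    show "AE t in \<mu>. summable (\<lambda>n. norm (e n * of_real (t ^ k n)))"
      by (rule AE_I2) (rule summable_comparison_test'[OF e, of 0], use bnd in auto)
    have "summable (\<lambda>n. measure \<mu> (space \<mu>) * norm (e n))" using e by (rule summable_mult)
    then show "summable (\<lambda>n. LINT t|\<mu>. norm (e n * of_real (t ^ k n)))"
    proof (rule summable_comparison_test'[where N = 0])
      fix n
      have "(LINT t|\<mu>. norm (e n * of_real (t ^ k n))) \<le> (LINT t|\<mu>. norm (e n))"
        using bnd by (intro integral_mono integrable_norm intc) auto
      then show "norm (LINT t|\<mu>. norm (e n * of_real (t ^ k n))) \<le> measure \<mu> (space \<mu>) * norm (e n)"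
        by simp
    qed
  qed
  then show ?thesis by (simp only: eq)
qed

text \<open>
  The Cauchy product with the geometric series.
\<close>

lemma partial_sums_geometric:
  fixes a :: "nat \<Rightarrow> complex"
  assumes a: "\<And>z. z \<in> unit_disk \<Longrightarrow> (\<lambda>n. a n * z ^ n) sums f z" and z: "z \<in> unit_disk"
  shows "(\<lambda>n. (\<Sum>k\<le>n. a k) * z ^ n) sums (f z / (1 - z))"
proof -
  \<comment> \<open>convergence at a point farther out gives absolute convergence at \<open>z\<close>\<close>
  obtain x :: real where x: "cmod z < x" "x < 1" using dense[of "cmod z" 1] z by auto
  have x0: "0 < x" using x norm_ge_zero[of z] by linarith
  have "summable (\<lambda>n. a n * of_real x ^ n)" using a[of "of_real x"] x x0 by (auto simp: sums_iff)
  then have 1: "summable (\<lambda>n. norm (a n * z ^ n))"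
    by (rule powser_insidea) (use x x0 in auto)
  have 2: "summable (\<lambda>n. norm (z ^ n))" using z by (simp add: norm_power summable_geometric)
  have "(\<lambda>n. \<Sum>k\<le>n. (a k * z ^ k) * z ^ (n - k)) sums ((\<Sum>n. a n * z ^ n) * (\<Sum>n. z ^ n))"
    by (rule Cauchy_product_sums[OF 1 2])
  moreover have "(\<Sum>k\<le>n. (a k * z ^ k) * z ^ (n - k)) = (\<Sum>k\<le>n. a k) * z ^ n" for n
    by (simp add: sum_distrib_right mult.assoc power_add[symmetric])
  moreover have "(\<Sum>n. a n * z ^ n) = f z" using a[OF z] by (simp add: sums_iff)
  moreover have "(\<Sum>n. z ^ n) = 1 / (1 - z)" using z by (simp add: suminf_geometric)
  ultimately show ?thesis by simp
qed

lemma taylor_coeff_sums: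
  assumes "f holomorphic_on unit_disk" "z \<in> unit_disk"
  shows "(\<lambda>n. taylor_coeff f n * z ^ n) sums f z"
  using holomorphic_power_series[OF assms] by (simp add: taylor_coeff_def)

lemma deriv_div_one_minus:
  assumes f: "f holomorphic_on unit_disk" and w: "w \<in> unit_disk"
  shows "deriv (\<lambda>w. f w / (1 - w)) w = deriv f w / (1 - w) + f w / (1 - w)\<^sup>2"
proof -
  have nz: "1 - w \<noteq> 0" using w by auto
  have d: "(f has_field_derivative deriv f w) (at w)"
    by (rule holomorphic_derivI[OF f _ w]) simp
  have "((\<lambda>w. f w / (1 - w)) has_field_derivative (deriv f w * (1 - w) - f w * - 1) / ((1 - w) * (1 - w))) (at w)"
    by (rule DERIV_divide[where g = "\<lambda>w. 1 - w", OF d _ nz]) (auto intro!: derivative_eq_intros)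
  moreover have "(x * u - y * - 1) / (u * u) = x / u + y / u\<^sup>2" if "u \<noteq> 0" for x y u :: complex
    using that by (simp add: field_simps power2_eq_square)
  ultimately have "((\<lambda>w. f w / (1 - w)) has_field_derivative deriv f w / (1 - w) + f w / (1 - w)\<^sup>2) (at w)"
    using nz by simp
  then show ?thesis by (rule DERIV_imp_deriv)
qed

context
  fixes \<mu> :: "real measure" and f :: "complex \<Rightarrow> complex"
  assumes \<mu>: "finite_borel_measure_01 \<mu>" and f: "f holomorphic_on unit_disk"
begin

lemma partial_sums_taylor:
  assumes "z \<in> unit_disk"
  shows "(\<lambda>n. (\<Sum>k\<le>n. taylor_coeff f k) * z ^ n) sums (f z / (1 - z))"
  using partial_sums_geometric[OF taylor_coeff_sums[OF f] assms] by simp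

lemma partial_sums_taylor_norm:
  assumes "z \<in> unit_disk"
  shows "summable (\<lambda>n. norm ((\<Sum>k\<le>n. taylor_coeff f k) * z ^ n))"
    and "summable (\<lambda>n. norm (diffs (\<lambda>n. \<Sum>k\<le>n. taylor_coeff f k) n * z ^ n))"
proof -
  let ?s = "\<lambda>n. \<Sum>k\<le>n. taylor_coeff f k"
  have sm: "summable (\<lambda>n. ?s n * w ^ n)" if "w \<in> unit_disk" for w
    using partial_sums_taylor[OF that] by (simp add: sums_iff)
  obtain x :: real where x: "cmod z < x" "x < 1" using dense[of "cmod z" 1] assms by auto
  have x0: "0 < x" using x norm_ge_zero[of z] by linarith
  have xz: "norm z < norm (of_real x :: complex)" using x x0 by simp
  show "summable (\<lambda>n. norm (?s n * z ^ n))"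
    by (rule powser_insidea[OF sm[of "of_real x"] xz]) (use x x0 in auto)
  have "summable (\<lambda>n. diffs ?s n * of_real x ^ n)"
    by (rule termdiff_converges[of _ 1]) (use x x0 sm in auto)
  then show "summable (\<lambda>n. norm (diffs ?s n * z ^ n))"
    by (rule powser_insidea[OF _ xz])
qed

lemma cesaro_op_sums:
  assumes z: "z \<in> unit_disk"
  shows "(\<lambda>n. (of_real (moment \<mu> n) * (\<Sum>k\<le>n. taylor_coeff f k)) * z ^ n) sums
      (LINT t|\<mu>. f (of_real t * z) / (1 - of_real t * z))"
proof -
  let ?s = "\<lambda>n. \<Sum>k\<le>n. taylor_coeff f k"
  have "(LINT t|\<mu>. (\<Sum>n. ?s n * z ^ n * of_real (t ^ n))) = (LINT t|\<mu>. f (of_real t * z) / (1 - of_real t * z))"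
  proof (rule Bochner_Integration.integral_cong)
    fix t assume "t \<in> space \<mu>"
    then have t: "0 \<le> t" "t < 1" using space_01[OF \<mu>] by auto
    have tz: "of_real t * z \<in> unit_disk"
      using z t mult_left_le_one_le[of "cmod z" t] by (auto simp: norm_mult)
    show "(\<Sum>n. ?s n * z ^ n * of_real (t ^ n)) = f (of_real t * z) / (1 - of_real t * z)"
      using sums_unique[OF partial_sums_taylor[OF tz]] by (simp add: power_mult_distrib mult_ac)
  qed simp
  then show ?thesis using moment_sums[OF \<mu> partial_sums_taylor_norm(1)[OF z], of "\<lambda>n. n"]
    by (simp add: mult_ac)
qed

lemma cesaro_op_eq_integral:
  assumes z: "z \<in> unit_disk"
  shows "cesaro_op \<mu> f z = (LINT t|\<mu>. f (of_real t * z) / (1 - of_real t * z))"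
  using cesaro_op_sums[OF z] z unfolding cesaro_op_def by (simp add: sums_iff)

lemma cesaro_op_in_hol_disk: "cesaro_op \<mu> f \<in> hol_disk"
proof -
  have "cesaro_op \<mu> f holomorphic_on ball 0 1"
  proof (rule power_series_holomorphic)
    fix w :: complex assume "w \<in> ball 0 1"
    from cesaro_op_sums[OF this] cesaro_op_eq_integral[OF this]
    show "(\<lambda>n. (of_real (moment \<mu> n) * (\<Sum>k\<le>n. taylor_coeff f k)) * (w - 0) ^ n) sums cesaro_op \<mu> f w"
      by (simp only: diff_zero)
  qed
  then show ?thesis by (simp add: hol_disk_def cesaro_op_def)
qed

lemma deriv_cesaro_op_eq_integral:
  assumes z: "z \<in> unit_disk"
  shows "deriv (cesaro_op \<mu> f) z = (LINT t|\<mu>. of_real t * deriv (\<lambda>w. f w / (1 - w)) (of_real t * z))"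
proof -
  let ?s = "\<lambda>n. \<Sum>k\<le>n. taylor_coeff f k"
  let ?c = "\<lambda>n. of_real (moment \<mu> n) * ?s n"
  have dF: "deriv (\<lambda>w. f w / (1 - w)) w = (\<Sum>n. diffs ?s n * w ^ n)" if w: "w \<in> unit_disk" for w
  proof -
    have sm: "summable (\<lambda>n. ?s n * x ^ n)" if "cmod x < 1" for x
      using partial_sums_taylor[of x] that by (simp add: sums_summable)
    have "((\<lambda>x. \<Sum>n. ?s n * x ^ n) has_field_derivative (\<Sum>n. diffs ?s n * w ^ n)) (at w)"
      by (rule termdiffs_strong'[of 1]) (use w sm in simp_all)
    then have "((\<lambda>w. f w / (1 - w)) has_field_derivative (\<Sum>n. diffs ?s n * w ^ n)) (at w)"
    proof (rule has_field_derivative_transform_within_open[of _ _ _ unit_disk])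
      show "(\<Sum>n. ?s n * x ^ n) = f x / (1 - x)" if "x \<in> unit_disk" for x
        using sums_unique[OF partial_sums_taylor[OF that]] by simp
    qed (use w in simp_all)
    then show ?thesis by (rule DERIV_imp_deriv)
  qed
  have smc: "summable (\<lambda>n. ?c n * x ^ n)" if "cmod x < 1" for x
    using cesaro_op_sums[of x] that by (simp add: sums_summable)
  have "((\<lambda>x. \<Sum>n. ?c n * x ^ n) has_field_derivative (\<Sum>n. diffs ?c n * z ^ n)) (at z)"
    by (rule termdiffs_strong'[of 1]) (use z smc in simp_all)
  then have "(cesaro_op \<mu> f has_field_derivative (\<Sum>n. diffs ?c n * z ^ n)) (at z)"
    by (rule has_field_derivative_transform_within_open[of _ _ _ unit_disk])
      (use z in \<open>simp_all add: cesaro_op_def\<close>)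
  then have "deriv (cesaro_op \<mu> f) z = (\<Sum>n. diffs ?c n * z ^ n)" by (rule DERIV_imp_deriv)
  also have "\<dots> = (\<Sum>n. (diffs ?s n * z ^ n) * of_real (moment \<mu> (Suc n)))"
    by (simp add: diffs_def mult_ac)
  also have "\<dots> = (LINT t|\<mu>. (\<Sum>n. diffs ?s n * z ^ n * of_real (t ^ Suc n)))"
    using moment_sums[OF \<mu> partial_sums_taylor_norm(2)[OF z], of Suc] by (simp add: sums_iff)
  also have "\<dots> = (LINT t|\<mu>. of_real t * deriv (\<lambda>w. f w / (1 - w)) (of_real t * z))"
  proof (rule Bochner_Integration.integral_cong)
    fix t assume "t \<in> space \<mu>"
    then have t: "0 \<le> t" "t < 1" using space_01[OF \<mu>] by auto
    have tz: "of_real t * z \<in> unit_disk"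
      using z t mult_left_le_one_le[of "cmod z" t] by (auto simp: norm_mult)
    have "summable (\<lambda>n. diffs ?s n * (of_real t * z) ^ n)"
      using partial_sums_taylor_norm(2)[OF tz] by (rule summable_norm_cancel)
    from suminf_mult[OF this, of "of_real t"]
    have "(\<Sum>n. diffs ?s n * z ^ n * of_real (t ^ Suc n)) = of_real t * (\<Sum>n. diffs ?s n * (of_real t * z) ^ n)"
      by (simp add: power_mult_distrib mult_ac)
    then show "(\<Sum>n. diffs ?s n * z ^ n * of_real (t ^ Suc n)) = of_real t * deriv (\<lambda>w. f w / (1 - w)) (of_real t * z)"
      by (simp only: dF[OF tz])
  qed simp
  finally show ?thesis .
qed

end

section \<open>The derivative of the image\<close>

text \<open>
  The factor \<open>|1 - z|\<close> enters because \<open>\<mu>\<close> lives on a radius: the kernels \<open>1 / (1 - t z)\<close> are singular only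
  at the point 1 of the circle. The share \<open>\<delta>\<close> of the power is what makes the integral over \<open>t\<close> converge
  at the rate \<open>(1 - |z|) powr - \<delta>\<close>.
\<close>

definition slit_weight :: "real \<Rightarrow> complex \<Rightarrow> real" where
  "slit_weight \<delta> z = (1 - cmod z) powr \<delta> * cmod (1 - z) powr (1 - \<delta>)"

text \<open>
  Four times the constant of \<open>carleson_kernel_bound\<close>: one factor 2 for the two terms of the derivative of
  \<open>f(w) / (1 - w)\<close>, and \<open>2 powr (1 - \<delta>) \<le> 2\<close> from \<open>cmod_one_minus_ge\<close>.
\<close>

definition carleson_const :: "real \<Rightarrow> real" where
  "carleson_const \<delta> = 4 * (2 powr (2 + \<delta>) / (1 - 2 powr - \<delta>))"

text \<open>
  Both terms of the derivative are at most \<open>A L / (x d)\<close>, where \<open>x = 1 - t |z|\<close> and \<open>d = |1 - t z| \<ge> x\<close>. Of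
  \<open>1 / d\<close> the power \<open>\<delta>\<close> is given to \<open>x\<close> and the power \<open>1 - \<delta>\<close> to \<open>|1 - z|\<close>; then \<open>t\<close> occurs only in the
  form treated by \<open>carleson_kernel_bound\<close>.
\<close>

lemma deriv_cesaro_kernel_bound:
  assumes f: "f holomorphic_on unit_disk" and \<delta>: "0 < \<delta>" "\<delta> < 1" and \<alpha>: "0 \<le> \<alpha>"
    and A: "0 \<le> A"
    and growth: "\<And>w. w \<in> unit_disk \<Longrightarrow> cmod (f w) \<le> A * log_weight \<alpha> (cmod w)"
      "\<And>w. w \<in> unit_disk \<Longrightarrow> cmod (deriv f w) * (1 - cmod w) \<le> A"
    and z: "z \<in> unit_disk" and t: "0 \<le> t" "t < 1"
  shows "cmod (deriv (\<lambda>w. f w / (1 - w)) (of_real t * z)) \<le>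
     2 * A * 2 powr (1 - \<delta>) * cmod (1 - z) powr - (1 - \<delta>) *
       (log_weight \<alpha> (t * cmod z) * (1 - t * cmod z) powr (- 1 - \<delta>))"
proof -
  define w where "w = of_real t * z"
  define x where "x = 1 - t * cmod z"
  define d where "d = cmod (1 - w)"
  define L where "L = log_weight \<alpha> (t * cmod z)"
  have tz: "t * cmod z < 1" using z t mult_left_le_one_le[of "cmod z" t] by simp
  have cw: "cmod w = t * cmod z" using t by (simp add: w_def norm_mult)
  have w: "w \<in> unit_disk" using tz cw by simp
  have x0: "0 < x" using tz by (simp add: x_def)
  have xd: "x \<le> d" using norm_triangle_ineq2[of 1 w] by (simp add: x_def d_def cw)
  have d0: "0 < d" using x0 xd by simp
  have L1: "1 \<le> L" unfolding L_def using \<alpha> t tz by (intro log_weight_ge_1) auto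
  have f1: "cmod (f w) \<le> A * L" using growth(1)[OF w] by (simp add: cw L_def)
  have f2: "cmod (deriv f w) \<le> A / x" using growth(2)[OF w] x0 by (simp add: cw x_def pos_le_divide_eq)
  have db: "1 / d \<le> 2 powr (1 - \<delta>) * cmod (1 - z) powr - (1 - \<delta>) * x powr - \<delta>"
  proof -
    have z0: "0 < cmod (1 - z)" using z by auto
    have "cmod (1 - z) \<le> 2 * d"
      unfolding d_def w_def using z t by (intro cmod_one_minus_ge) auto
    then have h: "cmod (1 - z) / 2 \<le> d" by simp
    have e: "- (1 - \<delta>) + - \<delta> = (-1 :: real)" by simp
    have "1 / d = d powr (- (1 - \<delta>) + - \<delta>)" unfolding e using d0 by (simp add: powr_minus_divide)
    also have "\<dots> = d powr - (1 - \<delta>) * d powr - \<delta>" by (rule powr_add)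
    also have "\<dots> \<le> (cmod (1 - z) / 2) powr - (1 - \<delta>) * x powr - \<delta>"
      using h xd x0 z0 d0 \<delta> by (intro mult_mono powr_mono2') auto
    also have "(cmod (1 - z) / 2) powr - (1 - \<delta>) = 2 powr (1 - \<delta>) * cmod (1 - z) powr - (1 - \<delta>)"
      using z0 powr_minus[of 2 "1 - \<delta>"] by (simp only: powr_divide) (simp add: powr_minus field_simps)
    finally show ?thesis .
  qed
  have "cmod (deriv (\<lambda>w. f w / (1 - w)) w) \<le> cmod (deriv f w) / d + cmod (f w) / d\<^sup>2"
    unfolding deriv_div_one_minus[OF f w] d_def
    by (rule order_trans[OF norm_triangle_ineq]) (simp add: norm_divide norm_power)
  also have "\<dots> \<le> (A / x * L) / d + (A * L) / (x * d)"
  proof (rule add_mono)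
    have "cmod (deriv f w) \<le> A / x * 1" using f2 by simp
    also have "\<dots> \<le> A / x * L" using L1 A x0 by (intro mult_left_mono) auto
    finally show "cmod (deriv f w) / d \<le> A / x * L / d" using d0 by (intro divide_right_mono) auto
    show "cmod (f w) / d\<^sup>2 \<le> A * L / (x * d)"
      using f1 xd x0 d0 A L1 by (intro frac_le) (auto simp: power2_eq_square)
  qed
  also have "\<dots> = 2 * A * L / x * (1 / d)" using x0 d0 by (simp add: field_simps)
  also have "\<dots> \<le> 2 * A * L / x * (2 powr (1 - \<delta>) * cmod (1 - z) powr - (1 - \<delta>) * x powr - \<delta>)"
    using A L1 x0 by (intro mult_left_mono db) auto
  also have "2 * A * L / x * (2 powr (1 - \<delta>) * cmod (1 - z) powr - (1 - \<delta>) * x powr - \<delta>)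
      = 2 * A * 2 powr (1 - \<delta>) * cmod (1 - z) powr - (1 - \<delta>) * (L * x powr (- 1 - \<delta>))"
  proof -
    have e: "- 1 - \<delta> = - \<delta> + (- 1 :: real)" by simp
    have "x powr (- 1 - \<delta>) = x powr - \<delta> / x" unfolding e powr_add using x0 by (simp add: powr_minus_divide)
    then show ?thesis by (simp add: field_simps)
  qed
  finally show ?thesis by (simp only: w_def x_def L_def)
qed

text \<open>
  The integral is split at \<open>\<rho>\<close>: below \<open>\<rho>\<close> the function \<open>f\<close> is sampled only on the disk of radius \<open>\<rho>\<close>, above \<open>\<rho>\<close>
  the measure is small.
\<close>

proposition deriv_cesaro_op_bound:
  assumes \<mu>: "finite_borel_measure_01 \<mu>" and f: "f holomorphic_on unit_disk"
    and \<delta>: "0 < \<delta>" "\<delta> < 1" and \<alpha>: "0 \<le> \<alpha>" "\<alpha> \<le> 1"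
    and \<rho>: "0 \<le> \<rho>" "\<rho> < 1" and A: "0 \<le> A" and \<eta>: "0 \<le> \<eta>"
    and growth: "\<And>w. w \<in> unit_disk \<Longrightarrow> cmod (f w) \<le> A * log_weight \<alpha> (cmod w)"
      "\<And>w. w \<in> unit_disk \<Longrightarrow> cmod (deriv f w) * (1 - cmod w) \<le> A"
    and small: "\<And>w. cmod w \<le> \<rho> \<Longrightarrow> cmod (deriv (\<lambda>w. f w / (1 - w)) w) \<le> \<eta>"
    and \<epsilon>: "\<And>t. \<rho> \<le> t \<Longrightarrow> t < 1 \<Longrightarrow> measure \<mu> {t..<1} * log_weight \<alpha> t \<le> \<epsilon> * (1 - t)"
    and z: "z \<in> unit_disk"
  shows "slit_weight \<delta> z * cmod (deriv (cesaro_op \<mu> f) z)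
      \<le> 2 * \<eta> * measure \<mu> (space \<mu>) + carleson_const \<delta> * A * \<epsilon>"
proof -
  interpret finite_measure \<mu> using \<mu> by (simp add: finite_borel_measure_01_def)
  define r where "r = cmod z"
  have r: "0 \<le> r" "r < 1" using z by (auto simp: r_def)
  define k where "k t = log_weight \<alpha> (t * r) * (1 - t * r) powr (- 1 - \<delta>)" for t
  have k0: "0 \<le> k t" for t by (simp add: k_def log_weight_def)
  define B where "B = 2 * A * 2 powr (1 - \<delta>) * cmod (1 - z) powr - (1 - \<delta>)"
  have B0: "0 \<le> B" using A by (simp add: B_def)
  have kint: "integrable \<mu> (\<lambda>t. indicator {\<rho>..<1} t * k t)"
  proof (rule integrable_const_bound[of _ "k 1"])
    show "(\<lambda>t. indicator {\<rho>..<1} t * k t) \<in> borel_measurable \<mu>"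
      by (rule borel_measurable_01[OF \<mu>]) (simp add: k_def log_weight_def)
    show "AE t in \<mu>. norm (indicator {\<rho>..<1} t * k t) \<le> k 1"
    proof (rule AE_I2)
      fix t assume "t \<in> space \<mu>"
      then have t: "0 \<le> t" "t < 1" using space_01[OF \<mu>] by auto
      have tr: "t * r \<le> r" using t r by (simp add: mult_left_le_one_le)
      have "k t \<le> k 1"
        unfolding k_def using tr t r \<alpha> \<delta>
        by (intro mult_mono log_weight_mono powr_mono2') (auto simp: log_weight_def)
      then show "norm (indicator {\<rho>..<1} t * k t) \<le> k 1"
        using k0[of t] k0[of 1] by (auto simp: indicator_def)
    qed
  qed
  have pw: "cmod (of_real t * deriv (\<lambda>w. f w / (1 - w)) (of_real t * z)) \<le> \<eta> + B * (indicator {\<rho>..<1} t * k t)"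
    if "t \<in> space \<mu>" for t
  proof -
    have t: "0 \<le> t" "t < 1" using that space_01[OF \<mu>] by auto
    have "cmod (of_real t * deriv (\<lambda>w. f w / (1 - w)) (of_real t * z)) \<le> cmod (deriv (\<lambda>w. f w / (1 - w)) (of_real t * z))"
      using t by (simp add: norm_mult mult_left_le_one_le)
    also have "\<dots> \<le> \<eta> + B * (indicator {\<rho>..<1} t * k t)"
    proof (cases "t < \<rho>")
      case True
      have "t * cmod z \<le> \<rho> * 1" using True t r by (intro mult_mono) (auto simp: r_def)
      then have "cmod (of_real t * z) \<le> \<rho>" using t by (simp add: norm_mult)
      then show ?thesis using small True by simp
    next
      case False
      then show ?thesis
        using deriv_cesaro_kernel_bound[OF f \<delta> \<alpha>(1) A growth z t] t \<eta> by (simp add: B_def k_def r_def)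
    qed
    finally show ?thesis .
  qed
  have "cmod (deriv (cesaro_op \<mu> f) z) \<le> (LINT t|\<mu>. cmod (of_real t * deriv (\<lambda>w. f w / (1 - w)) (of_real t * z)))"
    unfolding deriv_cesaro_op_eq_integral[OF \<mu> f z] by (rule integral_norm_bound)
  also have "\<dots> \<le> (LINT t|\<mu>. \<eta> + B * (indicator {\<rho>..<1} t * k t))"
    using kint pw \<eta> B0 k0 by (intro integral_mono') auto
  also have "\<dots> = \<eta> * measure \<mu> (space \<mu>) + B * (LINT t|\<mu>. indicator {\<rho>..<1} t * k t)"
    using kint by (subst Bochner_Integration.integral_add) auto
  also have "(LINT t|\<mu>. indicator {\<rho>..<1} t * k t) \<le> 2 powr (2 + \<delta>) / (1 - 2 powr - \<delta>) * \<epsilon> * (1 - r) powr - \<delta>"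
    using carleson_kernel_bound[OF \<mu> \<delta>(1) \<alpha> r \<rho> \<epsilon>] by (simp add: set_lebesgue_integral_def k_def)
  also have "2 powr (2 + \<delta>) / (1 - 2 powr - \<delta>) = carleson_const \<delta> / 4"
    unfolding carleson_const_def by (rule nonzero_mult_div_cancel_left[symmetric]) simp
  finally have main: "cmod (deriv (cesaro_op \<mu> f) z)
      \<le> \<eta> * measure \<mu> (space \<mu>) + B * (carleson_const \<delta> / 4 * \<epsilon> * (1 - r) powr - \<delta>)"
    using B0 by (simp add: mult_left_mono)
  have z0: "0 < cmod (1 - z)" using z by auto
  have e0: "0 \<le> \<epsilon>" by (rule log_carleson_const_nonneg[OF \<alpha>(1) \<rho> \<epsilon>]) (use \<rho> in auto)
  have c0: "0 \<le> carleson_const \<delta>"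
    using \<delta> by (auto simp: carleson_const_def powr_minus_divide ge_one_powr_ge_zero)
  have w0: "0 \<le> slit_weight \<delta> z" by (simp add: slit_weight_def)
  have two: "2 powr (1 - \<delta>) \<le> 2" using powr_mono[of "1 - \<delta>" 1 2] \<delta> by simp
  have w2: "slit_weight \<delta> z \<le> 2"
  proof -
    have "(1 - cmod z) powr \<delta> \<le> 1" using z \<delta> by (intro powr_le1) auto
    moreover have "cmod (1 - z) powr (1 - \<delta>) \<le> 2 powr (1 - \<delta>)"
      using norm_triangle_ineq4[of 1 z] z \<delta> by (intro powr_mono2) auto
    ultimately have "slit_weight \<delta> z \<le> 1 * 2 powr (1 - \<delta>)"
      unfolding slit_weight_def by (intro mult_mono) auto
    then show ?thesis using two by simp
  qed
  have wB: "slit_weight \<delta> z * (B * (1 - r) powr - \<delta>) \<le> 4 * A"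
  proof -
    have q1: "cmod (1 - z) powr (1 - \<delta>) * cmod (1 - z) powr - (1 - \<delta>) = 1"
      unfolding powr_add[symmetric] using z0 by simp
    have q2: "(1 - r) powr \<delta> * (1 - r) powr - \<delta> = 1"
      unfolding powr_add[symmetric] using r by simp
    have "slit_weight \<delta> z * (B * (1 - r) powr - \<delta>) = 2 * A * 2 powr (1 - \<delta>) *
        (cmod (1 - z) powr (1 - \<delta>) * cmod (1 - z) powr - (1 - \<delta>)) * ((1 - r) powr \<delta> * (1 - r) powr - \<delta>)"
      unfolding slit_weight_def B_def r_def by (simp only: mult_ac)
    then have "slit_weight \<delta> z * (B * (1 - r) powr - \<delta>) = 2 * A * 2 powr (1 - \<delta>)"
      by (simp only: q1 q2 mult_1_right)
    moreover have "2 * A * 2 powr (1 - \<delta>) \<le> 2 * A * 2" using two A by (intro mult_left_mono) auto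
    ultimately show ?thesis by simp
  qed
  have "slit_weight \<delta> z * cmod (deriv (cesaro_op \<mu> f) z)
      \<le> slit_weight \<delta> z * (\<eta> * measure \<mu> (space \<mu>) + B * (carleson_const \<delta> / 4 * \<epsilon> * (1 - r) powr - \<delta>))"
    using main w0 by (rule mult_left_mono)
  also have "\<dots> = slit_weight \<delta> z * (\<eta> * measure \<mu> (space \<mu>))
      + (slit_weight \<delta> z * (B * (1 - r) powr - \<delta>)) * (carleson_const \<delta> / 4 * \<epsilon>)"
    by (simp add: algebra_simps)
  also have "\<dots> \<le> 2 * (\<eta> * measure \<mu> (space \<mu>)) + (4 * A) * (carleson_const \<delta> / 4 * \<epsilon>)"
    using w2 wB \<eta> e0 c0 by (intro add_mono mult_right_mono) auto
  finally show ?thesis by (simp add: mult_ac)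
qed

section \<open>A Banach space inside the mean Lipschitz space\<close>

abbreviation weighted_deriv_bdd :: "(complex \<Rightarrow> real) \<Rightarrow> (complex \<Rightarrow> complex) \<Rightarrow> bool" where
  "weighted_deriv_bdd w f \<equiv> bdd_above ((\<lambda>z. w z * cmod (deriv f z)) ` unit_disk)"

definition weighted_deriv_sup :: "(complex \<Rightarrow> real) \<Rightarrow> (complex \<Rightarrow> complex) \<Rightarrow> real" where
  "weighted_deriv_sup w f = (SUP z\<in>unit_disk. w z * cmod (deriv f z))"

lemma weighted_deriv_sup_upper:
  "weighted_deriv_bdd w f \<Longrightarrow> z \<in> unit_disk \<Longrightarrow> w z * cmod (deriv f z) \<le> weighted_deriv_sup w f"
  unfolding weighted_deriv_sup_def by (rule cSUP_upper)

lemma weighted_deriv_sup_least: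
  "(\<And>z. z \<in> unit_disk \<Longrightarrow> w z * cmod (deriv f z) \<le> M) \<Longrightarrow> weighted_deriv_sup w f \<le> M"
  unfolding weighted_deriv_sup_def by (rule cSUP_least) auto

lemma hol_disk_field_differentiable:
  "f \<in> hol_disk \<Longrightarrow> z \<in> unit_disk \<Longrightarrow> f field_differentiable at z"
  by (auto simp: hol_disk_def intro: holomorphic_on_imp_differentiable_at)

lemma hol_disk_add: "f \<in> hol_disk \<Longrightarrow> g \<in> hol_disk \<Longrightarrow> (\<lambda>z. f z + g z) \<in> hol_disk"
  by (auto simp: hol_disk_def intro: holomorphic_intros)

lemma hol_disk_scale: "f \<in> hol_disk \<Longrightarrow> (\<lambda>z. c * f z) \<in> hol_disk"
  by (auto simp: hol_disk_def intro: holomorphic_intros)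

lemma weighted_deriv_add_le:
  assumes "f \<in> hol_disk" "g \<in> hol_disk" "weighted_deriv_bdd w f" "weighted_deriv_bdd w g"
    and z: "z \<in> unit_disk" and w: "0 \<le> w z"
  shows "w z * cmod (deriv (\<lambda>z. f z + g z) z) \<le> weighted_deriv_sup w f + weighted_deriv_sup w g"
proof -
  have "deriv (\<lambda>z. f z + g z) z = deriv f z + deriv g z"
    using assms z by (intro deriv_add hol_disk_field_differentiable)
  then have "w z * cmod (deriv (\<lambda>z. f z + g z) z) \<le> w z * (cmod (deriv f z) + cmod (deriv g z))"
    using w by (simp add: mult_left_mono norm_triangle_ineq)
  also have "\<dots> \<le> weighted_deriv_sup w f + weighted_deriv_sup w g"
    using weighted_deriv_sup_upper[of w f z] weighted_deriv_sup_upper[of w g z] assms by (simp add: distrib_left)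
  finally show ?thesis .
qed

lemma weighted_deriv_scale_le:
  assumes "f \<in> hol_disk" "weighted_deriv_bdd w f" "z \<in> unit_disk"
  shows "w z * cmod (deriv (\<lambda>z. c * f z) z) \<le> cmod c * weighted_deriv_sup w f"
proof -
  have "deriv (\<lambda>z. c * f z) z = c * deriv f z"
    using assms by (intro deriv_cmult hol_disk_field_differentiable)
  then have "w z * cmod (deriv (\<lambda>z. c * f z) z) = cmod c * (w z * cmod (deriv f z))"
    by (simp add: norm_mult)
  also have "\<dots> \<le> cmod c * weighted_deriv_sup w f"
    using weighted_deriv_sup_upper[of w f z] assms by (intro mult_left_mono) auto
  finally show ?thesis .
qed

text \<open>
  For small \<open>\<delta>\<close> membership implies membership in the mean Lipschitz space, while the
  triangle inequality and completeness are elementary.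
\<close>

definition slit_space :: "real \<Rightarrow> (complex \<Rightarrow> complex) set" where
  "slit_space \<delta> = {g \<in> hol_disk. weighted_deriv_bdd (slit_weight \<delta>) g}"

definition slit_norm :: "real \<Rightarrow> (complex \<Rightarrow> complex) \<Rightarrow> real" where
  "slit_norm \<delta> g = cmod (g 0) + weighted_deriv_sup (slit_weight \<delta>) g"

lemma slit_weight_nonneg: "0 \<le> slit_weight \<delta> z"
  by (simp add: slit_weight_def)

lemma one_minus_cmod_le_slit_weight:
  assumes "z \<in> unit_disk" "0 \<le> \<delta>" "\<delta> \<le> 1"
  shows "1 - cmod z \<le> slit_weight \<delta> z"
proof -
  have "1 - cmod z = (1 - cmod z) powr \<delta> * (1 - cmod z) powr (1 - \<delta>)"
    using assms by (simp add: powr_add[symmetric])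
  also have "\<dots> \<le> slit_weight \<delta> z"
    unfolding slit_weight_def using assms norm_triangle_ineq2[of 1 z]
    by (intro mult_left_mono powr_mono2) auto
  finally show ?thesis .
qed

lemma slit_norm_bounds:
  assumes "g \<in> slit_space \<delta>"
  shows "cmod (g 0) \<le> slit_norm \<delta> g"
    and "z \<in> unit_disk \<Longrightarrow> slit_weight \<delta> z * cmod (deriv g z) \<le> slit_norm \<delta> g"
    and "0 \<le> slit_norm \<delta> g"
proof -
  have up: "slit_weight \<delta> z * cmod (deriv g z) \<le> weighted_deriv_sup (slit_weight \<delta>) g"
    if "z \<in> unit_disk" for z
    using assms that by (intro weighted_deriv_sup_upper) (simp_all add: slit_space_def)
  have "0 \<le> slit_weight \<delta> 0 * cmod (deriv g 0)" by (simp add: slit_weight_nonneg)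
  also have "\<dots> \<le> weighted_deriv_sup (slit_weight \<delta>) g" by (rule up) simp
  finally have "0 \<le> weighted_deriv_sup (slit_weight \<delta>) g" .
  then show "cmod (g 0) \<le> slit_norm \<delta> g" "0 \<le> slit_norm \<delta> g" by (simp_all add: slit_norm_def)
  show "slit_weight \<delta> z * cmod (deriv g z) \<le> slit_norm \<delta> g" if "z \<in> unit_disk"
    using up[OF that] by (simp add: slit_norm_def add_increasing)
qed

lemma slit_space_intro:
  assumes "g \<in> hol_disk" "\<And>z. z \<in> unit_disk \<Longrightarrow> slit_weight \<delta> z * cmod (deriv g z) \<le> M"
  shows "g \<in> slit_space \<delta>" "slit_norm \<delta> g \<le> cmod (g 0) + M"
proof -
  show "g \<in> slit_space \<delta>" using assms by (auto simp: slit_space_def intro!: bdd_aboveI2[of _ _ M])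
  show "slit_norm \<delta> g \<le> cmod (g 0) + M"
    unfolding slit_norm_def using assms(2) by (intro add_left_mono weighted_deriv_sup_least) auto
qed

lemma slit_space_add:
  assumes "f \<in> slit_space \<delta>" "g \<in> slit_space \<delta>"
  shows "(\<lambda>z. f z + g z) \<in> slit_space \<delta>" "slit_norm \<delta> (\<lambda>z. f z + g z) \<le> slit_norm \<delta> f + slit_norm \<delta> g"
proof -
  let ?S = "weighted_deriv_sup (slit_weight \<delta>)"
  have h: "f \<in> hol_disk" "g \<in> hol_disk" using assms by (auto simp: slit_space_def)
  have b: "slit_weight \<delta> z * cmod (deriv (\<lambda>z. f z + g z) z) \<le> ?S f + ?S g" if "z \<in> unit_disk" for z
    using assms that by (intro weighted_deriv_add_le slit_weight_nonneg) (simp_all add: slit_space_def)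
  show "(\<lambda>z. f z + g z) \<in> slit_space \<delta>" by (rule slit_space_intro(1)[OF hol_disk_add[OF h] b])
  have "slit_norm \<delta> (\<lambda>z. f z + g z) \<le> cmod (f 0 + g 0) + (?S f + ?S g)"
    by (rule slit_space_intro(2)[OF hol_disk_add[OF h] b])
  also have "\<dots> \<le> slit_norm \<delta> f + slit_norm \<delta> g"
    using norm_triangle_ineq[of "f 0" "g 0"] by (simp add: slit_norm_def)
  finally show "slit_norm \<delta> (\<lambda>z. f z + g z) \<le> slit_norm \<delta> f + slit_norm \<delta> g" .
qed

lemma slit_space_scale:
  assumes "f \<in> slit_space \<delta>"
  shows "(\<lambda>z. c * f z) \<in> slit_space \<delta>" "slit_norm \<delta> (\<lambda>z. c * f z) = cmod c * slit_norm \<delta> f"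
proof -
  let ?S = "weighted_deriv_sup (slit_weight \<delta>)"
  have le: "(\<lambda>z. c * f z) \<in> slit_space \<delta> \<and> slit_norm \<delta> (\<lambda>z. c * f z) \<le> cmod c * slit_norm \<delta> f"
    if f: "f \<in> slit_space \<delta>" for c f
  proof -
    have h: "f \<in> hol_disk" using f by (auto simp: slit_space_def)
    have b: "slit_weight \<delta> z * cmod (deriv (\<lambda>z. c * f z) z) \<le> cmod c * ?S f" if "z \<in> unit_disk" for z
      using f that by (intro weighted_deriv_scale_le) (simp_all add: slit_space_def)
    show ?thesis
      using slit_space_intro[OF hol_disk_scale[OF h] b] by (simp add: slit_norm_def norm_mult distrib_left)
  qed
  show "(\<lambda>z. c * f z) \<in> slit_space \<delta>" using le[OF assms] by simp
  show "slit_norm \<delta> (\<lambda>z. c * f z) = cmod c * slit_norm \<delta> f"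
  proof (cases "c = 0")
    case True
    have "0 \<le> slit_norm \<delta> (\<lambda>z. 0 * f z)" using le[OF assms, of 0] slit_norm_bounds(3) by blast
    then show ?thesis using True le[OF assms, of 0] by simp
  next
    case False
    have "slit_norm \<delta> (\<lambda>z. inverse c * (c * f z)) \<le> cmod (inverse c) * slit_norm \<delta> (\<lambda>z. c * f z)"
      using le[of "\<lambda>z. c * f z" "inverse c"] le[OF assms, of c] by blast
    moreover have "(\<lambda>z. inverse c * (c * f z)) = f" using False by (auto simp: fun_eq_iff)
    ultimately have "cmod c * slit_norm \<delta> f \<le> slit_norm \<delta> (\<lambda>z. c * f z)"
      using False by (simp add: norm_inverse norm_divide field_simps)
    then show ?thesis using le[OF assms, of c] by simp
  qed
qed

lemma slit_space_eval_bound: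
  assumes g: "g \<in> slit_space \<delta>" and \<delta>: "0 \<le> \<delta>" "\<delta> \<le> 1" and z: "z \<in> unit_disk"
  shows "cmod (g z) \<le> (1 + 1 / (1 - cmod z)) * slit_norm \<delta> g"
proof -
  have h: "g holomorphic_on unit_disk" using g by (auto simp: slit_space_def hol_disk_def)
  have z1: "0 < 1 - cmod z" using z by simp
  have "cmod (g z - g 0) \<le> (slit_norm \<delta> g / (1 - cmod z)) * cmod (z - 0)"
  proof (rule field_differentiable_bound[of "cball 0 (cmod z)" g "deriv g"])
    fix u :: complex assume "u \<in> cball 0 (cmod z)"
    then have u: "u \<in> unit_disk" "cmod u \<le> cmod z" using z by auto
    show "(g has_field_derivative deriv g u) (at u within cball 0 (cmod z))"
      using holomorphic_derivI[OF h _ u(1)] by (simp add: has_field_derivative_at_within)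
    have "(1 - cmod z) * cmod (deriv g u) \<le> slit_weight \<delta> u * cmod (deriv g u)"
      using one_minus_cmod_le_slit_weight[OF u(1) \<delta>] u by (intro mult_right_mono) auto
    also have "\<dots> \<le> slit_norm \<delta> g" by (rule slit_norm_bounds(2)[OF g u(1)])
    finally show "cmod (deriv g u) \<le> slit_norm \<delta> g / (1 - cmod z)" using z1 by (simp add: field_simps)
  qed auto
  also have "\<dots> \<le> (slit_norm \<delta> g / (1 - cmod z)) * 1"
    using z1 z slit_norm_bounds(3)[OF g] by (intro mult_left_mono) auto
  finally have "cmod (g z - g 0) \<le> slit_norm \<delta> g / (1 - cmod z)" by simp
  moreover have "cmod (g z) \<le> cmod (g z - g 0) + cmod (g 0)" using norm_triangle_ineq[of "g z - g 0" "g 0"] by simp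
  ultimately show ?thesis using slit_norm_bounds(1)[OF g] by (simp add: distrib_right)
qed

lemma zero_in_slit_space: "(\<lambda>z. 0) \<in> slit_space \<delta>" "slit_norm \<delta> (\<lambda>z. 0) = 0"
proof -
  have z: "(\<lambda>z. 0) \<in> hol_disk" by (simp add: hol_disk_def)
  show 1: "(\<lambda>z. 0) \<in> slit_space \<delta>" by (rule slit_space_intro(1)[OF z, of _ 0]) simp
  show "slit_norm \<delta> (\<lambda>z. 0) = 0"
    using slit_space_intro(2)[OF z, of \<delta> 0] slit_norm_bounds(3)[OF 1] by simp
qed

lemma normed_slit_space:
  assumes \<delta>: "0 \<le> \<delta>" "\<delta> \<le> 1"
  shows "normed_function_space (slit_space \<delta>) (slit_norm \<delta>)"
proof
  fix f assume f: "f \<in> slit_space \<delta>"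
  show "slit_norm \<delta> f = 0 \<longleftrightarrow> f = (\<lambda>z. 0)"
  proof
    assume n: "slit_norm \<delta> f = 0"
    show "f = (\<lambda>z. 0)"
    proof
      fix z show "f z = 0"
        using slit_space_eval_bound[OF f \<delta>, of z] n f by (cases "z \<in> unit_disk") (auto simp: slit_space_def hol_disk_def)
    qed
  qed (simp add: zero_in_slit_space)
qed (use slit_space_add slit_space_scale zero_in_slit_space slit_norm_bounds(3) in auto)

text \<open>
  Since the weight is at least \<open>1 - |z|\<close>, the derivatives of a Cauchy sequence converge uniformly on compact
  disks. The limit is holomorphic, and its primitive with the right value at 0 is the limit of the sequence.
\<close>

lemma slit_space_complete:
  assumes \<delta>: "0 \<le> \<delta>" "\<delta> \<le> 1"
  shows "Metric_space.mcomplete (slit_space \<delta>) (norm_dist (slit_space \<delta>) (slit_norm \<delta>))"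
proof -
  interpret E: normed_function_space "slit_space \<delta>" "slit_norm \<delta>" by (rule normed_slit_space[OF \<delta>])
  interpret M: Metric_space "slit_space \<delta>" "norm_dist (slit_space \<delta>) (slit_norm \<delta>)"
    by (rule E.Metric_space_norm_dist)
  show ?thesis
    unfolding M.mcomplete_def
  proof (intro allI impI)
    fix \<sigma> assume C: "M.MCauchy \<sigma>"
    then have \<sigma>: "\<sigma> n \<in> slit_space \<delta>" for n by (auto simp: M.MCauchy_def)
    have hol: "\<sigma> n holomorphic_on unit_disk" for n using \<sigma>[of n] by (auto simp: slit_space_def hol_disk_def)
    have Cau: "\<exists>n0. \<forall>m\<ge>n0. \<forall>n\<ge>n0. slit_norm \<delta> (\<lambda>z. \<sigma> m z - \<sigma> n z) < e" if "0 < e" for e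
      using C that \<sigma> unfolding M.MCauchy_def norm_dist_def by (auto; metis)
    have dd: "deriv (\<lambda>z. \<sigma> m z - \<sigma> n z) z = deriv (\<sigma> m) z - deriv (\<sigma> n) z" if "z \<in> unit_disk" for m n z
      using that by (intro deriv_diff holomorphic_on_imp_differentiable_at[OF hol]) auto
    have wd: "slit_weight \<delta> z * cmod (deriv (\<sigma> m) z - deriv (\<sigma> n) z) \<le> slit_norm \<delta> (\<lambda>z. \<sigma> m z - \<sigma> n z)"
      if "z \<in> unit_disk" for z m n
      using slit_norm_bounds(2)[OF E.diff_mem[OF \<sigma> \<sigma>] that, of m n] dd[OF that] by simp
    have wpos: "0 < slit_weight \<delta> z" if "z \<in> unit_disk" for z
      using one_minus_cmod_le_slit_weight[OF that \<delta>] that by auto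
    have "Cauchy (\<lambda>n. deriv (\<sigma> n) z)" if z: "z \<in> unit_disk" for z
    proof (rule metric_CauchyI)
      fix e :: real assume "0 < e"
      then have "0 < slit_weight \<delta> z * e" using wpos[OF z] by simp
      then obtain n0 where n0: "\<forall>m\<ge>n0. \<forall>n\<ge>n0. slit_norm \<delta> (\<lambda>z. \<sigma> m z - \<sigma> n z) < slit_weight \<delta> z * e"
        using Cau by blast
      have "dist (deriv (\<sigma> m) z) (deriv (\<sigma> n) z) < e" if "m \<ge> n0" "n \<ge> n0" for m n
      proof -
        have "slit_weight \<delta> z * cmod (deriv (\<sigma> m) z - deriv (\<sigma> n) z) < slit_weight \<delta> z * e"
          using wd[OF z, of m n] n0 that by fastforce
        then show ?thesis using wpos[OF z] by (simp add: dist_norm)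
      qed
      then show "\<exists>M. \<forall>m\<ge>M. \<forall>n\<ge>M. dist (deriv (\<sigma> m) z) (deriv (\<sigma> n) z) < e" by blast
    qed
    then have "\<forall>z\<in>unit_disk. \<exists>l. (\<lambda>n. deriv (\<sigma> n) z) \<longlonglongrightarrow> l" by (auto simp: Cauchy_convergent_iff convergent_def)
    then obtain h where h: "\<And>z. z \<in> unit_disk \<Longrightarrow> (\<lambda>n. deriv (\<sigma> n) z) \<longlonglongrightarrow> h z" by metis
    have "Cauchy (\<lambda>n. \<sigma> n 0)"
    proof (rule metric_CauchyI)
      fix e :: real assume "0 < e"
      then obtain n0 where n0: "\<forall>m\<ge>n0. \<forall>n\<ge>n0. slit_norm \<delta> (\<lambda>z. \<sigma> m z - \<sigma> n z) < e" using Cau by blast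
      have "dist (\<sigma> m 0) (\<sigma> n 0) < e" if "m \<ge> n0" "n \<ge> n0" for m n
        using slit_norm_bounds(1)[OF E.diff_mem[OF \<sigma> \<sigma>], of m n] n0 that by (fastforce simp: dist_norm)
      then show "\<exists>M. \<forall>m\<ge>M. \<forall>n\<ge>M. dist (\<sigma> m 0) (\<sigma> n 0) < e" by blast
    qed
    then obtain l where l: "(\<lambda>n. \<sigma> n 0) \<longlonglongrightarrow> l" by (auto simp: Cauchy_convergent_iff convergent_def)
    have lim: "slit_weight \<delta> z * cmod (deriv (\<sigma> m) z - h z) \<le> e"
      if "\<forall>n\<ge>n0. slit_norm \<delta> (\<lambda>z. \<sigma> m z - \<sigma> n z) < e" "z \<in> unit_disk" for m n0 e z
    proof (rule tendsto_upperbound)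
      show "(\<lambda>n. slit_weight \<delta> z * cmod (deriv (\<sigma> m) z - deriv (\<sigma> n) z)) \<longlonglongrightarrow> slit_weight \<delta> z * cmod (deriv (\<sigma> m) z - h z)"
        by (intro tendsto_intros h that)
      show "\<forall>\<^sub>F n in sequentially. slit_weight \<delta> z * cmod (deriv (\<sigma> m) z - deriv (\<sigma> n) z) \<le> e"
        unfolding eventually_sequentially
        using that(1) wd[OF that(2), of m] by (intro exI[of _ n0]) (meson less_imp_le order_trans)
    qed simp
    have "h holomorphic_on unit_disk"
    proof (rule holomorphic_uniform_sequence)
      show "deriv (\<sigma> n) holomorphic_on unit_disk" for n by (intro holomorphic_deriv hol) simp
      fix x assume x: "x \<in> unit_disk"
      define d where "d = (1 - cmod x) / 2"
      have d: "0 < d" using x by (simp add: d_def)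
      have cb: "d \<le> 1 - cmod y" if "y \<in> cball x d" for y
        using that norm_triangle_ineq2[of y x] by (auto simp: d_def dist_norm norm_minus_commute field_simps)
      have sub: "cball x d \<subseteq> unit_disk" using cb d by fastforce
      have "uniform_limit (cball x d) (\<lambda>n. deriv (\<sigma> n)) h sequentially"
      proof (rule uniform_limitI)
        fix e :: real assume e: "0 < e"
        then have "0 < d * e / 2" using d by simp
        then obtain n0 where n0: "\<forall>m\<ge>n0. \<forall>n\<ge>n0. slit_norm \<delta> (\<lambda>z. \<sigma> m z - \<sigma> n z) < d * e / 2" using Cau by blast
        have "dist (deriv (\<sigma> m) y) (h y) < e" if m: "m \<ge> n0" and y: "y \<in> cball x d" for m y
        proof -
          have yd: "y \<in> unit_disk" using sub y by auto
          have "d * cmod (deriv (\<sigma> m) y - h y) \<le> slit_weight \<delta> y * cmod (deriv (\<sigma> m) y - h y)"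
            using one_minus_cmod_le_slit_weight[OF yd \<delta>] cb[OF y] by (intro mult_right_mono) auto
          also have "\<dots> \<le> d * e / 2" using n0 m by (intro lim[of n0] yd) auto
          also have "\<dots> < d * e" using d e by simp
          finally show ?thesis using d by (simp add: dist_norm)
        qed
        then show "\<forall>\<^sub>F n in sequentially. \<forall>y\<in>cball x d. dist (deriv (\<sigma> n) y) (h y) < e"
          unfolding eventually_sequentially by blast
      qed
      then show "\<exists>d>0. cball x d \<subseteq> unit_disk \<and> uniform_limit (cball x d) (\<lambda>n. deriv (\<sigma> n)) h sequentially"
        using d sub by blast
    qed simp
    then obtain g0 where g0: "\<And>x. x \<in> unit_disk \<Longrightarrow> (g0 has_field_derivative h x) (at x)"
      using holomorphic_convex_primitive'[of unit_disk h] by (metis at_within_open convex_ball open_ball)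
    define g where "g z = (if z \<in> unit_disk then g0 z - g0 0 + l else 0)" for z
    have gd: "(g has_field_derivative h z) (at z)" if "z \<in> unit_disk" for z
    proof (rule has_field_derivative_transform_within_open[of _ _ _ unit_disk])
      show "((\<lambda>z. g0 z - g0 0 + l) has_field_derivative h z) (at z)"
        using g0[OF that] by (auto intro!: derivative_eq_intros)
    qed (use that in \<open>simp_all add: g_def\<close>)
    have gh: "g \<in> hol_disk"
    proof -
      have "g holomorphic_on unit_disk" unfolding holomorphic_on_open[OF open_ball] using gd by blast
      then show ?thesis by (simp add: hol_disk_def g_def)
    qed
    have deriv_sg: "deriv (\<lambda>z. \<sigma> m z - g z) z = deriv (\<sigma> m) z - h z" if "z \<in> unit_disk" for m z
    proof -
      have "(\<sigma> m has_field_derivative deriv (\<sigma> m) z) (at z)" by (rule holomorphic_derivI[OF hol _ that]) simp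
      from DERIV_diff[OF this gd[OF that]] show ?thesis by (rule DERIV_imp_deriv)
    qed
    have sg_hol: "(\<lambda>z. \<sigma> m z - g z) \<in> hol_disk" for m
      using hol_disk_add[of "\<sigma> m" "\<lambda>z. -1 * g z"] hol_disk_scale[OF gh, of "-1"] \<sigma>[of m] by (simp add: slit_space_def)
    have close: "(\<lambda>z. \<sigma> m z - g z) \<in> slit_space \<delta> \<and> slit_norm \<delta> (\<lambda>z. \<sigma> m z - g z) \<le> cmod (\<sigma> m 0 - l) + e"
      if prem: "\<forall>n\<ge>n0. slit_norm \<delta> (\<lambda>z. \<sigma> m z - \<sigma> n z) < e" for m n0 e
    proof -
      have b: "slit_weight \<delta> z * cmod (deriv (\<lambda>z. \<sigma> m z - g z) z) \<le> e" if "z \<in> unit_disk" for z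
        unfolding deriv_sg[OF that] by (rule lim[OF prem that])
      have "g 0 = l" by (simp add: g_def)
      with slit_space_intro[OF sg_hol b] show ?thesis by simp
    qed
    obtain n1 where "\<forall>m\<ge>n1. \<forall>n\<ge>n1. slit_norm \<delta> (\<lambda>z. \<sigma> m z - \<sigma> n z) < 1" using Cau[of 1] by auto
    then have "(\<lambda>z. \<sigma> n1 z - g z) \<in> slit_space \<delta>" using close[of n1 n1 1] by blast
    from E.diff_mem[OF \<sigma>[of n1] this] have gE: "g \<in> slit_space \<delta>" by simp
    have "\<exists>n0. \<forall>n\<ge>n0. slit_norm \<delta> (\<lambda>z. \<sigma> n z - g z) < e" if e: "0 < e" for e
    proof -
      obtain n1 where n1: "\<forall>m\<ge>n1. \<forall>n\<ge>n1. slit_norm \<delta> (\<lambda>z. \<sigma> m z - \<sigma> n z) < e/2"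
        using Cau[of "e/2"] e by auto
      obtain n2 where n2: "\<forall>m\<ge>n2. cmod (\<sigma> m 0 - l) < e/2"
        using LIMSEQ_D[OF l, of "e/2"] e by auto
      show ?thesis
      proof (intro exI[of _ "max n1 n2"] allI impI)
        fix m assume m: "m \<ge> max n1 n2"
        then have "slit_norm \<delta> (\<lambda>z. \<sigma> m z - g z) \<le> cmod (\<sigma> m 0 - l) + e/2"
          using close[of n1 m "e/2"] n1 by auto
        also have "cmod (\<sigma> m 0 - l) < e/2" using n2 m by auto
        finally show "slit_norm \<delta> (\<lambda>z. \<sigma> m z - g z) < e" by simp
      qed
    qed
    then have "limitin M.mtopology \<sigma> g sequentially"
      unfolding M.limitin_metric eventually_sequentially using gE \<sigma> by (auto simp: norm_dist_def)
    then show "\<exists>x. limitin M.mtopology \<sigma> x sequentially" by blast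
  qed
qed

text \<open>
  The power \<open>s\<close> of the pointwise bound is \<open>(1 - r) powr - (\<delta> s) * |1 - r e^(i \<theta>)| powr - \<sigma>\<close> with \<open>\<sigma> = (1 - \<delta>) s > 1\<close>, whose
  mean over the circle is at most of order \<open>(1 - r) powr (1 - s)\<close>.
\<close>

lemma slit_space_subset_mean_lipschitz:
  assumes \<delta>: "0 < \<delta>" "\<delta> < 1" and s: "1 < s" "1 < (1 - \<delta>) * s"
  shows "slit_space \<delta> \<subseteq> mean_lipschitz_space s"
proof
  fix g assume g: "g \<in> slit_space \<delta>"
  then have gh: "g \<in> hol_disk" by (simp add: slit_space_def)
  have dh: "deriv g holomorphic_on unit_disk" using gh by (auto simp: hol_disk_def intro: holomorphic_deriv)
  define \<sigma> where "\<sigma> = (1 - \<delta>) * s"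
  define M where "M = slit_norm \<delta> g"
  define K where "K = 2 * 8 powr \<sigma> / (\<sigma> - 1)"
  have "(1 - r) powr (1 - 1 / s) * integral_mean s r (deriv g) \<le> (1 / (2 * pi) * (M powr s * K)) powr (1 / s)"
    if r: "0 < r" "r < 1" for r
  proof -
    have rd: "rcis r \<theta> \<in> unit_disk" for \<theta> using r by simp
    have nz: "0 < cmod (1 - rcis r \<theta>)" for \<theta> 
    proof -
      have "1 - r \<le> cmod (1 - rcis r \<theta>)" using norm_triangle_ineq2[of 1 "rcis r \<theta>"] r by simp
      then show ?thesis using r by linarith
    qed
    have crc: "continuous_on A (rcis r)" for A
      by (auto simp: rcis_def cis.ctr Complex_eq intro!: continuous_intros)
    have cg: "continuous_on A (\<lambda>\<theta>. deriv g (rcis r \<theta>))" for A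
      by (rule continuous_on_compose2[OF holomorphic_on_imp_continuous_on[OF dh] crc]) (use rd in auto)
    have pw: "cmod (deriv g (rcis r \<theta>)) powr s \<le> (M powr s * (1 - r) powr - (\<delta> * s)) * cmod (1 - rcis r \<theta>) powr - \<sigma>" for \<theta>
    proof -
      have "slit_weight \<delta> (rcis r \<theta>) * cmod (deriv g (rcis r \<theta>)) \<le> M"
        unfolding M_def by (rule slit_norm_bounds(2)[OF g rd])
      moreover have "c \<le> M * (inverse u * inverse v)" if "u * v * c \<le> M" "0 < u" "0 < v" for c u v :: real
        using that by (simp add: field_simps)
      ultimately have "cmod (deriv g (rcis r \<theta>))
          \<le> M * (inverse ((1 - r) powr \<delta>) * inverse (cmod (1 - rcis r \<theta>) powr (1 - \<delta>)))"
        using r nz[of \<theta>] by (simp add: slit_weight_def)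
      then have "cmod (deriv g (rcis r \<theta>)) \<le> M * ((1 - r) powr - \<delta> * cmod (1 - rcis r \<theta>) powr - (1 - \<delta>))"
        by (simp only: powr_minus)
      then have "cmod (deriv g (rcis r \<theta>)) powr s \<le> (M * ((1 - r) powr - \<delta> * cmod (1 - rcis r \<theta>) powr - (1 - \<delta>))) powr s"
        using s by (intro powr_mono2) auto
      also have "\<dots> = M powr s * ((1 - r) powr (- \<delta> * s) * cmod (1 - rcis r \<theta>) powr (- (1 - \<delta>) * s))"
        by (simp only: powr_mult powr_powr)
      also have "- (1 - \<delta>) * s = - \<sigma>" unfolding \<sigma>_def by (rule mult_minus_left)
      also have "- \<delta> * s = - (\<delta> * s)" by simp
      finally show ?thesis by (simp only: mult.assoc)
    qed
    have cK: "continuous_on A (\<lambda>\<theta>. cmod (1 - rcis r \<theta>) powr - \<sigma>)" for A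
      using nz by (intro continuous_on_powr continuous_intros crc) (auto dest: less_imp_neq)
    have "integral {0..2 * pi} (\<lambda>\<theta>. cmod (deriv g (rcis r \<theta>)) powr s)
        \<le> integral {0..2 * pi} (\<lambda>\<theta>. (M powr s * (1 - r) powr - (\<delta> * s)) * cmod (1 - rcis r \<theta>) powr - \<sigma>)"
      using s pw by (intro integral_le integrable_continuous_real continuous_on_powr' continuous_on_mult continuous_on_const cK continuous_on_norm cg) auto
    also have "\<dots> = (M powr s * (1 - r) powr - (\<delta> * s)) * integral {0..2 * pi} (\<lambda>\<theta>. cmod (1 - rcis r \<theta>) powr - \<sigma>)"
      by simp
    also have "\<dots> \<le> (M powr s * (1 - r) powr - (\<delta> * s)) * (K * (1 - r) powr (1 - \<sigma>))"
      using integral_kernel_bound[of \<sigma> r] s r by (intro mult_left_mono) (auto simp: K_def \<sigma>_def)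
    also have "\<dots> = M powr s * K * (1 - r) powr (1 - s)"
    proof -
      have "(1 - r) powr - (\<delta> * s) * (1 - r) powr (1 - \<sigma>) = (1 - r) powr (1 - s)"
        unfolding powr_add[symmetric] by (rule arg_cong[of _ _ "(powr) (1 - r)"]) (simp add: \<sigma>_def algebra_simps)
      then show ?thesis by (simp add: mult_ac)
    qed
    finally have I: "integral {0..2 * pi} (\<lambda>\<theta>. cmod (deriv g (rcis r \<theta>)) powr s) \<le> M powr s * K * (1 - r) powr (1 - s)" .
    have I0: "0 \<le> integral {0..2 * pi} (\<lambda>\<theta>. cmod (deriv g (rcis r \<theta>)) powr s)"
      using s by (intro Henstock_Kurzweil_Integration.integral_nonneg integrable_continuous_real continuous_on_powr' continuous_on_const continuous_on_norm cg) auto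
    have "integral_mean s r (deriv g) \<le> (1 / (2 * pi) * (M powr s * K) * (1 - r) powr (1 - s)) powr (1 / s)"
      unfolding integral_mean_def using I I0 s by (intro powr_mono2) (auto simp: field_simps)
    also have "\<dots> = (1 / (2 * pi) * (M powr s * K)) powr (1 / s) * (1 - r) powr ((1 - s) * (1 / s))"
      by (simp only: powr_mult powr_powr)
    finally have "(1 - r) powr (1 - 1 / s) * integral_mean s r (deriv g)
        \<le> (1 - r) powr (1 - 1 / s) * ((1 / (2 * pi) * (M powr s * K)) powr (1 / s) * (1 - r) powr ((1 - s) * (1 / s)))"
      by (intro mult_left_mono) auto
    also have "\<dots> = (1 / (2 * pi) * (M powr s * K)) powr (1 / s)"
    proof -
      have "(1 - 1 / s) + (1 - s) * (1 / s) = 0" using s by (simp add: field_simps)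
      then have "(1 - r) powr (1 - 1 / s) * (1 - r) powr ((1 - s) * (1 / s)) = 1"
        using r by (simp only: powr_add[symmetric]) simp
      then show ?thesis by (simp add: mult_ac)
    qed
    finally show ?thesis .
  qed
  then show "g \<in> mean_lipschitz_space s"
    using gh by (auto simp: mean_lipschitz_space_def intro!: bdd_aboveI2)
qed

section \<open>Closed graph arguments\<close>

context normed_function_space
begin

lemma sum_mem: "(\<And>n. h n \<in> X) \<Longrightarrow> (\<lambda>z. \<Sum>i<n. h i z) \<in> X" for n :: nat
  by (induction n) (auto intro: zero_mem add_mem)

text \<open>
  Completeness in terms of absolutely convergent series, the form that fits countable subadditivity.
\<close>

lemma abs_summable_series_converges:
  assumes complete: "Metric_space.mcomplete X (norm_dist X N)"
    and h: "\<And>n::nat. h n \<in> X" and sm: "summable (\<lambda>n. N (h n))"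
  shows "\<exists>g\<in>X. (\<lambda>n. N (\<lambda>z. g z - (\<Sum>i<n. h i z))) \<longlonglongrightarrow> 0 \<and> N g \<le> (\<Sum>n. N (h n))"
proof -
  interpret M: Metric_space X "norm_dist X N" by (rule Metric_space_norm_dist)
  define S where "S n z = (\<Sum>i<n. h i z)" for n z
  have S: "S n \<in> X" for n unfolding S_def [abs_def] by (rule sum_mem[OF h])
  define T where "T n = (\<Sum>i<n. N (h i))" for n
  have d: "N (\<lambda>z. S (n + k) z - S n z) \<le> T (n + k) - T n" for n k
  proof (induction k)
    case 0
    show ?case using norm_eq_zero[OF zero_mem] by simp
  next
    case (Suc k)
    have "N (\<lambda>z. S (n + Suc k) z - S n z) = N (\<lambda>z. (S (n + k) z - S n z) + h (n + k) z)"
      by (rule arg_cong[of _ _ N]) (simp add: S_def fun_eq_iff)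
    also have "\<dots> \<le> N (\<lambda>z. S (n + k) z - S n z) + N (h (n + k))"
      by (intro norm_triangle diff_mem S h)
    finally show ?case using Suc.IH by (simp add: T_def)
  qed
  have Tc: "Cauchy T" unfolding T_def [abs_def] using sm by (simp add: summable_iff_convergent Cauchy_convergent_iff)
  have "M.MCauchy S"
    unfolding M.MCauchy_def
  proof (intro conjI allI impI)
    show "range S \<subseteq> X" using S by auto
    fix e :: real assume "0 < e"
    then obtain n0 where n0: "\<And>m n. m \<ge> n0 \<Longrightarrow> n \<ge> n0 \<Longrightarrow> dist (T m) (T n) < e"
      using metric_CauchyD[OF Tc] by blast
    have le: "norm_dist X N (S m) (S n) < e" if "n0 \<le> n" "n \<le> m" for m n
      using d[of n "m - n"] n0[of m n] that S by (simp add: norm_dist_def dist_real_def)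
    have "norm_dist X N (S m) (S n) < e" if "n0 \<le> n" "n0 \<le> m" for m n
      using le[of n m] le[of m n] that M.commute[of "S m" "S n"] by (cases "n \<le> m") auto
    then show "\<exists>n0. \<forall>n n'. n0 \<le> n \<longrightarrow> n0 \<le> n' \<longrightarrow> norm_dist X N (S n) (S n') < e" by blast
  qed
  then obtain g where g: "limitin M.mtopology S g sequentially"
    using complete unfolding M.mcomplete_def by blast
  then have gX: "g \<in> X" by (rule M.limitin_mspace)
  have "(\<lambda>n. norm_dist X N (S n) g) \<longlonglongrightarrow> 0"
    using g unfolding M.limitin_metric_dist_null by blast
  then have lim: "(\<lambda>n. N (\<lambda>z. g z - S n z)) \<longlonglongrightarrow> 0"
    using gX S norm_minus_commute[OF gX S] by (simp add: norm_dist_def)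
  have "N g \<le> (\<Sum>n. N (h n))"
  proof (rule LIMSEQ_le_const)
    show "(\<lambda>n. T n + N (\<lambda>z. g z - S n z)) \<longlonglongrightarrow> (\<Sum>n. N (h n))"
      using tendsto_add[OF summable_LIMSEQ[OF sm] lim] by (simp add: T_def)
    have "N g \<le> T n + N (\<lambda>z. g z - S n z)" for n
    proof -
      have "N (\<lambda>z. S n z + (g z - S n z)) \<le> N (S n) + N (\<lambda>z. g z - S n z)"
        by (intro norm_triangle diff_mem S gX)
      moreover have "(\<lambda>z. S (0 + n) z - S 0 z) = S n" "T 0 = 0" by (auto simp: S_def T_def)
      then have "N (S n) \<le> T n" using d[of 0 n] by simp
      ultimately show ?thesis by simp
    qed
    then show "\<exists>N'. \<forall>n\<ge>N'. N g \<le> T n + N (\<lambda>z. g z - S n z)" by blast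
  qed
  with gX lim show ?thesis unfolding S_def by blast
qed

end

lemma deriv_sum_hol_disk:
  assumes "\<And>i::nat. h i \<in> hol_disk" "z \<in> unit_disk"
  shows "deriv (\<lambda>z. \<Sum>i<n. h i z) z = (\<Sum>i<n. deriv (h i) z)"
proof (rule DERIV_imp_deriv, rule DERIV_sum)
  fix i
  show "(h i has_field_derivative deriv (h i) z) (at z)"
    using assms by (intro holomorphic_derivI[of _ unit_disk]) (auto simp: hol_disk_def)
qed

context banach_space_of_analytic_functions
begin

lemma eval_tendsto:
  assumes f: "f \<in> X" and g: "\<And>n. g n \<in> X" and lim: "(\<lambda>n. N (\<lambda>z. f z - g n z)) \<longlonglongrightarrow> 0"
    and z: "z \<in> unit_disk"
  shows "(\<lambda>n. g n z) \<longlonglongrightarrow> f z"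
proof -
  interpret M: Metric_space X "norm_dist X N" by (rule Metric_space_norm_dist)
  have "(\<lambda>n. norm_dist X N (g n) f) \<longlonglongrightarrow> 0"
    using lim f g norm_minus_commute[OF f g] by (simp add: norm_dist_def)
  then have "limitin M.mtopology g f sequentially"
    using f g by (simp add: M.limitin_metric_dist_null)
  from continuous_map_limit[OF continuous_eval[OF z] this]
  show ?thesis by (simp add: o_def)
qed

text \<open>
  The sup norm on a compact disk is countably subadditive because point evaluations are continuous.
\<close>

lemma locally_uniformly_bounded:
  assumes \<rho>: "0 \<le> \<rho>" "\<rho> < 1"
  obtains C where "0 \<le> C" "\<And>f z. f \<in> X \<Longrightarrow> cmod z \<le> \<rho> \<Longrightarrow> cmod (f z) \<le> C * N f"
proof -
  define P where "P f = (SUP z\<in>cball 0 \<rho>. cmod (f z))" for f :: "complex \<Rightarrow> complex"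
  have sub: "cball 0 \<rho> \<subseteq> unit_disk" using \<rho> by auto
  have up: "cmod (f z) \<le> P f" if f: "f \<in> X" and z: "z \<in> cball 0 \<rho>" for f z
  proof -
    have "continuous_on (cball 0 \<rho>) f"
      using f subset_hol_disk sub by (auto simp: hol_disk_def intro!: holomorphic_on_imp_continuous_on intro: holomorphic_on_subset)
    then have "compact ((\<lambda>z. cmod (f z)) ` cball 0 \<rho>)"
      by (intro compact_continuous_image continuous_on_norm) auto
    then have "bdd_above ((\<lambda>z. cmod (f z)) ` cball 0 \<rho>)"
      by (intro bounded_imp_bdd_above compact_imp_bounded)
    then show ?thesis unfolding P_def using z by (intro cSUP_upper)
  qed
  have least: "P f \<le> M" if "\<And>z. z \<in> cball 0 \<rho> \<Longrightarrow> cmod (f z) \<le> M" for f M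
    unfolding P_def using \<rho> that by (intro cSUP_least) auto
  obtain C where C: "0 \<le> C" "\<And>f. f \<in> X \<Longrightarrow> P f \<le> C * N f"
  proof (rule bounded_if_countably_subadditive[OF complete, of P])
    show "P (\<lambda>z. f z + g z) \<le> P f + P g" if "f \<in> X" "g \<in> X" for f g
      by (rule least, rule order_trans[OF norm_triangle_ineq add_mono[OF up up]]) (use that in auto)
    show "P (\<lambda>z. c * f z) \<le> cmod c * P f" if "f \<in> X" for c f
      by (rule least) (use up[OF that] in \<open>auto simp: norm_mult intro!: mult_left_mono\<close>)
    show nonneg: "0 \<le> P f" if "f \<in> X" for f
      using up[OF that, of 0] \<rho> norm_ge_zero[of "f 0"] by (simp add: order_trans[OF norm_ge_zero])
    show "P f \<le> (\<Sum>n. P (h n))"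
      if f: "f \<in> X" and h: "\<And>n. h n \<in> X" and sm: "summable (\<lambda>n. P (h n))"
        and lim: "(\<lambda>n. N (\<lambda>z. f z - (\<Sum>i<n. h i z))) \<longlonglongrightarrow> 0" for f h
    proof (rule least)
      fix z :: complex assume z: "z \<in> cball 0 \<rho>"
      have "(\<lambda>n. \<Sum>i<n. h i z) \<longlonglongrightarrow> f z"
        using sub z by (intro eval_tendsto[OF f sum_mem[OF h] lim]) auto
      then have "(\<lambda>n. cmod (\<Sum>i<n. h i z)) \<longlonglongrightarrow> cmod (f z)" by (rule tendsto_norm)
      moreover have "cmod (\<Sum>i<n. h i z) \<le> (\<Sum>n. P (h n))" for n
      proof -
        have "cmod (\<Sum>i<n. h i z) \<le> (\<Sum>i<n. P (h i))" using up[OF h z] by (intro sum_norm_le)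
        also have "\<dots> \<le> (\<Sum>n. P (h n))" using nonneg[OF h] by (intro sum_le_suminf sm) auto
        finally show ?thesis .
      qed
      ultimately show "cmod (f z) \<le> (\<Sum>n. P (h n))" by (intro LIMSEQ_le_const2) auto
    qed
  qed (rule that)
  show ?thesis by (rule that[OF C(1)]) (use up C(2) in \<open>force intro: order_trans\<close>)
qed

text \<open>
  Cauchy's inequality on a disk about \<open>z\<close>.
\<close>

lemma deriv_eval_bounded:
  assumes z: "z \<in> unit_disk"
  obtains C where "0 \<le> C" "\<And>f. f \<in> X \<Longrightarrow> cmod (deriv f z) \<le> C * N f"
proof -
  define \<rho> where "\<rho> = (1 + cmod z) / 2"
  define d where "d = (1 - cmod z) / 2"
  have \<rho>: "0 \<le> \<rho>" "\<rho> < 1" and d: "0 < d" using z by (auto simp: \<rho>_def d_def)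
  have sub: "cmod w \<le> \<rho>" if "w \<in> cball z d" for w
    using that norm_triangle_ineq2[of w z] Real_Vector_Spaces.norm_minus_commute[of w z] by (auto simp: \<rho>_def d_def dist_norm)
  obtain C where C: "0 \<le> C" "\<And>f z. f \<in> X \<Longrightarrow> cmod z \<le> \<rho> \<Longrightarrow> cmod (f z) \<le> C * N f"
    using locally_uniformly_bounded[OF \<rho>] by blast
  show ?thesis
  proof (rule that)
    show "0 \<le> C / d" using C d by simp
    fix f assume f: "f \<in> X"
    have "cball z d \<subseteq> unit_disk" using sub \<rho> by fastforce
    then have h: "f holomorphic_on cball z d"
      using f subset_hol_disk by (auto simp: hol_disk_def intro: holomorphic_on_subset)
    have "cmod ((deriv ^^ 1) f z) \<le> fact 1 * (C * N f) / d ^ 1"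
      by (rule Cauchy_inequality)
        (use d h f C sub in \<open>auto intro!: holomorphic_on_imp_continuous_on intro: holomorphic_on_subset simp: dist_norm\<close>)
    then show "cmod (deriv f z) \<le> C / d * N f" by simp
  qed
qed

text \<open>
  The Bloch seminorm is finite on \<open>X\<close> by hypothesis, and countably subadditive because the evaluations of the
  derivative are continuous.
\<close>

proposition bloch_seminorm_bounded:
  assumes bloch: "X \<subseteq> bloch_space"
  obtains C where "0 \<le> C"
    "\<And>f z. f \<in> X \<Longrightarrow> z \<in> unit_disk \<Longrightarrow> (1 - (cmod z)\<^sup>2) * cmod (deriv f z) \<le> C * N f"
proof -
  define w where "w z = 1 - (cmod z)\<^sup>2" for z :: complex
  define P where "P = weighted_deriv_sup w"
  have hd: "f \<in> hol_disk" if "f \<in> X" for f using that subset_hol_disk by auto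
  have w0: "0 \<le> w z" if "z \<in> unit_disk" for z
    using that by (simp add: w_def abs_square_le_1)
  have bdd: "weighted_deriv_bdd w f" if "f \<in> X" for f
    using that bloch by (auto simp: bloch_space_def w_def)
  have up: "w z * cmod (deriv f z) \<le> P f" if "f \<in> X" "z \<in> unit_disk" for f z
    unfolding P_def by (rule weighted_deriv_sup_upper[OF bdd that(2)]) (rule that)
  note least = weighted_deriv_sup_least[of w, folded P_def]
  obtain C where C: "0 \<le> C" "\<And>f. f \<in> X \<Longrightarrow> P f \<le> C * N f"
  proof (rule bounded_if_countably_subadditive[OF complete, of P])
    show "P (\<lambda>z. f z + g z) \<le> P f + P g" if "f \<in> X" "g \<in> X" for f g
      unfolding P_def using that by (intro weighted_deriv_sup_least weighted_deriv_add_le hd bdd w0)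
    show "P (\<lambda>z. c * f z) \<le> cmod c * P f" if "f \<in> X" for c f
      unfolding P_def using that by (intro weighted_deriv_sup_least weighted_deriv_scale_le hd bdd)
    show nonneg: "0 \<le> P f" if "f \<in> X" for f
      using up[OF that, of 0] w0[of 0] by (simp add: w_def order_trans[OF norm_ge_zero])
    show "P f \<le> (\<Sum>n. P (h n))"
      if f: "f \<in> X" and h: "\<And>n. h n \<in> X" and sm: "summable (\<lambda>n. P (h n))"
        and lim: "(\<lambda>n. N (\<lambda>z. f z - (\<Sum>i<n. h i z))) \<longlonglongrightarrow> 0" for f h
    proof (rule least)
      fix z :: complex assume z: "z \<in> unit_disk"
      obtain K where K: "0 \<le> K" "\<And>f. f \<in> X \<Longrightarrow> cmod (deriv f z) \<le> K * N f"
        using deriv_eval_bounded[OF z] by blast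
      have "(\<lambda>n. (\<Sum>i<n. deriv (h i) z)) \<longlonglongrightarrow> deriv f z"
      proof (rule LIM_zero_cancel, rule Lim_null_comparison)
        show "(\<lambda>n. K * N (\<lambda>z. f z - (\<Sum>i<n. h i z))) \<longlonglongrightarrow> 0"
          using tendsto_mult_left[OF lim, of K] by simp
        have "cmod ((\<Sum>i<n. deriv (h i) z) - deriv f z) \<le> K * N (\<lambda>z. f z - (\<Sum>i<n. h i z))" for n
        proof -
          have "deriv (\<lambda>z. f z - (\<Sum>i<n. h i z)) z = deriv f z - (\<Sum>i<n. deriv (h i) z)"
            using f h z deriv_sum_hol_disk[of h z n] hd
            by (subst deriv_diff) (auto intro!: hol_disk_field_differentiable hd sum_mem)
          moreover have "(\<lambda>z. f z - (\<Sum>i<n. h i z)) \<in> X" by (rule diff_mem[OF f sum_mem[OF h]])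
          ultimately show ?thesis
            using K(2)[of "\<lambda>z. f z - (\<Sum>i<n. h i z)"] by (simp add: Real_Vector_Spaces.norm_minus_commute)
        qed
        then show "\<forall>\<^sub>F n in sequentially. cmod ((\<Sum>i<n. deriv (h i) z) - deriv f z) \<le> K * N (\<lambda>z. f z - (\<Sum>i<n. h i z))"
          by simp
      qed
      then have "(\<lambda>n. w z * cmod (\<Sum>i<n. deriv (h i) z)) \<longlonglongrightarrow> w z * cmod (deriv f z)"
        by (intro tendsto_intros)
      moreover have "w z * cmod (\<Sum>i<n. deriv (h i) z) \<le> (\<Sum>n. P (h n))" for n
      proof -
        have "w z * cmod (\<Sum>i<n. deriv (h i) z) \<le> w z * (\<Sum>i<n. cmod (deriv (h i) z))"
          using w0[OF z] by (intro mult_left_mono norm_sum) auto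
        also have "\<dots> \<le> (\<Sum>i<n. P (h i))"
          unfolding sum_distrib_left using up[OF h z] by (intro sum_mono)
        also have "\<dots> \<le> (\<Sum>n. P (h n))" using nonneg[OF h] by (intro sum_le_suminf sm) auto
        finally show ?thesis .
      qed
      ultimately show "w z * cmod (deriv f z) \<le> (\<Sum>n. P (h n))" by (intro LIMSEQ_le_const2) auto
    qed
  qed (rule that)
  show ?thesis by (rule that[OF C(1)]) (use up C(2) in \<open>force simp: w_def intro: order_trans\<close>)
qed

text \<open>
  Here the seminorm is the norm of \<open>X\<close> on the slit space. A series that converges in the slit
  space and absolutely in \<open>X\<close> has the same sum in both, since both norms control the values at points.
\<close>

proposition slit_space_embedding_bounded:
  assumes \<delta>: "0 \<le> \<delta>" "\<delta> \<le> 1" and sub: "slit_space \<delta> \<subseteq> X"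
  obtains C where "0 \<le> C" "\<And>f. f \<in> slit_space \<delta> \<Longrightarrow> N f \<le> C * slit_norm \<delta> f"
proof -
  interpret E: normed_function_space "slit_space \<delta>" "slit_norm \<delta>" by (rule normed_slit_space[OF \<delta>])
  show ?thesis
  proof (rule E.bounded_if_countably_subadditive[OF slit_space_complete[OF \<delta>], of N])
    show "N (\<lambda>z. f z + g z) \<le> N f + N g" if "f \<in> slit_space \<delta>" "g \<in> slit_space \<delta>" for f g
      using that sub by (intro norm_triangle) auto
    show "N (\<lambda>z. c * f z) \<le> cmod c * N f" if "f \<in> slit_space \<delta>" for c f
      using that sub norm_scale[of f c] by auto
    show "0 \<le> N f" if "f \<in> slit_space \<delta>" for f using that sub by (intro norm_nonneg) auto
    show "N f \<le> (\<Sum>n. N (h n))"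
      if f: "f \<in> slit_space \<delta>" and h: "\<And>n. h n \<in> slit_space \<delta>" and sm: "summable (\<lambda>n. N (h n))"
        and lim: "(\<lambda>n. slit_norm \<delta> (\<lambda>z. f z - (\<Sum>i<n. h i z))) \<longlonglongrightarrow> 0" for f h
    proof -
      have hX: "h n \<in> X" for n using h sub by auto
      obtain g where g: "g \<in> X" "(\<lambda>n. N (\<lambda>z. g z - (\<Sum>i<n. h i z))) \<longlonglongrightarrow> 0" "N g \<le> (\<Sum>n. N (h n))"
        using abs_summable_series_converges[OF complete hX sm] by blast
      have "f z = g z" if z: "z \<in> unit_disk" for z
      proof (rule LIMSEQ_unique)
        show "(\<lambda>n. \<Sum>i<n. h i z) \<longlonglongrightarrow> g z" by (rule eval_tendsto[OF g(1) sum_mem[OF hX] g(2) z])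
        show "(\<lambda>n. \<Sum>i<n. h i z) \<longlonglongrightarrow> f z"
        proof (rule LIM_zero_cancel, rule Lim_null_comparison)
          show "(\<lambda>n. (1 + 1 / (1 - cmod z)) * slit_norm \<delta> (\<lambda>z. f z - (\<Sum>i<n. h i z))) \<longlonglongrightarrow> 0"
            using tendsto_mult_left[OF lim, of "1 + 1 / (1 - cmod z)"] by simp
          have "(\<lambda>z. f z - (\<Sum>i<n. h i z)) \<in> slit_space \<delta>" for n
            by (rule E.diff_mem[OF f E.sum_mem[OF h]])
          from slit_space_eval_bound[OF this \<delta> z]
          show "\<forall>\<^sub>F n in sequentially. cmod ((\<Sum>i<n. h i z) - f z) \<le>
              (1 + 1 / (1 - cmod z)) * slit_norm \<delta> (\<lambda>z. f z - (\<Sum>i<n. h i z))"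
            by (simp add: Real_Vector_Spaces.norm_minus_commute)
        qed
      qed
      moreover have "f \<in> hol_disk" "g \<in> hol_disk" using f sub g(1) subset_hol_disk by auto
      ultimately have "f = g" by (auto simp: hol_disk_def fun_eq_iff) (metis mem_ball_0)
      then show ?thesis using g(3) by simp
    qed
  qed (rule that)
qed

end

section \<open>Logarithmic test functions in the Besov space\<close>

text \<open>
  With the summand 1 the value at a real \<open>x\<close> is exactly \<open>ln (e / (1 - a x))\<close>, the logarithm of the
  Carleson condition.
\<close>

definition log_test :: "real \<Rightarrow> complex \<Rightarrow> complex" where
  "log_test a z = (if z \<in> unit_disk then 1 - Ln (1 - of_real a * z) else 0)"

lemma one_minus_mult_halfplane:
  assumes "0 \<le> a" "a < 1" "z \<in> unit_disk"
  shows "0 < Re (1 - of_real a * z)"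
proof -
  have "Re (of_real a * z) \<le> cmod (of_real a * z)" by (rule complex_Re_le_cmod)
  also have "\<dots> < 1" using assms mult_left_le_one_le[of "cmod z" a] by (simp add: norm_mult)
  finally show ?thesis by simp
qed

lemma log_test_has_derivative:
  assumes a: "0 \<le> a" "a < 1" and z: "z \<in> unit_disk"
  shows "(log_test a has_field_derivative of_real a / (1 - of_real a * z)) (at z)"
proof (rule has_field_derivative_transform_within_open[of _ _ _ unit_disk])
  have "1 - of_real a * z \<notin> \<real>\<^sub>\<le>\<^sub>0"
    using one_minus_mult_halfplane[OF assms] by (auto simp: complex_nonpos_Reals_iff)
  then show "((\<lambda>z. 1 - Ln (1 - of_real a * z)) has_field_derivative of_real a / (1 - of_real a * z)) (at z)"
    by (auto intro!: derivative_eq_intros simp: divide_inverse)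
qed (use z in \<open>simp_all add: log_test_def\<close>)

lemma deriv_log_test:
  "0 \<le> a \<Longrightarrow> a < 1 \<Longrightarrow> z \<in> unit_disk \<Longrightarrow> deriv (log_test a) z = of_real a / (1 - of_real a * z)"
  by (rule DERIV_imp_deriv[OF log_test_has_derivative])

lemma log_test_in_hol_disk:
  assumes "0 \<le> a" "a < 1"
  shows "log_test a \<in> hol_disk"
proof -
  have "log_test a holomorphic_on unit_disk"
    unfolding holomorphic_on_open[OF open_ball] using log_test_has_derivative[OF assms] by blast
  then show ?thesis by (simp add: hol_disk_def log_test_def)
qed

lemma log_test_of_real:
  assumes "0 \<le> a" "a < 1" "0 \<le> x" "x < 1"
  shows "log_test a (of_real x) = of_real (ln (exp 1 / (1 - a * x)))"
proof -
  have ax: "a * x < 1" using assms mult_left_le_one_le[of x a] by simp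
  have "Ln (1 - of_real a * of_real x) = of_real (ln (1 - a * x))"
    using Ln_of_real[of "1 - a * x"] ax by simp
  then show ?thesis using assms ax by (simp add: log_test_def ln_div)
qed

lemma cmod_log_test_le:
  assumes a: "0 \<le> a" "a < 1" and z: "z \<in> unit_disk"
  shows "cmod (log_test a z) \<le> 1 + 1 / (1 - cmod z)"
proof -
  have z1: "0 < 1 - cmod z" using z by simp
  have "cmod (log_test a z - log_test a 0) \<le> 1 / (1 - cmod z) * cmod (z - 0)"
  proof (rule field_differentiable_bound[of "cball 0 (cmod z)" "log_test a" "\<lambda>u. of_real a / (1 - of_real a * u)"])
    fix u :: complex assume "u \<in> cball 0 (cmod z)"
    then have u: "u \<in> unit_disk" "cmod u \<le> cmod z" using z by auto
    show "(log_test a has_field_derivative of_real a / (1 - of_real a * u)) (at u within cball 0 (cmod z))"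
      by (rule has_field_derivative_at_within[OF log_test_has_derivative[OF a u(1)]])
    have "a * cmod u \<le> 1 * cmod u" using a by (intro mult_right_mono) auto
    then have "1 - cmod z \<le> cmod (1 - of_real a * u)"
      using norm_triangle_ineq2[of 1 "of_real a * u"] u a by (simp add: norm_mult)
    then show "cmod (of_real a / (1 - of_real a * u)) \<le> 1 / (1 - cmod z)"
      using a z1 by (auto simp: norm_divide intro!: frac_le)
  qed auto
  also have "\<dots> \<le> 1 / (1 - cmod z) * 1" using z1 by (intro mult_left_mono) auto
  finally have "cmod (log_test a z - 1) \<le> 1 / (1 - cmod z)" by (simp add: log_test_def)
  then show ?thesis using norm_triangle_ineq[of "log_test a z - 1" 1] by simp
qed

text \<open>
  In polar coordinates the integral over the angle is at most of order \<open>(1 - a r) powr (1 - p)\<close>, which leaves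
  \<open>(1 - r) powr (p - 2) * (1 - a r) powr (1 - p)\<close>. For \<open>r \<le> a\<close> this is at most \<open>1 / (1 - r)\<close>, with
  integral \<open>ln (1 / (1 - a))\<close>; for \<open>r \<ge> a\<close> the second factor is at most \<open>(1 - a) powr (1 - p)\<close>, and the integral
  is at most \<open>1 / (p - 1)\<close>.
\<close>

lemma besov_density_log_test_integral:
  fixes p :: real
  assumes p: "1 < p"
  obtains K where "0 \<le> K"
    "\<And>a. 0 \<le> a \<Longrightarrow> a < 1 \<Longrightarrow>
      besov_energy p (log_test a) \<le> ennreal (K * ln (exp 1 / (1 - a)))"
proof -
  define Kp where "Kp = 2 * 8 powr p / (p - 1)"
  have Kp: "0 \<le> Kp" using p by (simp add: Kp_def)
  define D where "D = 2 powr \<bar>p - 2\<bar> * Kp"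
  have D: "0 \<le> D" using Kp by (simp add: D_def)
  have bound: "besov_energy p (log_test a) \<le> ennreal (D * (1 + 1 / (p - 1)) * ln (exp 1 / (1 - a)))"
    if a: "0 \<le> a" "a < 1" for a
  proof -
    have hd: "log_test a \<in> hol_disk" by (rule log_test_in_hol_disk[OF a])
    have m: "besov_density p (log_test a) \<in> borel_measurable borel"
      using besov_density_measurable[OF hd] p by simp
    define g where "g r = (1 - r) powr (p - 2) * (1 - a * r) powr (1 - p)" for r
    have inner: "(\<integral>\<^sup>+\<theta>. polar_density r \<theta> * ennreal (besov_density p (log_test a) (rcis r \<theta>)) \<partial>lborel)
        \<le> ennreal (D * (indicator {0..1} r * g r))" for r
    proof (cases "0 < r \<and> r < 1")
      case False
      then have zero: "polar_density r \<theta> * ennreal (besov_density p (log_test a) (rcis r \<theta>)) = 0" for \<theta>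
        by (auto simp: besov_density_def indicator_def)
      show ?thesis unfolding zero by simp
    next
      case True
      have ar: "0 \<le> a * r" "a * r < 1" using a True mult_left_le[of r a] by auto
      define c where "c = 2 powr \<bar>p - 2\<bar> * (1 - r) powr (p - 2)"
      have c0: "0 \<le> c" by (simp add: c_def)
      have nz: "0 < cmod (1 - rcis (a * r) \<theta>)" for \<theta>
      proof -
        have "1 - a * r \<le> cmod (1 - rcis (a * r) \<theta>)"
          using norm_triangle_ineq2[of 1 "rcis (a * r) \<theta>"] ar by simp
        then show ?thesis using ar by linarith
      qed
      have dens: "r * besov_density p (log_test a) (rcis r \<theta>) \<le> c * cmod (1 - rcis (a * r) \<theta>) powr - p" for \<theta>
      proof -
        have rd: "rcis r \<theta> \<in> unit_disk" using True by simp
        have eq: "of_real a * rcis r \<theta> = rcis (a * r) \<theta>" by (simp add: rcis_def)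
        have A: "cmod (deriv (log_test a) (rcis r \<theta>)) powr p \<le> cmod (1 - rcis (a * r) \<theta>) powr - p"
        proof -
          have "cmod (deriv (log_test a) (rcis r \<theta>)) \<le> 1 / cmod (1 - rcis (a * r) \<theta>)"
            using a nz[of \<theta>] by (simp add: deriv_log_test[OF a rd] eq norm_divide divide_right_mono)
          then have "cmod (deriv (log_test a) (rcis r \<theta>)) powr p \<le> (1 / cmod (1 - rcis (a * r) \<theta>)) powr p"
            using p by (intro powr_mono2) auto
          also have "\<dots> = cmod (1 - rcis (a * r) \<theta>) powr - p" by (simp add: powr_divide powr_minus_divide)
          finally show ?thesis .
        qed
        have B: "(1 - r\<^sup>2) powr (p - 2) \<le> c"
        proof -
          have "(1 - r\<^sup>2) powr (p - 2) = (1 - r) powr (p - 2) * (1 + r) powr (p - 2)"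
            unfolding powr_mult[symmetric] by (rule arg_cong[of _ _ "\<lambda>x. x powr (p - 2)"]) (simp add: power2_eq_square algebra_simps)
          moreover have "(1 + r) powr (p - 2) \<le> 2 powr \<bar>p - 2\<bar>"
          proof -
            have "(1 + r) powr (p - 2) \<le> (1 + r) powr \<bar>p - 2\<bar>" using True by (intro powr_mono) auto
            also have "\<dots> \<le> 2 powr \<bar>p - 2\<bar>" using True by (intro powr_mono2) auto
            finally show ?thesis .
          qed
          ultimately show ?thesis
            using mult_left_mono[of "(1 + r) powr (p - 2)" "2 powr \<bar>p - 2\<bar>" "(1 - r) powr (p - 2)"]
            by (simp add: c_def mult.commute)
        qed
        have "r * besov_density p (log_test a) (rcis r \<theta>) \<le> 1 * besov_density p (log_test a) (rcis r \<theta>)"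
          using True besov_density_nonneg by (intro mult_right_mono) auto
        also have "\<dots> = (1 - r\<^sup>2) powr (p - 2) * cmod (deriv (log_test a) (rcis r \<theta>)) powr p"
          using True by (simp add: besov_density_def)
        also have "\<dots> \<le> c * cmod (1 - rcis (a * r) \<theta>) powr - p"
          using A B c0 by (intro mult_mono) auto
        finally show ?thesis .
      qed
      have cK: "continuous_on S (\<lambda>\<theta>. cmod (1 - rcis (a * r) \<theta>) powr - p)" for S
        using nz by (intro continuous_on_powr continuous_intros) (auto simp: rcis_def cis.ctr Complex_eq dest: less_imp_neq intro!: continuous_intros)
      let ?J = "integral {0..2*pi} (\<lambda>\<theta>. cmod (1 - rcis (a * r) \<theta>) powr - p)"
      have hi: "((\<lambda>\<theta>. c * cmod (1 - rcis (a * r) \<theta>) powr - p) has_integral c * ?J) {0..2*pi}"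
        by (intro has_integral_mult_right integrable_integral integrable_continuous_real cK)
      have "(\<integral>\<^sup>+\<theta>. polar_density r \<theta> * ennreal (besov_density p (log_test a) (rcis r \<theta>)) \<partial>lborel)
        \<le> (\<integral>\<^sup>+\<theta>. ennreal (indicator {0..2*pi} \<theta> * (c * cmod (1 - rcis (a * r) \<theta>) powr - p)) \<partial>lborel)"
        using True dens besov_density_nonneg c0
        by (intro nn_integral_mono) (auto simp: indicator_def ennreal_mult[symmetric] intro!: ennreal_leI)
      also have "\<dots> = ennreal (c * ?J)"
        using c0 by (intro nn_integral_indicator_has_integral[OF hi] borel_measurable_continuous_onI continuous_on_mult continuous_on_const cK) auto
      also have "\<dots> \<le> ennreal (c * (Kp * (1 - a * r) powr (1 - p)))"
        using integral_kernel_bound[OF p ar] c0 by (intro ennreal_leI mult_left_mono) (auto simp: Kp_def)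
      also have "c * (Kp * (1 - a * r) powr (1 - p)) = D * (indicator {0..1} r * g r)"
        using True by (simp add: c_def D_def g_def)
      finally show ?thesis .
    qed
    define g1 where "g1 r = 1 / (1 - r)" for r :: real
    define g2 where "g2 r = (1 - a) powr (1 - p) * (1 - r) powr (p - 2)" for r
    have le: "indicator {0..1} r * g r \<le> indicator {0..a} r * g1 r + indicator {a..1} r * g2 r" for r
    proof -
      consider "r < 0 \<or> 1 < r" | "0 \<le> r" "r \<le> a" | "a < r" "r \<le> 1" by linarith
      then show ?thesis
      proof cases
        case 2
        have "a * r \<le> 1 * r" using a 2 by (intro mult_right_mono) auto
        then have "(1 - a * r) powr (1 - p) \<le> (1 - r) powr (1 - p)" using p 2 a by (intro powr_mono2') auto
        then have "g r \<le> (1 - r) powr (p - 2) * (1 - r) powr (1 - p)" unfolding g_def by (intro mult_left_mono) auto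
        also have "\<dots> = g1 r" using 2 a by (simp add: powr_add[symmetric] g1_def powr_minus_divide)
        finally have "g r \<le> g1 r" .
        moreover have "0 \<le> indicator {a..1} r * g2 r" by (simp add: g2_def)
        ultimately show ?thesis using 2 a by (simp add: add_increasing2)
      next
        case 3
        have "a * r \<le> a * 1" using a 3 by (intro mult_left_mono) auto
        then have "(1 - a * r) powr (1 - p) \<le> (1 - a) powr (1 - p)" using p 3 a by (intro powr_mono2') auto
        then have "g r \<le> (1 - r) powr (p - 2) * (1 - a) powr (1 - p)" unfolding g_def by (intro mult_left_mono) auto
        then have "g r \<le> g2 r" by (simp add: g2_def mult.commute)
        then show ?thesis using 3 a by simp
      qed (use a in auto)
    qed
    have i1: "(g1 has_integral ln (1 / (1 - a))) {0..a}"
    proof -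
      have "(g1 has_integral (- ln (1 - a)) - (- ln (1 - 0))) {0..a}"
        unfolding g1_def using a by (intro fundamental_theorem_of_calculus)
          (auto intro!: derivative_eq_intros simp: has_real_derivative_iff_has_vector_derivative[symmetric])
      then show ?thesis using a by (simp add: ln_div)
    qed
    have i2: "(g2 has_integral 1 / (p - 1)) {a..1}"
    proof -
      define G where "G r = (1 - a) powr (1 - p) * (- ((1 - r) powr (p - 1) / (p - 1)))" for r
      have "(g2 has_integral G 1 - G a) {a..1}"
      proof (rule fundamental_theorem_of_calculus_interior)
        show "continuous_on {a..1} G"
          unfolding G_def using p by (intro continuous_intros continuous_on_powr') auto
        fix x assume x: "x \<in> {a<..<1}"
        have "((\<lambda>r. (1 - r) powr (p - 1)) has_real_derivative (p - 1) * (1 - x) powr (p - 1 - 1) * - 1) (at x)"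
          using x by (auto intro!: derivative_eq_intros)
        then have "(G has_real_derivative (1 - a) powr (1 - p) * (- (((p - 1) * (1 - x) powr (p - 1 - 1) * - 1) / (p - 1)))) (at x)"
          unfolding G_def by (intro DERIV_cmult DERIV_minus DERIV_cdivide)
        then show "(G has_vector_derivative g2 x) (at x)"
          using p by (simp add: g2_def has_real_derivative_iff_has_vector_derivative[symmetric])
      qed (use a in simp)
      moreover have "(1 - a) powr (1 - p) * (1 - a) powr (p - 1) = 1" using a by (simp add: powr_add[symmetric])
      then have "G 1 - G a = 1 / (p - 1)" using p by (simp add: G_def)
      ultimately show ?thesis by simp
    qed
    have "besov_energy p (log_test a)
        = (\<integral>\<^sup>+r. \<integral>\<^sup>+\<theta>. polar_density r \<theta> * ennreal (besov_density p (log_test a) (rcis r \<theta>)) \<partial>lborel \<partial>lborel)"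
      using m by (intro nn_integral_polar) simp
    also have "\<dots> \<le> (\<integral>\<^sup>+r. ennreal D * (ennreal (indicator {0..a} r * g1 r) + ennreal (indicator {a..1} r * g2 r)) \<partial>lborel)"
    proof (rule nn_integral_mono, rule order_trans[OF inner])
      fix r
      have 0: "0 \<le> indicator {0..a} r * g1 r" "0 \<le> indicator {a..1} r * g2 r"
        using a by (auto simp: g1_def g2_def indicator_def)
      have "D * (indicator {0..1} r * g r) \<le> D * (indicator {0..a} r * g1 r + indicator {a..1} r * g2 r)"
        using D le[of r] by (rule mult_left_mono[rotated])
      then show "ennreal (D * (indicator {0..1} r * g r)) \<le> ennreal D * (ennreal (indicator {0..a} r * g1 r) + ennreal (indicator {a..1} r * g2 r))"
        using 0 D by (simp add: ennreal_plus[symmetric] ennreal_mult[symmetric] ennreal_leI del: ennreal_plus)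
    qed
    also have "\<dots> = ennreal D * ((\<integral>\<^sup>+r. ennreal (indicator {0..a} r * g1 r) \<partial>lborel) + (\<integral>\<^sup>+r. ennreal (indicator {a..1} r * g2 r) \<partial>lborel))"
      unfolding g1_def g2_def by (subst nn_integral_cmult, measurable, subst nn_integral_add, measurable)
    also have "(\<integral>\<^sup>+r. ennreal (indicator {0..a} r * g1 r) \<partial>lborel) = ennreal (ln (1 / (1 - a)))"
      by (rule nn_integral_indicator_has_integral[OF i1]) (use a in \<open>auto simp: g1_def [abs_def]\<close>)
    also have "(\<integral>\<^sup>+r. ennreal (indicator {a..1} r * g2 r) \<partial>lborel) = ennreal (1 / (p - 1))"
      by (rule nn_integral_indicator_has_integral[OF i2]) (use a in \<open>auto simp: g2_def [abs_def]\<close>)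
    also have "ennreal D * (ennreal (ln (1 / (1 - a))) + ennreal (1 / (p - 1))) = ennreal (D * (ln (1 / (1 - a)) + 1 / (p - 1)))"
    proof -
      have "0 \<le> ln (1 / (1 - a))" using a by (auto simp: field_simps)
      then show ?thesis using D p by (simp add: ennreal_plus[symmetric] ennreal_mult[symmetric] del: ennreal_plus)
    qed
    also have "\<dots> \<le> ennreal (D * ((1 + 1 / (p - 1)) * ln (exp 1 / (1 - a))))"
    proof (intro ennreal_leI mult_left_mono D)
      have l0: "0 \<le> ln (1 / (1 - a))" using a by (auto simp: field_simps)
      have "1 / (p - 1) * 1 \<le> 1 / (p - 1) * ln (exp 1 / (1 - a))"
        using p l0 a by (intro mult_left_mono) (auto simp: ln_e_div)
      moreover have "ln (1 / (1 - a)) \<le> ln (exp 1 / (1 - a))" using a by (simp add: ln_e_div)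
      ultimately show "ln (1 / (1 - a)) + 1 / (p - 1) \<le> (1 + 1 / (p - 1)) * ln (exp 1 / (1 - a))"
        by (simp add: distrib_right)
    qed
    finally show ?thesis by (simp add: mult.assoc)
  qed
  show ?thesis by (rule that[OF _ bound]) (use D p in auto)
qed

text \<open>
  The factor compensates the growth of the norm of \<open>log_test a\<close>, and leaves the power \<open>1 - 1/p\<close> of the
  logarithm near the point \<open>a\<close>.
\<close>

definition besov_test :: "real \<Rightarrow> real \<Rightarrow> complex \<Rightarrow> complex" where
  "besov_test p a z = of_real (ln (exp 1 / (1 - a)) powr (- 1 / p)) * log_test a z"

lemma besov_test_bounded:
  assumes p: "1 < p"
  obtains M where "\<And>a. 0 \<le> a \<Longrightarrow> a < 1 \<Longrightarrow> besov_test p a \<in> besov_space p \<and> besov_norm p (besov_test p a) \<le> M"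
proof -
  obtain K where K: "0 \<le> K" and KI: "\<And>a. 0 \<le> a \<Longrightarrow> a < 1 \<Longrightarrow>
      besov_energy p (log_test a) \<le> ennreal (K * ln (exp 1 / (1 - a)))"
    using besov_density_log_test_integral[OF p] by blast
  show ?thesis
  proof (rule that[of "1 + (K / pi) powr (1 / p)"])
    fix a :: real assume a: "0 \<le> a" "a < 1"
    define L where "L = ln (exp 1 / (1 - a))"
    define c where "c = L powr (- 1 / p)"
    have "0 \<le> ln (1 / (1 - a))" using a by (auto simp: field_simps)
    then have l1: "1 \<le> L" using a by (simp add: L_def ln_e_div)
    have c: "0 < c" "c \<le> 1"
      using l1 p powr_mono[of "- 1 / p" 0 L] by (auto simp: c_def)
    have cp: "c powr p * L = 1" 
    proof -
      have "c powr p = L powr - 1" unfolding c_def powr_powr using p by simp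
      then show ?thesis using l1 by (simp add: powr_minus_divide)
    qed
    have bt: "besov_test p a = (\<lambda>z. of_real c * log_test a z)" by (simp add: besov_test_def [abs_def] c_def L_def)
    have hd: "besov_test p a \<in> hol_disk" unfolding bt by (rule hol_disk_scale[OF log_test_in_hol_disk[OF a]])
    have dens: "besov_density p (besov_test p a) w = c powr p * besov_density p (log_test a) w" for w
    proof (cases "w \<in> unit_disk")
      case True
      have "deriv (besov_test p a) w = of_real c * deriv (log_test a) w"
        unfolding bt by (rule deriv_cmult) (rule hol_disk_field_differentiable[OF log_test_in_hol_disk[OF a] True])
      then show ?thesis using c by (simp add: besov_density_def norm_mult powr_mult)
    qed (simp add: besov_density_def)
    have m: "besov_density p (log_test a) \<in> borel_measurable borel"
      using besov_density_measurable[OF log_test_in_hol_disk[OF a]] p by simp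
    have "besov_energy p (besov_test p a)
        = ennreal (c powr p) * besov_energy p (log_test a)"
      unfolding dens using m by (subst nn_integral_cmult[symmetric]) (auto simp: ennreal_mult besov_density_nonneg)
    also have "\<dots> \<le> ennreal (c powr p) * ennreal (K * L)"
      unfolding L_def by (intro mult_left_mono KI a) simp
    also have "\<dots> = ennreal K"
    proof -
      have "c powr p * (K * L) = K * (c powr p * L)" by (simp only: mult_ac)
      then show ?thesis using K l1 by (simp add: ennreal_mult[symmetric] cp)
    qed
    finally have I: "besov_energy p (besov_test p a) \<le> ennreal K" .
    have "besov_energy p (besov_test p a) < \<infinity>"
      using I by (rule le_less_trans) simp
    then have 1: "besov_test p a \<in> besov_space p" using hd p by (simp add: besov_space_iff)
    have "enn2real (besov_energy p (besov_test p a)) \<le> K"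
      by (rule enn2real_leI[OF K I])
    then have "(enn2real (besov_energy p (besov_test p a)) / pi) powr (1 / p) \<le> (K / pi) powr (1 / p)"
      using p by (intro powr_mono2 divide_right_mono) auto
    moreover have "cmod (besov_test p a 0) \<le> 1" using c by (simp add: bt log_test_def)
    ultimately have "besov_norm p (besov_test p a) \<le> 1 + (K / pi) powr (1 / p)"
      using besov_norm_eq[OF hd, of p] p by simp
    then show "besov_test p a \<in> besov_space p \<and> besov_norm p (besov_test p a) \<le> 1 + (K / pi) powr (1 / p)"
      using 1 by blast
  qed
qed

section \<open>Sufficiency of the Carleson condition\<close>

lemma cesaro_op_add:
  assumes \<mu>: "finite_borel_measure_01 \<mu>" and f: "f \<in> hol_disk" and g: "g \<in> hol_disk"
  shows "cesaro_op \<mu> (\<lambda>z. f z + g z) = (\<lambda>z. cesaro_op \<mu> f z + cesaro_op \<mu> g z)"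
proof
  fix z
  have h: "f holomorphic_on unit_disk" "g holomorphic_on unit_disk" using f g by (auto simp: hol_disk_def)
  have t: "taylor_coeff (\<lambda>z. f z + g z) n = taylor_coeff f n + taylor_coeff g n" for n
    unfolding taylor_coeff_def using higher_deriv_add[OF h open_ball, of 0 n] by (simp add: add_divide_distrib)
  show "cesaro_op \<mu> (\<lambda>z. f z + g z) z = cesaro_op \<mu> f z + cesaro_op \<mu> g z"
  proof (cases "z \<in> unit_disk")
    case True
    have "(\<lambda>n. (of_real (moment \<mu> n) * (\<Sum>k\<le>n. taylor_coeff f k)) * z ^ n +
        (of_real (moment \<mu> n) * (\<Sum>k\<le>n. taylor_coeff g k)) * z ^ n) sums (cesaro_op \<mu> f z + cesaro_op \<mu> g z)"
      unfolding cesaro_op_eq_integral[OF \<mu> h(1) True] cesaro_op_eq_integral[OF \<mu> h(2) True]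
      by (intro sums_add cesaro_op_sums[OF \<mu>] h True)
    then have "(\<lambda>n. (of_real (moment \<mu> n) * (\<Sum>k\<le>n. taylor_coeff (\<lambda>z. f z + g z) k)) * z ^ n)
        sums (cesaro_op \<mu> f z + cesaro_op \<mu> g z)"
      by (simp add: t sum.distrib algebra_simps)
    then show ?thesis using True by (simp add: cesaro_op_def[of \<mu> "\<lambda>z. f z + g z"] sums_iff)
  qed (simp add: cesaro_op_def)
qed

lemma cesaro_op_scale:
  assumes \<mu>: "finite_borel_measure_01 \<mu>" and f: "f \<in> hol_disk"
  shows "cesaro_op \<mu> (\<lambda>z. c * f z) = (\<lambda>z. c * cesaro_op \<mu> f z)"
proof
  fix z
  have h: "f holomorphic_on unit_disk" using f by (auto simp: hol_disk_def)
  have t: "taylor_coeff (\<lambda>z. c * f z) n = c * taylor_coeff f n" for n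
    unfolding taylor_coeff_def using higher_deriv_cmult[OF h, of 0 n c] by simp
  show "cesaro_op \<mu> (\<lambda>z. c * f z) z = c * cesaro_op \<mu> f z"
  proof (cases "z \<in> unit_disk")
    case True
    have "(\<lambda>n. c * ((of_real (moment \<mu> n) * (\<Sum>k\<le>n. taylor_coeff f k)) * z ^ n)) sums (c * cesaro_op \<mu> f z)"
      unfolding cesaro_op_eq_integral[OF \<mu> h True]
      by (intro sums_mult cesaro_op_sums[OF \<mu>] h True)
    then have "(\<lambda>n. (of_real (moment \<mu> n) * (\<Sum>k\<le>n. taylor_coeff (\<lambda>z. c * f z) k)) * z ^ n)
        sums (c * cesaro_op \<mu> f z)"
      by (simp add: t sum_distrib_left[symmetric] mult_ac)
    then show ?thesis using True by (simp add: cesaro_op_def[of \<mu> "\<lambda>z. c * f z"] sums_iff)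
  qed (simp add: cesaro_op_def)
qed

lemma cesaro_op_diff:
  assumes \<mu>: "finite_borel_measure_01 \<mu>" and f: "f \<in> hol_disk" and g: "g \<in> hol_disk"
  shows "cesaro_op \<mu> (\<lambda>z. f z - g z) = (\<lambda>z. cesaro_op \<mu> f z - cesaro_op \<mu> g z)"
  using cesaro_op_add[OF \<mu> f hol_disk_scale[OF g, of "-1"]] cesaro_op_scale[OF \<mu> g, of "-1"] by simp

lemma vanishing_log_carleson_tail:
  assumes v: "vanishing_log_carleson \<alpha> 1 \<mu>" and e: "0 < \<epsilon>"
  obtains \<rho> where "0 \<le> \<rho>" "\<rho> < 1"
    "\<And>t. \<rho> \<le> t \<Longrightarrow> t < 1 \<Longrightarrow> measure \<mu> {t..<1} * log_weight \<alpha> t \<le> \<epsilon> * (1 - t)"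
proof -
  have "\<forall>\<^sub>F t in at_left 1. dist (measure \<mu> {t..<1} * ln (exp 1 / (1 - t)) powr \<alpha> / (1 - t) powr 1) 0 < \<epsilon>"
    using v e unfolding vanishing_log_carleson_def by (rule tendstoD)
  then obtain b where b: "b < 1" "\<And>t. b < t \<Longrightarrow> t < 1 \<Longrightarrow>
      dist (measure \<mu> {t..<1} * ln (exp 1 / (1 - t)) powr \<alpha> / (1 - t) powr 1) 0 < \<epsilon>"
    unfolding eventually_at_left_field by blast
  define \<rho> where "\<rho> = max 0 ((b + 1) / 2)"
  show ?thesis
  proof (rule that[of \<rho>])
    show "0 \<le> \<rho>" "\<rho> < 1" using b(1) by (auto simp: \<rho>_def)
    fix t assume t: "\<rho> \<le> t" "t < 1"
    have "b < \<rho>" using b(1) unfolding \<rho>_def by (intro less_max_iff_disj[THEN iffD2]) simp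
    then have "dist (measure \<mu> {t..<1} * ln (exp 1 / (1 - t)) powr \<alpha> / (1 - t) powr 1) 0 < \<epsilon>"
      using b(2)[of t] t by simp
    then have "measure \<mu> {t..<1} * log_weight \<alpha> t / (1 - t) < \<epsilon>"
      using t by (simp add: log_weight_def)
    then show "measure \<mu> {t..<1} * log_weight \<alpha> t \<le> \<epsilon> * (1 - t)"
      using t by (simp add: pos_divide_less_eq)
  qed
qed

text \<open>
  Cauchy's inequality on the disk of radius \<open>(1 - \<rho>) / 2\<close> about \<open>w\<close>.
\<close>

lemma deriv_div_one_minus_le:
  assumes f: "f holomorphic_on unit_disk" and \<rho>: "0 \<le> \<rho>" "\<rho> < 1"
    and le: "\<And>z. cmod z \<le> (1 + \<rho>) / 2 \<Longrightarrow> cmod (f z) \<le> B" and w: "cmod w \<le> \<rho>"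
  shows "cmod (deriv (\<lambda>w. f w / (1 - w)) w) \<le> 3 * B / (1 - \<rho>)\<^sup>2"
proof -
  define d where "d = (1 - \<rho>) / 2"
  have d: "0 < d" using \<rho> by (simp add: d_def)
  have wd: "w \<in> unit_disk" using w \<rho> by simp
  have B: "0 \<le> B" by (rule order_trans[OF norm_ge_zero le[of 0]]) (use \<rho> in simp)
  have near: "cmod u \<le> (1 + \<rho>) / 2" if "cmod (w - u) \<le> d" for u
    using that w norm_triangle_ineq2[of u w] norm_minus_commute[of w u] by (auto simp: d_def)
  have sub: "cball w d \<subseteq> unit_disk" using near \<rho> by (fastforce simp: dist_norm)
  have hol: "f holomorphic_on cball w d" using f sub by (rule holomorphic_on_subset)
  have "cmod ((deriv ^^ 1) f w) \<le> fact 1 * B / d ^ 1"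
  proof (rule Cauchy_inequality[OF _ _ d])
    show "f holomorphic_on ball w d" by (rule holomorphic_on_subset[OF hol]) auto
    show "continuous_on (cball w d) f" by (rule holomorphic_on_imp_continuous_on[OF hol])
    show "cmod (f x) \<le> B" if "cmod (w - x) = d" for x using that by (intro le near) simp
  qed
  then have df: "cmod (deriv f w) \<le> 2 * B / (1 - \<rho>)" using d by (simp add: d_def field_simps)
  have fw: "cmod (f w) \<le> B" using w \<rho> by (intro le) simp
  have one: "1 - \<rho> \<le> cmod (1 - w)" using norm_triangle_ineq2[of 1 w] w by simp
  have "cmod (deriv (\<lambda>w. f w / (1 - w)) w) \<le> cmod (deriv f w) / cmod (1 - w) + cmod (f w) / (cmod (1 - w))\<^sup>2"
    unfolding deriv_div_one_minus[OF f wd]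
    by (rule order_trans[OF norm_triangle_ineq]) (simp add: norm_divide norm_power)
  also have "\<dots> \<le> 2 * B / (1 - \<rho>) / (1 - \<rho>) + B / (1 - \<rho>)\<^sup>2"
    using df fw one \<rho> B by (intro add_mono frac_le power_mono) auto
  also have "\<dots> = 3 * B / (1 - \<rho>)\<^sup>2" using \<rho> by (simp add: power2_eq_square add_divide_distrib[symmetric])
  finally show ?thesis .
qed

lemma cesaro_op_slit_norm_le:
  assumes \<mu>: "finite_borel_measure_01 \<mu>" and f: "f \<in> hol_disk"
    and \<delta>: "0 < \<delta>" "\<delta> < 1" and \<alpha>: "0 \<le> \<alpha>" "\<alpha> \<le> 1"
    and \<rho>: "0 \<le> \<rho>" "\<rho> < 1" and A: "0 \<le> A"
    and growth: "\<And>w. w \<in> unit_disk \<Longrightarrow> cmod (f w) \<le> A * log_weight \<alpha> (cmod w)"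
      "\<And>w. w \<in> unit_disk \<Longrightarrow> cmod (deriv f w) * (1 - cmod w) \<le> A"
    and tail: "\<And>t. \<rho> \<le> t \<Longrightarrow> t < 1 \<Longrightarrow> measure \<mu> {t..<1} * log_weight \<alpha> t \<le> \<epsilon> * (1 - t)"
    and le: "\<And>z. cmod z \<le> (1 + \<rho>) / 2 \<Longrightarrow> cmod (f z) \<le> B"
  shows "cesaro_op \<mu> f \<in> slit_space \<delta>"
    and "slit_norm \<delta> (cesaro_op \<mu> f) \<le> 7 * B / (1 - \<rho>)\<^sup>2 * measure \<mu> (space \<mu>) + carleson_const \<delta> * A * \<epsilon>"
proof -
  interpret finite_measure \<mu> using \<mu> by (simp add: finite_borel_measure_01_def)
  let ?m = "measure \<mu> (space \<mu>)"
  have h: "f holomorphic_on unit_disk" using f by (simp add: hol_disk_def)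
  have B: "0 \<le> B" by (rule order_trans[OF norm_ge_zero le[of 0]]) (use \<rho> in simp)
  have b: "slit_weight \<delta> z * cmod (deriv (cesaro_op \<mu> f) z)
      \<le> 2 * (3 * B / (1 - \<rho>)\<^sup>2) * ?m + carleson_const \<delta> * A * \<epsilon>" if "z \<in> unit_disk" for z
    using B by (intro deriv_cesaro_op_bound[OF \<mu> h \<delta> \<alpha> \<rho> A _ growth _ tail that]
        deriv_div_one_minus_le[OF h \<rho> le]) auto
  show "cesaro_op \<mu> f \<in> slit_space \<delta>"
    by (rule slit_space_intro(1)[OF cesaro_op_in_hol_disk[OF \<mu> h] b])
  have "cesaro_op \<mu> f 0 = of_real ?m * f 0"
    using cesaro_op_eq_integral[OF \<mu> h, of 0] by (simp add: scaleR_conv_of_real)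
  then have "cmod (cesaro_op \<mu> f 0) = cmod (f 0) * ?m" by (simp add: norm_mult)
  also have "\<dots> \<le> B / (1 - \<rho>)\<^sup>2 * ?m"
  proof (rule mult_right_mono)
    have "(1 - \<rho>)\<^sup>2 \<le> 1" using \<rho> by (simp add: abs_square_le_1)
    then have "B / 1 \<le> B / (1 - \<rho>)\<^sup>2" using B \<rho> by (intro divide_left_mono) auto
    then show "cmod (f 0) \<le> B / (1 - \<rho>)\<^sup>2" using le[of 0] \<rho> by simp
  qed simp
  finally have z: "cmod (cesaro_op \<mu> f 0) \<le> B / (1 - \<rho>)\<^sup>2 * ?m" .
  have "slit_norm \<delta> (cesaro_op \<mu> f) \<le> cmod (cesaro_op \<mu> f 0) +
      (2 * (3 * B / (1 - \<rho>)\<^sup>2) * ?m + carleson_const \<delta> * A * \<epsilon>)"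
    by (rule slit_space_intro(2)[OF cesaro_op_in_hol_disk[OF \<mu> h] b])
  also have "\<dots> \<le> 7 * B / (1 - \<rho>)\<^sup>2 * ?m + carleson_const \<delta> * A * \<epsilon>"
  proof -
    have "7 * B / (1 - \<rho>)\<^sup>2 * ?m = 7 * (B / (1 - \<rho>)\<^sup>2 * ?m)"
      "2 * (3 * B / (1 - \<rho>)\<^sup>2) * ?m = 6 * (B / (1 - \<rho>)\<^sup>2 * ?m)" by simp_all
    then show ?thesis using z by linarith
  qed
  finally show "slit_norm \<delta> (cesaro_op \<mu> f) \<le> 7 * B / (1 - \<rho>)\<^sup>2 * ?m + carleson_const \<delta> * A * \<epsilon>" .
qed

lemma carleson_const_pos: "0 < \<delta> \<Longrightarrow> 0 < carleson_const \<delta>"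
  using powr_less_mono[of "- \<delta>" 0 2] by (simp add: carleson_const_def)

text \<open>
  Relative compactness is total boundedness, so it suffices to find, for a bounded sequence \<open>F\<close> in the Besov
  space, a subsequence with Cauchy images. Montel's theorem provides one that converges locally
  uniformly. In the bound of \<open>cesaro_op_slit_norm_le\<close> for a difference of its terms, the tail of \<open>\<mu>\<close> is made
  small first, which fixes the radius \<open>\<rho>\<close>, and then the difference on the disk of radius \<open>(1 + \<rho>) / 2\<close>.
\<close>

proposition compact_cesaro_op_if_vanishing:
  assumes p: "1 < p" and s: "1 < s"
    and X: "banach_space_of_analytic_functions X N"
    and sub: "mean_lipschitz_space s \<subseteq> X" and \<mu>: "finite_borel_measure_01 \<mu>"
    and v: "vanishing_log_carleson (1 - 1 / p) 1 \<mu>"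
  shows "compact_operator (besov_space p) (besov_norm p) X N (cesaro_op \<mu>)"
proof -
  interpret X: banach_space_of_analytic_functions X N by (rule X)
  interpret M: Metric_space X "norm_dist X N" by (rule X.Metric_space_norm_dist)
  interpret finite_measure \<mu> using \<mu> by (simp add: finite_borel_measure_01_def)
  let ?\<alpha> = "1 - 1 / p" and ?T = "cesaro_op \<mu>" and ?m = "measure \<mu> (space \<mu>)"
  have \<alpha>: "0 \<le> ?\<alpha>" "?\<alpha> \<le> 1" using p by auto
  \<comment> \<open>any \<open>\<delta>\<close> with \<open>0 < \<delta> < 1 - 1/s\<close> serves\<close>
  define \<delta> where "\<delta> = (1 - 1 / s) / 2"
  have \<delta>: "0 < \<delta>" "\<delta> < 1" using s by (auto simp: \<delta>_def field_simps)
  have "(1 - \<delta>) * s = (s + 1) / 2" using s by (simp add: \<delta>_def field_simps)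
  then have "1 < (1 - \<delta>) * s" using s by simp
  then have sE: "slit_space \<delta> \<subseteq> X"
    using slit_space_subset_mean_lipschitz[OF \<delta> s] sub by blast
  obtain CE where CE: "0 \<le> CE" "\<And>f. f \<in> slit_space \<delta> \<Longrightarrow> N f \<le> CE * slit_norm \<delta> f"
    using X.slit_space_embedding_bounded[of \<delta>] \<delta> sE by auto
  obtain CB where CB: "0 < CB"
    "\<And>f z. f \<in> besov_space p \<Longrightarrow> z \<in> unit_disk \<Longrightarrow> cmod (f z) \<le> CB * besov_norm p f * log_weight ?\<alpha> (cmod z)"
    "\<And>f z. f \<in> besov_space p \<Longrightarrow> z \<in> unit_disk \<Longrightarrow> cmod (deriv f z) * (1 - cmod z) \<le> CB * besov_norm p f"
    using besov_growth[OF p] by metis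
  have hd: "f \<in> hol_disk" if "f \<in> besov_space p" for f using that by (simp add: besov_space_def)
  have n0: "0 \<le> besov_norm p f" for f by (simp add: besov_norm_def)
  have TE: "?T f \<in> slit_space \<delta>" if f: "f \<in> besov_space p" for f
  proof -
    obtain \<rho> where \<rho>: "0 \<le> \<rho>" "\<rho> < 1"
      and tail: "\<And>t. \<rho> \<le> t \<Longrightarrow> t < 1 \<Longrightarrow> measure \<mu> {t..<1} * log_weight ?\<alpha> t \<le> 1 * (1 - t)"
      using vanishing_log_carleson_tail[OF v, of 1] by auto
    have A: "0 \<le> CB * besov_norm p f" using CB(1) n0 by simp
    have le: "cmod (f z) \<le> CB * besov_norm p f * log_weight ?\<alpha> ((1 + \<rho>) / 2)" if "cmod z \<le> (1 + \<rho>) / 2" for z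
    proof -
      have "cmod (f z) \<le> CB * besov_norm p f * log_weight ?\<alpha> (cmod z)" using that \<rho> by (intro CB(2) f) auto
      also have "\<dots> \<le> CB * besov_norm p f * log_weight ?\<alpha> ((1 + \<rho>) / 2)"
        using that \<rho> \<alpha> A by (intro mult_left_mono log_weight_mono) auto
      finally show ?thesis .
    qed
    show ?thesis
      by (rule cesaro_op_slit_norm_le(1)[OF \<mu> hd[OF f] \<delta> \<alpha> \<rho> A CB(2)[OF f] CB(3)[OF f] tail le])
  qed
  have lin: "linear_map (besov_space p) X ?T"
    unfolding linear_map_def using TE sE cesaro_op_add[OF \<mu> hd hd] cesaro_op_scale[OF \<mu> hd] by blast
  have "compactin M.mtopology (M.mtopology closure_of (?T ` S))"
    if S: "S \<subseteq> besov_space p" and bdd: "bdd_above (besov_norm p ` S)" for S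
  proof -
    obtain B0 where B0: "\<And>f. f \<in> S \<Longrightarrow> besov_norm p f \<le> B0" using bdd by (auto simp: bdd_above_def)
    define A where "A = CB * max 0 B0"
    have A: "0 \<le> A" using CB(1) by (simp add: A_def)
    have leA: "CB * besov_norm p f \<le> A" if "f \<in> S" for f
      unfolding A_def using CB(1) B0[OF that] by (intro mult_left_mono) auto
    have g1: "cmod (f z) \<le> A * log_weight ?\<alpha> (cmod z)" if "f \<in> S" "z \<in> unit_disk" for f z
    proof -
      have "cmod (f z) \<le> CB * besov_norm p f * log_weight ?\<alpha> (cmod z)" using that S by (intro CB(2)) auto
      also have "\<dots> \<le> A * log_weight ?\<alpha> (cmod z)" using leA[OF that(1)] by (intro mult_right_mono) (auto simp: log_weight_def)
      finally show ?thesis .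
    qed
    have g2: "cmod (deriv f z) * (1 - cmod z) \<le> A" if "f \<in> S" "z \<in> unit_disk" for f z
      using CB(3)[of f z] leA[OF that(1)] that S by fastforce
    have "M.mtotally_bounded (?T ` S)"
      unfolding M.mtotally_bounded_sequentially
    proof (intro conjI allI impI)
      show "?T ` S \<subseteq> X" using TE sE S by blast
      fix \<sigma> :: "nat \<Rightarrow> complex \<Rightarrow> complex" assume "range \<sigma> \<subseteq> ?T ` S"
      then have "\<forall>n. \<exists>f. f \<in> S \<and> \<sigma> n = ?T f" by blast
      then obtain F where F: "\<And>n. F n \<in> S" "\<And>n. \<sigma> n = ?T (F n)" by metis
      have FB: "F n \<in> besov_space p" for n using F(1) S by blast
      have Fh: "F n \<in> hol_disk" for n by (rule hd[OF FB])
      have Fhol: "F n holomorphic_on unit_disk" for n using Fh by (simp add: hol_disk_def)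
      obtain g r where r: "strict_mono (r :: nat \<Rightarrow> nat)"
        and ul: "\<And>K. compact K \<Longrightarrow> K \<subseteq> unit_disk \<Longrightarrow> uniform_limit K (F \<circ> r) g sequentially"
      proof (rule Montel[of unit_disk "range F" F])
        show "h holomorphic_on unit_disk" if "h \<in> range F" for h using that Fhol by auto
        show "\<exists>B. \<forall>h\<in>range F. \<forall>z\<in>K. cmod (h z) \<le> B" if K: "compact K" "K \<subseteq> unit_disk" for K
        proof (cases "K = {}")
          case False
          obtain x where x: "x \<in> K" "\<And>y. y \<in> K \<Longrightarrow> cmod y \<le> cmod x"
            using continuous_attains_sup[OF K(1) False, of cmod] by (auto intro: continuous_intros)
          have "cmod (F n z) \<le> A * log_weight ?\<alpha> (cmod x)" if "z \<in> K" for n z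
          proof -
            have "cmod (F n z) \<le> A * log_weight ?\<alpha> (cmod z)" using that K by (intro g1 F) auto
            also have "\<dots> \<le> A * log_weight ?\<alpha> (cmod x)"
              using x that K \<alpha> A by (intro mult_left_mono log_weight_mono) auto
            finally show ?thesis .
          qed
          then show ?thesis by blast
        qed auto
      qed auto
      have "M.MCauchy (\<sigma> \<circ> r)"
        unfolding M.MCauchy_def
      proof (intro conjI allI impI)
        show "range (\<sigma> \<circ> r) \<subseteq> X" using F TE FB sE by auto
        fix e :: real assume e: "0 < e"
        \<comment> \<open>\<open>\<epsilon>\<close> and \<open>B\<close> make each of the two terms of the norm bound at most \<open>e / (4 (CE + 1))\<close>\<close>
        define \<epsilon> where "\<epsilon> = e / (4 * (CE + 1) * carleson_const \<delta> * (2 * A + 1))"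
        have cc: "0 < carleson_const \<delta>" by (rule carleson_const_pos[OF \<delta>(1)])
        have \<epsilon>: "0 < \<epsilon>" using e CE(1) A cc by (simp add: \<epsilon>_def)
        obtain \<rho> where \<rho>: "0 \<le> \<rho>" "\<rho> < 1"
          and tail: "\<And>t. \<rho> \<le> t \<Longrightarrow> t < 1 \<Longrightarrow> measure \<mu> {t..<1} * log_weight ?\<alpha> t \<le> \<epsilon> * (1 - t)"
          using vanishing_log_carleson_tail[OF v \<epsilon>] by blast
        define B where "B = e * (1 - \<rho>)\<^sup>2 / (28 * (CE + 1) * (?m + 1))"
        have m1: "0 < ?m + 1" using measure_nonneg[of \<mu> "space \<mu>"] by linarith
        have B: "0 < B" using e CE(1) \<rho> m1 unfolding B_def by (intro divide_pos_pos mult_pos_pos) auto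
        have ulr: "uniform_limit (cball 0 ((1 + \<rho>) / 2)) (F \<circ> r) g sequentially" using \<rho> by (intro ul) auto
        have "\<forall>\<^sub>F n in sequentially. \<forall>z\<in>cball 0 ((1 + \<rho>) / 2). dist ((F \<circ> r) n z) (g z) < B / 2"
          by (rule uniform_limitD[OF ulr]) (use B in simp)
        then obtain n0 where n0': "\<forall>n\<ge>n0. \<forall>z\<in>cball 0 ((1 + \<rho>) / 2). dist ((F \<circ> r) n z) (g z) < B / 2"
          unfolding eventually_sequentially by blast
        have n0: "dist (F (r n) z) (g z) < B / 2" if "n0 \<le> n" "cmod z \<le> (1 + \<rho>) / 2" for n z
          using n0'[rule_format, of n z] that by simp
        have "norm_dist X N ((\<sigma> \<circ> r) m) ((\<sigma> \<circ> r) n) < e" if mn: "n0 \<le> m" "n0 \<le> n" for m n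
        proof -
          define f where "f z = F (r m) z - F (r n) z" for z
          have fh: "f \<in> hol_disk"
            using hol_disk_add[OF Fh hol_disk_scale[OF Fh, of "-1"], of "r m" "r n"] by (simp add: f_def [abs_def])
          have fle: "cmod (f z) \<le> B" if "cmod z \<le> (1 + \<rho>) / 2" for z
            using n0[OF mn(1) that] n0[OF mn(2) that] dist_triangle2[of "F (r m) z" "F (r n) z" "g z"]
            by (simp add: f_def dist_norm)
          have fg1: "cmod (f z) \<le> (2 * A) * log_weight ?\<alpha> (cmod z)" if z: "z \<in> unit_disk" for z
            using g1[OF F(1) z, of "r m"] g1[OF F(1) z, of "r n"] norm_triangle_ineq4[of "F (r m) z" "F (r n) z"]
            by (simp add: f_def)
          have fg2: "cmod (deriv f z) * (1 - cmod z) \<le> 2 * A" if z: "z \<in> unit_disk" for z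
          proof -
            have "deriv f z = deriv (F (r m)) z - deriv (F (r n)) z"
              unfolding f_def [abs_def] by (intro deriv_diff hol_disk_field_differentiable[OF Fh z])
            then have "cmod (deriv f z) * (1 - cmod z) \<le> (cmod (deriv (F (r m)) z) + cmod (deriv (F (r n)) z)) * (1 - cmod z)"
              using z norm_triangle_ineq4[of "deriv (F (r m)) z" "deriv (F (r n)) z"] by (intro mult_right_mono) auto
            also have "\<dots> \<le> 2 * A" using g2[OF F(1) z, of "r m"] g2[OF F(1) z, of "r n"] by (simp add: distrib_right)
            finally show ?thesis .
          qed
          have A2: "0 \<le> 2 * A" using A by simp
          have TFX: "?T (F n) \<in> X" for n using TE[OF FB] sE by blast
          note est = cesaro_op_slit_norm_le[OF \<mu> fh \<delta> \<alpha> \<rho> A2 fg1 fg2 tail fle]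
          have Tf: "?T f = (\<lambda>z. ?T (F (r m)) z - ?T (F (r n)) z)"
            unfolding f_def [abs_def] by (rule cesaro_op_diff[OF \<mu> Fh Fh])
          have t1: "7 * B / (1 - \<rho>)\<^sup>2 * ?m \<le> e / (4 * (CE + 1))"
          proof -
            have "7 * B / (1 - \<rho>)\<^sup>2 * ?m = e / (4 * (CE + 1)) * (?m / (?m + 1))"
              using \<rho> CE(1) m1 by (simp add: B_def divide_simps)
            also have "\<dots> \<le> e / (4 * (CE + 1)) * 1"
              using e CE(1) m1 by (intro mult_left_mono) (auto simp: divide_simps)
            finally show ?thesis by simp
          qed
          have t2: "carleson_const \<delta> * (2 * A) * \<epsilon> \<le> e / (4 * (CE + 1))"
          proof -
            have "carleson_const \<delta> * (2 * A) * \<epsilon> = e / (4 * (CE + 1)) * (2 * A / (2 * A + 1))"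
              using cc CE(1) A by (simp add: \<epsilon>_def divide_simps)
            also have "\<dots> \<le> e / (4 * (CE + 1)) * 1"
              using e CE(1) A by (intro mult_left_mono) (auto simp: divide_simps)
            finally show ?thesis by simp
          qed
          have "norm_dist X N ((\<sigma> \<circ> r) m) ((\<sigma> \<circ> r) n) = N (?T f)"
            using TFX F(2) by (simp add: norm_dist_def Tf)
          also have "\<dots> \<le> CE * slit_norm \<delta> (?T f)" by (rule CE(2)[OF est(1)])
          also have "\<dots> \<le> CE * (e / (4 * (CE + 1)) + e / (4 * (CE + 1)))"
            using est(2) t1 t2 CE(1) by (intro mult_left_mono) auto
          also have "\<dots> = e / 2 * (CE / (CE + 1))"
          proof -
            have eq: "CE * (e / (4 * d) + e / (4 * d)) = e / 2 * (CE / d)" if "d \<noteq> 0" for d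
              using that by (simp add: field_simps)
            show ?thesis by (rule eq) (use CE(1) in linarith)
          qed
          also have "\<dots> \<le> e / 2 * 1" using e CE(1) by (intro mult_left_mono) auto
          also have "\<dots> < e" using e by simp
          finally show ?thesis .
        qed
        then show "\<exists>n0. \<forall>n n'. n0 \<le> n \<longrightarrow> n0 \<le> n' \<longrightarrow> norm_dist X N ((\<sigma> \<circ> r) n) ((\<sigma> \<circ> r) n') < e" by blast
      qed
      then show "\<exists>r. strict_mono r \<and> M.MCauchy (\<sigma> \<circ> r)" using r by blast
    qed
    then show ?thesis using M.mtotally_bounded_eq_compact_closure_of[OF X.complete] by blast
  qed
  then show ?thesis unfolding compact_operator_def using lin by blast
qed

section \<open>Necessity of the Carleson condition\<close>

text \<open>
  At real points the integrand \<open>t * \<phi> t\<close> is real and nonnegative, so the integral is at least its part over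
  \<open>[a, 1)\<close>. There \<open>t a \<ge> a\<^sup>2\<close>, and only the second summand of \<open>\<phi>\<close> is kept.
\<close>

lemma deriv_cesaro_op_log_test_ge:
  assumes \<mu>: "finite_borel_measure_01 \<mu>" and a: "0 \<le> a" "a < 1"
  shows "a * ln (exp 1 / (1 - a ^ 3)) / (1 - a\<^sup>2)\<^sup>2 * measure \<mu> {a..<1}
      \<le> cmod (deriv (cesaro_op \<mu> (log_test a)) (of_real a))"
proof -
  interpret finite_measure \<mu> using \<mu> by (simp add: finite_borel_measure_01_def)
  have h: "log_test a holomorphic_on unit_disk" using log_test_in_hol_disk[OF a] by (simp add: hol_disk_def)
  define \<phi> where "\<phi> t = a / ((1 - a * (t * a)) * (1 - t * a)) + ln (exp 1 / (1 - a * (t * a))) / (1 - t * a)\<^sup>2" for t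
  have sp: "0 \<le> t \<and> t < 1" if "t \<in> space \<mu>" for t using that space_01[OF \<mu>] by auto
  have ta: "0 \<le> t * a" "t * a \<le> a" "0 \<le> a * (t * a)" "a * (t * a) \<le> a" if "0 \<le> t" "t < 1" for t
  proof -
    show 1: "0 \<le> t * a" "t * a \<le> a" using that a by (auto simp: mult_left_le_one_le)
    show "0 \<le> a * (t * a)" using 1 a by simp
    show "a * (t * a) \<le> a" using 1 a mult_left_le[of "t * a" a] by linarith
  qed
  have F: "of_real t * deriv (\<lambda>w. log_test a w / (1 - w)) (of_real t * of_real a) = of_real (t * \<phi> t)"
    if t: "t \<in> space \<mu>" for t
  proof -
    have x: "0 \<le> t * a" "t * a < 1" using ta[of t] sp[OF t] a by auto
    have xd: "complex_of_real (t * a) \<in> unit_disk"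
      by (simp only: mem_ball_0 norm_of_real) (use x in simp)
    show ?thesis
      using deriv_div_one_minus[OF h xd] deriv_log_test[OF a xd] log_test_of_real[OF a x]
      by (simp add: \<phi>_def)
  qed
  have l0: "0 \<le> ln (exp 1 / (1 - x))" "ln (exp 1 / (1 - x)) \<le> ln (exp 1 / (1 - a))" if "0 \<le> x" "x \<le> a" for x
    using that a by (auto simp: ln_e_div add_nonneg_nonneg field_simps)
  have \<phi>0: "0 \<le> \<phi> t" if "t \<in> space \<mu>" for t
    unfolding \<phi>_def using ta[of t] sp[OF that] a l0[of "a * (t * a)"]
    by (intro add_nonneg_nonneg divide_nonneg_nonneg mult_nonneg_nonneg) auto
  define c where "c = a * ln (exp 1 / (1 - a ^ 3)) / (1 - a\<^sup>2)\<^sup>2"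
  have low: "c \<le> t * \<phi> t" if t: "t \<in> space \<mu>" "a \<le> t" for t
  proof -
    have t1: "0 \<le> t" "t < 1" using sp[OF t(1)] by auto
    have sq: "a * a \<le> t * a" using t(2) a by (intro mult_right_mono) auto
    have cu: "a ^ 3 \<le> a * (t * a)" using mult_left_mono[OF sq a(1)] by (simp add: power3_eq_cube)
    have c3: "0 \<le> a ^ 3" "a ^ 3 \<le> a" using a cu ta[OF t1] by auto
    have "ln (exp 1 / (1 - a ^ 3)) \<le> ln (exp 1 / (1 - a * (t * a)))"
      using cu c3 ta[OF t1] a by (subst ln_le_cancel_iff) (auto intro!: divide_left_mono mult_pos_pos)
    moreover have "(1 - t * a)\<^sup>2 \<le> (1 - a\<^sup>2)\<^sup>2"
      using sq ta[OF t1] a by (intro power_mono) (auto simp: power2_eq_square)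
    moreover have "0 < 1 - t * a" using ta[OF t1] a by simp
    ultimately have "ln (exp 1 / (1 - a ^ 3)) / (1 - a\<^sup>2)\<^sup>2 \<le> ln (exp 1 / (1 - a * (t * a))) / (1 - t * a)\<^sup>2"
      using l0(1)[OF c3] by (intro frac_le) auto
    also have "\<dots> \<le> \<phi> t"
      unfolding \<phi>_def using ta[OF t1] a by (simp add: divide_nonneg_nonneg)
    finally have "ln (exp 1 / (1 - a ^ 3)) / (1 - a\<^sup>2)\<^sup>2 \<le> \<phi> t" .
    then have "a * (ln (exp 1 / (1 - a ^ 3)) / (1 - a\<^sup>2)\<^sup>2) \<le> t * \<phi> t"
      using t(2) a l0(1)[OF c3] \<phi>0[OF t(1)] by (intro mult_mono) auto
    then show ?thesis by (simp add: c_def)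
  qed
  have int: "integrable \<mu> (\<lambda>t. t * \<phi> t)"
  proof (rule integrable_const_bound[of _ "1 / ((1 - a) * (1 - a)) + ln (exp 1 / (1 - a)) / (1 - a)\<^sup>2"])
    show "(\<lambda>t. t * \<phi> t) \<in> borel_measurable \<mu>"
      by (rule borel_measurable_01[OF \<mu>]) (simp add: \<phi>_def)
    show "AE t in \<mu>. norm (t * \<phi> t) \<le> 1 / ((1 - a) * (1 - a)) + ln (exp 1 / (1 - a)) / (1 - a)\<^sup>2"
    proof (rule AE_I2)
      fix t assume t: "t \<in> space \<mu>"
      have t1: "0 \<le> t" "t < 1" using sp[OF t] by auto
      have "\<phi> t \<le> 1 / ((1 - a) * (1 - a)) + ln (exp 1 / (1 - a)) / (1 - a)\<^sup>2"
        unfolding \<phi>_def using ta[OF t1] a l0[of "a * (t * a)"]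
        by (intro add_mono frac_le mult_mono power_mono) auto
      moreover have "t * \<phi> t \<le> 1 * \<phi> t" using t1 \<phi>0[OF t] by (intro mult_right_mono) auto
      moreover have "0 \<le> t * \<phi> t" using t1 \<phi>0[OF t] by simp
      ultimately show "norm (t * \<phi> t) \<le> 1 / ((1 - a) * (1 - a)) + ln (exp 1 / (1 - a)) / (1 - a)\<^sup>2" by simp
    qed
  qed
  have sets: "{a..<1} \<in> sets \<mu>" by (rule tail_in_sets[OF \<mu> a(1)])
  have ad: "complex_of_real a \<in> unit_disk" using a by simp
  have "c * measure \<mu> {a..<1} = (LINT t|\<mu>. c * indicator {a..<1} t)"
    using sets by (simp add: sets.Int_space_eq2)
  also have "\<dots> \<le> (LINT t|\<mu>. t * \<phi> t)"
    using int low \<phi>0 sp sets by (intro integral_mono_AE AE_I2 integrable_mult_right integrable_real_indicator)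
      (auto simp: indicator_def less_top[symmetric])
  also have "\<dots> \<le> cmod (of_real (LINT t|\<mu>. t * \<phi> t))" by simp
  also have "of_real (LINT t|\<mu>. t * \<phi> t) = deriv (cesaro_op \<mu> (log_test a)) (of_real a)"
    unfolding deriv_cesaro_op_eq_integral[OF \<mu> h ad] integral_complex_of_real[symmetric]
    by (rule Bochner_Integration.integral_cong) (simp_all add: F)
  finally show ?thesis by (simp add: c_def)
qed

lemma cmod_cesaro_op_log_test_le:
  assumes \<mu>: "finite_borel_measure_01 \<mu>" and a: "0 \<le> a" "a < 1" and z: "z \<in> unit_disk"
  shows "cmod (cesaro_op \<mu> (log_test a) z) \<le> (1 + 1 / (1 - cmod z)) / (1 - cmod z) * measure \<mu> (space \<mu>)"
proof -
  interpret finite_measure \<mu> using \<mu> by (simp add: finite_borel_measure_01_def)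
  have h: "log_test a holomorphic_on unit_disk" using log_test_in_hol_disk[OF a] by (simp add: hol_disk_def)
  have "cmod (cesaro_op \<mu> (log_test a) z) \<le> (LINT t|\<mu>. cmod (log_test a (of_real t * z) / (1 - of_real t * z)))"
    unfolding cesaro_op_eq_integral[OF \<mu> h z] by (rule integral_norm_bound)
  also have "\<dots> \<le> (LINT t|\<mu>. (1 + 1 / (1 - cmod z)) / (1 - cmod z))"
  proof (rule integral_mono')
    fix t assume "t \<in> space \<mu>"
    then have t: "0 \<le> t" "t < 1" using space_01[OF \<mu>] by auto
    have tz: "cmod (of_real t * z) \<le> cmod z" using t by (simp add: norm_mult mult_left_le_one_le)
    have tzd: "of_real t * z \<in> unit_disk" using tz z by simp
    have z1: "0 < 1 - cmod z" using z by simp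
    have "cmod (log_test a (of_real t * z)) \<le> 1 + 1 / (1 - cmod (of_real t * z))" by (rule cmod_log_test_le[OF a tzd])
    also have "\<dots> \<le> 1 + 1 / (1 - cmod z)" using tz z1 by (intro add_left_mono frac_le) auto
    finally have "cmod (log_test a (of_real t * z)) \<le> 1 + 1 / (1 - cmod z)" .
    moreover have "1 - cmod z \<le> cmod (1 - of_real t * z)"
      using norm_triangle_ineq2[of 1 "of_real t * z"] tz by simp
    ultimately show "cmod (log_test a (of_real t * z) / (1 - of_real t * z)) \<le> (1 + 1 / (1 - cmod z)) / (1 - cmod z)"
      unfolding norm_divide using z1 by (intro frac_le) auto
  qed (use z in auto)
  also have "\<dots> = (1 + 1 / (1 - cmod z)) / (1 - cmod z) * measure \<mu> (space \<mu>)" by simp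
  finally show ?thesis .
qed

text \<open>
  Since \<open>1 - a\<^sup>3 \<le> 3 (1 - a)\<close>, the two logarithms differ by at most \<open>ln 3\<close>, which is at most half of
  \<open>ln (e / (1 - a))\<close> as soon as \<open>9 (1 - a) \<le> e\<close>.
\<close>

lemma log_factor_ge:
  assumes "7/8 < a" "a < (1::real)"
  shows "ln (exp 1 / (1 - a)) / (8 * (1 - a)) \<le> (1 - a\<^sup>2) * (a * ln (exp 1 / (1 - a ^ 3)) / (1 - a\<^sup>2)\<^sup>2)"
proof -
  define x where "x = 1 - a"
  have x: "0 < x" "x < 1/8" using assms by (auto simp: x_def)
  have s: "1 - a\<^sup>2 = x * (1 + a)" by (simp add: x_def power2_eq_square algebra_simps)
  have s0: "0 < 1 - a\<^sup>2" "1 - a\<^sup>2 \<le> 2 * x" unfolding s using x assms by auto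
  have c: "1 - a ^ 3 = x * (1 + a + a\<^sup>2)" by (simp add: x_def power2_eq_square power3_eq_cube algebra_simps)
  have a2: "0 \<le> a\<^sup>2" "a\<^sup>2 \<le> 1" using assms by (auto simp: abs_square_le_1)
  have "0 < 1 + a + a\<^sup>2" using a2(1) assms by linarith
  then have c0: "0 < 1 - a ^ 3" unfolding c using x by (intro mult_pos_pos)
  have c3: "1 - a ^ 3 \<le> x * 3" unfolding c using x assms a2 by (intro mult_left_mono) auto
  have e: "2 \<le> exp (1::real)" using exp_ge_add_one_self[of 1] by simp
  have "9 * x \<le> exp 1" using e x by linarith
  then have "9 * x * exp 1 \<le> exp 1 * exp 1" by (intro mult_right_mono) auto
  then have "exp 1 / x \<le> (exp 1 / (x * 3))\<^sup>2"
    using x by (simp add: power2_eq_square field_simps)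
  then have "ln (exp 1 / x) \<le> ln ((exp 1 / (x * 3))\<^sup>2)" using x by (subst ln_le_cancel_iff) auto
  also have "\<dots> = 2 * ln (exp 1 / (x * 3))" using x by (simp add: ln_realpow)
  also have "\<dots> \<le> 2 * ln (exp 1 / (1 - a ^ 3))"
    using c0 c3 x by (intro mult_left_mono, subst ln_le_cancel_iff) (auto intro!: divide_left_mono mult_pos_pos)
  finally have L: "ln (exp 1 / x) \<le> 2 * ln (exp 1 / (1 - a ^ 3))" .
  have L0: "0 \<le> ln (exp 1 / x)" using x e by (intro ln_ge_zero) (auto simp: field_simps)
  have L1: "0 \<le> ln (exp 1 / (1 - a ^ 3))" using L L0 by linarith
  have "ln (exp 1 / x) / (8 * x) = (1/2) * (ln (exp 1 / x) / 2) / (2 * x)" by simp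
  also have "\<dots> \<le> a * ln (exp 1 / (1 - a ^ 3)) / (1 - a\<^sup>2)"
    using L L0 L1 s0 assms by (intro frac_le mult_mono mult_nonneg_nonneg) auto
  also have "\<dots> = (1 - a\<^sup>2) * (a * ln (exp 1 / (1 - a ^ 3)) / (1 - a\<^sup>2)\<^sup>2)"
    using s0 by (simp add: power2_eq_square)
  finally show ?thesis by (simp add: x_def)
qed

text \<open>
  Along a sequence tending to 1 from the left, the images \<open>y n\<close> of the test functions tend to 0 at every point. A
  cluster point of the \<open>y n\<close> in \<open>X\<close> can only be 0, so compactness forces \<open>N (y n)\<close> to tend to 0; the Bloch
  seminorm at the point \<open>S n\<close> then bounds the Carleson quotient.
\<close>

proposition vanishing_if_compact_cesaro_op:
  assumes p: "1 < p" and X: "banach_space_of_analytic_functions X N"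
    and bloch: "X \<subseteq> bloch_space" and \<mu>: "finite_borel_measure_01 \<mu>"
    and comp: "compact_operator (besov_space p) (besov_norm p) X N (cesaro_op \<mu>)"
  shows "vanishing_log_carleson (1 - 1 / p) 1 \<mu>"
proof -
  interpret X: banach_space_of_analytic_functions X N by (rule X)
  interpret M: Metric_space X "norm_dist X N" by (rule X.Metric_space_norm_dist)
  let ?T = "cesaro_op \<mu>" and ?\<alpha> = "1 - 1 / p"
  obtain C where C: "0 \<le> C" "\<And>f z. f \<in> X \<Longrightarrow> z \<in> unit_disk \<Longrightarrow> (1 - (cmod z)\<^sup>2) * cmod (deriv f z) \<le> C * N f"
    using X.bloch_seminorm_bounded[OF bloch] by metis
  obtain K where K: "\<And>a. 0 \<le> a \<Longrightarrow> a < 1 \<Longrightarrow> besov_test p a \<in> besov_space p \<and> besov_norm p (besov_test p a) \<le> K"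
    using besov_test_bounded[OF p] by metis
  have TX: "?T f \<in> X" if "f \<in> besov_space p" for f
    using comp that by (auto simp: compact_operator_def linear_map_def)
  define c where "c a = ln (exp 1 / (1 - a)) powr (- 1 / p)" for a
  have c0: "0 \<le> c a" for a by (simp add: c_def)
  have T: "?T (besov_test p a) = (\<lambda>z. of_real (c a) * ?T (log_test a) z)" if "0 \<le> a" "a < 1" for a
    unfolding besov_test_def [abs_def] c_def by (rule cesaro_op_scale[OF \<mu> log_test_in_hol_disk[OF that]])
  have "(\<lambda>n. measure \<mu> {S n..<1} * ln (exp 1 / (1 - S n)) powr ?\<alpha> / (1 - S n) powr 1) \<longlonglongrightarrow> 0"
    if S: "\<And>n. S n < 1" "\<And>n. 7/8 < S n" "S \<longlonglongrightarrow> 1" for S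
  proof -
    have S0: "0 \<le> S n" for n using S(2)[of n] by simp
    define y where "y n = ?T (besov_test p (S n))" for n
    have fB: "besov_test p (S n) \<in> besov_space p" for n using K S0 S(1) by blast
    have yX: "y n \<in> X" for n unfolding y_def by (rule TX[OF fB])
    have cn: "(\<lambda>n. c (S n)) \<longlonglongrightarrow> 0"
    proof -
      have "filterlim (\<lambda>n. 1 - S n) (at_right 0) sequentially"
        unfolding filterlim_at using S(1) less_imp_neq[OF S(1)]
        by (auto intro!: tendsto_eq_intros S(3))
      then have "filterlim (\<lambda>n. exp 1 * inverse (1 - S n)) at_top sequentially"
        by (intro filterlim_tendsto_pos_mult_at_top[OF tendsto_const] filterlim_compose[OF filterlim_inverse_at_top_right]) auto
      then have "filterlim (\<lambda>n. ln (exp 1 / (1 - S n))) at_top sequentially"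
        unfolding divide_inverse by (rule filterlim_compose[OF ln_at_top])
      then show ?thesis unfolding c_def using p by (intro tendsto_neg_powr) auto
    qed
    have yz: "(\<lambda>n. y n z) \<longlonglongrightarrow> 0" if z: "z \<in> unit_disk" for z
    proof (rule Lim_null_comparison)
      let ?R = "(1 + 1 / (1 - cmod z)) / (1 - cmod z) * measure \<mu> (space \<mu>)"
      show "(\<lambda>n. c (S n) * ?R) \<longlonglongrightarrow> 0" using tendsto_mult_right[OF cn, of ?R] by simp
      have "cmod (y n z) = c (S n) * cmod (?T (log_test (S n)) z)" for n
        unfolding y_def T[OF S0 S(1)] norm_mult using c0[of "S n"] by simp
      then have "cmod (y n z) \<le> c (S n) * ?R" for n
        using mult_left_mono[OF cmod_cesaro_op_log_test_le[OF \<mu> S0[of n] S(1)[of n] z] c0[of "S n"]] by (simp only:)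
      then show "\<forall>\<^sub>F n in sequentially. cmod (y n z) \<le> c (S n) * ?R" by simp
    qed
    have cl: "compactin M.mtopology (M.mtopology closure_of (?T ` range (\<lambda>n. besov_test p (S n))))"
    proof -
      have "bdd_above (besov_norm p ` range (\<lambda>n. besov_test p (S n)))"
        using K S0 S(1) by (auto intro!: bdd_aboveI2[of _ _ K])
      then show ?thesis using comp fB unfolding compact_operator_def by (metis image_subsetI)
    qed
    have Ny: "(\<lambda>n. N (y n)) \<longlonglongrightarrow> 0"
    proof (rule ccontr)
      assume "\<not> (\<lambda>n. N (y n)) \<longlonglongrightarrow> 0"
      then obtain e where e: "0 < e" "\<forall>n0. \<exists>n\<ge>n0. e \<le> N (y n)"
        using X.norm_nonneg[OF yX] unfolding LIMSEQ_def by (auto simp: dist_real_def not_less)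
      then have "infinite {n. e \<le> N (y n)}" by (auto simp: infinite_nat_iff_unbounded_le)
      then obtain r :: "nat \<Rightarrow> nat" where r: "strict_mono r" "\<And>n. e \<le> N (y (r n))"
        using infinite_enumerate[of "{n. e \<le> N (y n)}"] by auto
      have mem: "range (y \<circ> r) \<subseteq> M.mtopology closure_of (?T ` range (\<lambda>n. besov_test p (S n)))"
      proof -
        have "?T ` range (\<lambda>n. besov_test p (S n)) \<subseteq> topspace M.mtopology" using TX fB by auto
        from closure_of_subset[OF this] show ?thesis by (auto simp: y_def)
      qed
      obtain l r' where l: "limitin M.mtopology (y \<circ> r \<circ> r') l sequentially" and r': "strict_mono r'"
        using cl mem unfolding M.compactin_sequentially by blast
      have lX: "l \<in> X" using l by (rule M.limitin_mspace)
      have lim: "(\<lambda>n. norm_dist X N (y (r (r' n))) l) \<longlonglongrightarrow> 0"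
        using l unfolding M.limitin_metric_dist_null by (simp add: o_def)
      then have lim': "(\<lambda>n. N (\<lambda>z. l z - y (r (r' n)) z)) \<longlonglongrightarrow> 0"
        using lX yX X.norm_minus_commute[OF lX yX] by (simp add: norm_dist_def)
      have "l z = 0" if z: "z \<in> unit_disk" for z
      proof (rule LIMSEQ_unique)
        show "(\<lambda>n. y (r (r' n)) z) \<longlonglongrightarrow> l z" by (rule X.eval_tendsto[OF lX yX lim' z])
        show "(\<lambda>n. y (r (r' n)) z) \<longlonglongrightarrow> 0"
          using LIMSEQ_subseq_LIMSEQ[OF yz[OF z] strict_mono_o[OF r(1) r']] by (simp add: o_def)
      qed
      moreover have "l \<in> hol_disk" using lX X.subset_hol_disk by blast
      ultimately have "l = (\<lambda>z. 0)" by (auto simp: hol_disk_def fun_eq_iff)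
      then have "(\<lambda>n. N (y (r (r' n)))) \<longlonglongrightarrow> 0"
        using lim yX lX by (simp add: norm_dist_def)
      then have "\<forall>\<^sub>F n in sequentially. N (y (r (r' n))) < e" using e(1) by (rule order_tendstoD)
      then show False using r(2) by (auto simp: eventually_sequentially not_less[symmetric])
    qed
    show ?thesis
    proof (rule Lim_null_comparison)
      show "(\<lambda>n. 8 * C * N (y n)) \<longlonglongrightarrow> 0" using tendsto_mult_left[OF Ny, of "8 * C"] by simp
      have "norm (measure \<mu> {S n..<1} * ln (exp 1 / (1 - S n)) powr ?\<alpha> / (1 - S n) powr 1) \<le> 8 * C * N (y n)" for n
      proof -
        define a where "a = S n"
        have a: "0 \<le> a" "a < 1" "7/8 < a" using S0 S by (auto simp: a_def)
        define m where "m = measure \<mu> {a..<1}"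
        define L where "L = ln (exp 1 / (1 - a))"
        have "0 \<le> ln (1 / (1 - a))" using a by (auto simp: field_simps)
        then have L: "1 \<le> L" using a by (simp add: L_def ln_e_div)
        have ad: "complex_of_real a \<in> unit_disk" using a by simp
        have s0: "0 \<le> 1 - a\<^sup>2" using a by (simp add: abs_square_le_1)
        have Th: "?T (log_test a) \<in> hol_disk"
          using log_test_in_hol_disk[OF a(1,2)] by (intro cesaro_op_in_hol_disk[OF \<mu>]) (simp add: hol_disk_def)
        have "deriv (y n) (of_real a) = of_real (c a) * deriv (?T (log_test a)) (of_real a)"
          unfolding y_def a_def[symmetric] T[OF a(1,2)]
          by (rule deriv_cmult) (rule hol_disk_field_differentiable[OF Th ad])
        then have d: "cmod (deriv (y n) (of_real a)) = c a * cmod (deriv (?T (log_test a)) (of_real a))"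
          using c0 by (simp add: norm_mult)
        have cL: "c a * L = L powr ?\<alpha>"
          using L powr_add[of L "- 1 / p" 1] by (simp add: c_def L_def[symmetric])
        have "m * L powr ?\<alpha> / (8 * (1 - a)) = c a * (m * (L / (8 * (1 - a))))" by (simp add: cL[symmetric])
        also have "\<dots> \<le> c a * (m * ((1 - a\<^sup>2) * (a * ln (exp 1 / (1 - a ^ 3)) / (1 - a\<^sup>2)\<^sup>2)))"
          using log_factor_ge[OF a(3,2)] c0 by (intro mult_left_mono) (auto simp: L_def m_def)
        also have "\<dots> = (1 - a\<^sup>2) * (c a * (a * ln (exp 1 / (1 - a ^ 3)) / (1 - a\<^sup>2)\<^sup>2 * m))" by (simp only: mult_ac)
        also have "\<dots> \<le> (1 - a\<^sup>2) * (c a * cmod (deriv (?T (log_test a)) (of_real a)))"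
          unfolding m_def using s0 c0 by (intro mult_left_mono deriv_cesaro_op_log_test_ge[OF \<mu> a(1,2)])
        also have "\<dots> = (1 - (cmod (of_real a))\<^sup>2) * cmod (deriv (y n) (of_real a))" by (simp add: d)
        also have "\<dots> \<le> C * N (y n)" by (rule C(2)[OF yX ad])
        finally have "m * L powr ?\<alpha> / (1 - a) \<le> 8 * C * N (y n)" using a by (simp add: field_simps)
        moreover have "0 \<le> m * L powr ?\<alpha> / (1 - a)" using a by (simp add: m_def)
        ultimately show ?thesis using a by (simp add: m_def L_def a_def)
      qed
      then show "\<forall>\<^sub>F n in sequentially. norm (measure \<mu> {S n..<1} * ln (exp 1 / (1 - S n)) powr ?\<alpha> / (1 - S n) powr 1) \<le> 8 * C * N (y n)"
        by simp
    qed
  qed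
  then show ?thesis
    unfolding vanishing_log_carleson_def by (intro tendsto_at_left_sequentially[of "7/8"]) auto
qed

theorem theorem3p2:
  fixes p q s :: real
    and X :: "(complex \<Rightarrow> complex) set"
    and N :: "(complex \<Rightarrow> complex) \<Rightarrow> real"
    and \<mu> :: "real measure"
  assumes "1 < p" and "1 < s" and "1 / p + 1 / q = 1"
    and "banach_space_of_analytic_functions X N"
    and "mean_lipschitz_space s \<subseteq> X" and "X \<subseteq> bloch_space"
    and "finite_borel_measure_01 \<mu>"
  shows "compact_operator (besov_space p) (besov_norm p) X N (cesaro_op \<mu>) \<longleftrightarrow>
         vanishing_log_carleson (1 / q) 1 \<mu>"
proof -
  have q: "1 / q = 1 - 1 / p" using assms(3) by simp
  show ?thesis
    unfolding q
    using compact_cesaro_op_if_vanishing[OF assms(1,2,4,5,7)]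
      vanishing_if_compact_cesaro_op[OF assms(1,4,6,7)] by blast
qed

end
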